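(* For each integer $n\ge1$ there is a constant $C_n>0$, independent of $t$ and of the initial data, such that the following holds. Let $u_0\in H^1(\mathbf{R}^n)\cap L^1(\mathbf{R}^n)$ and $u_1\in L^2(\mathbf{R}^n)\cap L^{1,1}(\mathbf{R}^n)$, and let $u\in C([0,\infty);H^1(\mathbf{R}^n))\cap C^1([0,\infty);L^2(\mathbf{R}^n))$ be the unique mild solution of $$u_{tt}-\Delta u+\log(I-\Delta)u_t=0\ \text{ in } (0,\infty)\times\mathbf{R}^n,\qquad u(0,\cdot)=u_0,\quad u_t(0,\cdot)=u_1.$$ Put $P_1:=\int_{\mathbf{R}^n}u_1(x)\,dx$ and $I_0:=\Vert u_0\Vert_{L^2}+\Vert u_1\Vert_{L^2}+\Vert u_0\Vert_{L^1}+\Vert(1+|x|)u_1\Vert_{L^1}$. Then there exists $t_0>1$ (which may depend on $n$ and on the data) such that for all $t\ge t_0$: (i) if $n\ge3$, then $C_n|P_1|\,t^{-\frac{n-2}{4}}\le\Vert u(t,\cdot)\Vert_{L^2}\le C_n^{-1}I_0\,t^{-\frac{n-2}{4}}$; (ii) if $n=2$, then $C_2|P_1|\sqrt{\log t}\le\Vert u(t,\cdot)\Vert_{L^2}\le C_2^{-1}I_0\sqrt{\log t}$; (iii) if $n=1$, then $C_1|P_1|\sqrt t\le\Vert u(t,\cdot)\Vert_{L^2}\le C_1^{-1}I_0\sqrt t$.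
   Context: Fourier transform: $\hat f(\xi)=\int_{\mathbf{R}^n}e^{-ix\cdot\xi}f(x)\,dx$, with inverse $\mathcal{F}^{-1}_{\xi\to x}$. The operator $L=\log(I-\Delta)$ is the Fourier multiplier $Lf=\mathcal{F}^{-1}_{\xi\to x}(\log(1+|\xi|^2)\hat f(\xi))$ with domain $\{f\in L^2(\mathbf{R}^n):\int(\log(1+|\xi|^2))^2|\hat f(\xi)|^2d\xi<\infty\}$; it is nonnegative and self-adjoint in $L^2(\mathbf{R}^n)$. The weighted space is $L^{1,1}(\mathbf{R}^n)=\{f\in L^1(\mathbf{R}^n):\int(1+|x|)|f(x)|dx<\infty\}$. The mild solution is the first component of $e^{t\mathcal{A}}[u_0,u_1]$, where $e^{t\mathcal A}$ is the $C_0$-semigroup on $H^1(\mathbf{R}^n)\times L^2(\mathbf{R}^n)$ generated by $\mathcal{A}[u,v]=[v,\Delta u-Lv]$, $D(\mathcal{A})=H^2(\mathbf{R}^n)\times H^1(\mathbf{R}^n)$. In Fourier space, for a.e. $\xi$, $\hat u(\cdot,\xi)$ solves the ODE $\hat u_{tt}+\log(1+|\xi|^2)\hat u_t+|\xi|^2\hat u=0$ with $\hat u(0,\xi)=\hat u_0(\xi)$, $\hat u_t(0,\xi)=\hat u_1(\xi)$. *)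

theory Defs
  imports "HOL-Analysis.Analysis" "HOL-Library.Function_Algebras"
begin

text \<open>
  Elements of a Lebesgue or Sobolev space are represented by Borel functions
  \<open>f :: 'a \<Rightarrow> complex\<close>, two representatives being identified when they agree almost
  everywhere, i.e. when the (semi)norm of their difference vanishes. Every Lebesgue class has
  a Borel representative. With the pointwise real vector space structure on functions, the
  semigroup notions below can be stated for a carrier \<open>X\<close> with a seminorm \<open>N\<close> in any
  real vector space; equality in the associated normed space reads \<open>N (x - y) = 0\<close>.
\<close>

instantiation "fun" :: (type, real_vector) real_vector
begin

definition scaleR_fun :: "real \<Rightarrow> ('a \<Rightarrow> 'b) \<Rightarrow> 'a \<Rightarrow> 'b" where
  "scaleR_fun c f = (\<lambda>x. c *\<^sub>R f x)"

instance
  by standard (auto simp: scaleR_fun_def fun_eq_iff scaleR_add_right scaleR_add_left)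

end

subsection \<open>Lebesgue spaces\<close>

definition L2 :: "('a::euclidean_space \<Rightarrow> complex) set" where
  "L2 = {f. f \<in> borel_measurable lborel \<and> integrable lborel (\<lambda>x. (cmod (f x))\<^sup>2)}"

text \<open>Meaningful on \<open>L2\<close> only: the Bochner integral of a non-integrable function is 0.\<close>

definition L2_norm :: "('a::euclidean_space \<Rightarrow> complex) \<Rightarrow> real" where
  "L2_norm f = sqrt (\<integral>x. (cmod (f x))\<^sup>2 \<partial>lborel)"

definition L1 :: "('a::euclidean_space \<Rightarrow> complex) set" where
  "L1 = {f. integrable lborel f}"

definition L1_norm :: "('a::euclidean_space \<Rightarrow> complex) \<Rightarrow> real" where
  "L1_norm f = (\<integral>x. cmod (f x) \<partial>lborel)"

definition L11 :: "('a::euclidean_space \<Rightarrow> complex) set" where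
  "L11 = {f \<in> L1. integrable lborel (\<lambda>x. (1 + norm x) * cmod (f x))}"

subsection \<open>Fourier transform\<close>

definition fourier :: "('a::euclidean_space \<Rightarrow> complex) \<Rightarrow> 'a \<Rightarrow> complex" where
  "fourier f \<xi> = (\<integral>x. exp (- \<i> * complex_of_real (x \<bullet> \<xi>)) * f x \<partial>lborel)"

text \<open>
  The Fourier--Plancherel transform on \<open>L2\<close>, i.e. the continuous extension of
  \<^term>\<open>fourier\<close> from \<open>L1 \<inter> L2\<close> to \<open>L2\<close>: the limit in \<open>L2\<close> of the
  transforms of the truncations of \<open>f\<close> to balls, which lie in \<open>L1 \<inter> L2\<close>. The limit is
  unique almost everywhere, and the choice operator picks a representative.
\<close>

definition fourier_L2 :: "('a::euclidean_space \<Rightarrow> complex) \<Rightarrow> 'a \<Rightarrow> complex" where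
  "fourier_L2 f = (SOME g. g \<in> L2 \<and>
     ((\<lambda>R::real. L2_norm (fourier (\<lambda>x. if norm x \<le> R then f x else 0) - g)) \<longlongrightarrow> 0) at_top)"

definition inv_fourier_L2 :: "('a::euclidean_space \<Rightarrow> complex) \<Rightarrow> 'a \<Rightarrow> complex" where
  "inv_fourier_L2 g = (SOME f. f \<in> L2 \<and> (AE \<xi> in lborel. fourier_L2 f \<xi> = g \<xi>))"

text \<open>Applied only where \<open>m\<close> times the transform of \<open>f\<close> is square integrable.\<close>

definition fourier_multiplier ::
    "('a::euclidean_space \<Rightarrow> real) \<Rightarrow> ('a \<Rightarrow> complex) \<Rightarrow> 'a \<Rightarrow> complex" where
  "fourier_multiplier m f = inv_fourier_L2 (\<lambda>\<xi>. complex_of_real (m \<xi>) * fourier_L2 f \<xi>)"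

subsection \<open>Sobolev spaces and the operators \<open>\<Delta>\<close> and \<open>log (I - \<Delta>)\<close>\<close>

definition sobolev :: "real \<Rightarrow> ('a::euclidean_space \<Rightarrow> complex) set" where
  "sobolev s = {f \<in> L2. integrable lborel
     (\<lambda>\<xi>. (1 + (norm \<xi>)\<^sup>2) powr s * (cmod (fourier_L2 f \<xi>))\<^sup>2)}"

definition sobolev_norm :: "real \<Rightarrow> ('a::euclidean_space \<Rightarrow> complex) \<Rightarrow> real" where
  "sobolev_norm s f =
     sqrt (\<integral>\<xi>. (1 + (norm \<xi>)\<^sup>2) powr s * (cmod (fourier_L2 f \<xi>))\<^sup>2 \<partial>lborel)"

definition laplacian :: "('a::euclidean_space \<Rightarrow> complex) \<Rightarrow> 'a \<Rightarrow> complex" where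
  "laplacian = fourier_multiplier (\<lambda>\<xi>. - (norm \<xi>)\<^sup>2)"

definition log_operator :: "('a::euclidean_space \<Rightarrow> complex) \<Rightarrow> 'a \<Rightarrow> complex" where
  "log_operator = fourier_multiplier (\<lambda>\<xi>. ln (1 + (norm \<xi>)\<^sup>2))"

subsection \<open>Vector-valued functions on \<open>[0, \<infinity>)\<close> and \<open>C\<^sub>0\<close>-semigroups\<close>

definition continuous_into ::
    "'v::real_vector set \<Rightarrow> ('v \<Rightarrow> real) \<Rightarrow> (real \<Rightarrow> 'v) \<Rightarrow> bool" where
  "continuous_into X N u \<longleftrightarrow>
     (\<forall>t\<ge>0. u t \<in> X) \<and>
     (\<forall>t\<ge>0. ((\<lambda>s. N (u s - u t)) \<longlongrightarrow> 0) (at t within {0..}))"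

definition C1_into ::
    "'v::real_vector set \<Rightarrow> ('v \<Rightarrow> real) \<Rightarrow> (real \<Rightarrow> 'v) \<Rightarrow> bool" where
  "C1_into X N u \<longleftrightarrow>
     (\<forall>t\<ge>0. u t \<in> X) \<and>
     (\<exists>v. continuous_into X N v \<and>
        (\<forall>t\<ge>0. ((\<lambda>s. N ((1 / (s - t)) *\<^sub>R (u s - u t) - v t)) \<longlongrightarrow> 0) (at t within {0..})))"

definition C0_semigroup ::
    "'v::real_vector set \<Rightarrow> ('v \<Rightarrow> real) \<Rightarrow> (real \<Rightarrow> 'v \<Rightarrow> 'v) \<Rightarrow> bool" where
  "C0_semigroup X N S \<longleftrightarrow>
     (\<forall>t\<ge>0. \<forall>x\<in>X. S t x \<in> X) \<and>
     (\<forall>t\<ge>0. \<forall>x\<in>X. \<forall>y\<in>X. N (S t (x + y) - (S t x + S t y)) = 0) \<and>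
     (\<forall>t\<ge>0. \<forall>c. \<forall>x\<in>X. N (S t (c *\<^sub>R x) - c *\<^sub>R S t x) = 0) \<and>
     (\<forall>t\<ge>0. \<exists>M. \<forall>x\<in>X. N (S t x) \<le> M * N x) \<and>
     (\<forall>x\<in>X. N (S 0 x - x) = 0) \<and>
     (\<forall>s\<ge>0. \<forall>t\<ge>0. \<forall>x\<in>X. N (S (s + t) x - S s (S t x)) = 0) \<and>
     (\<forall>x\<in>X. ((\<lambda>t. N (S t x - x)) \<longlongrightarrow> 0) (at_right 0))"

definition infinitesimal_generator ::
    "'v::real_vector set \<Rightarrow> ('v \<Rightarrow> real) \<Rightarrow> (real \<Rightarrow> 'v \<Rightarrow> 'v) \<Rightarrow> ('v \<times> 'v) set" where
  "infinitesimal_generator X N S =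
     {(x, y). x \<in> X \<and> y \<in> X \<and>
        ((\<lambda>h. N ((1 / h) *\<^sub>R (S h x - x) - y)) \<longlongrightarrow> 0) (at_right 0)}"

text \<open>The operator \<open>A\<close> with domain \<open>D\<close> generates \<open>S\<close>: equality of graphs.\<close>

definition generates ::
    "'v::real_vector set \<Rightarrow> ('v \<Rightarrow> real) \<Rightarrow> 'v set \<Rightarrow> ('v \<Rightarrow> 'v) \<Rightarrow> (real \<Rightarrow> 'v \<Rightarrow> 'v) \<Rightarrow> bool" where
  "generates X N D A S \<longleftrightarrow>
     C0_semigroup X N S \<and>
     infinitesimal_generator X N S = {(x, y). x \<in> D \<and> y \<in> X \<and> N (y - A x) = 0}"

subsection \<open>The wave equation with logarithmic damping\<close>

type_synonym 'a state = "('a \<Rightarrow> complex) \<times> ('a \<Rightarrow> complex)"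

definition energy_space :: "'a::euclidean_space state set" where
  "energy_space = sobolev 1 \<times> L2"

definition energy_norm :: "'a::euclidean_space state \<Rightarrow> real" where
  "energy_norm = (\<lambda>(u, v). sqrt ((sobolev_norm 1 u)\<^sup>2 + (L2_norm v)\<^sup>2))"

definition wave_domain :: "'a::euclidean_space state set" where
  "wave_domain = sobolev 2 \<times> sobolev 1"

definition wave_operator :: "'a::euclidean_space state \<Rightarrow> 'a state" where
  "wave_operator = (\<lambda>(u, v). (v, laplacian u - log_operator v))"

definition mild_solution ::
    "('a::euclidean_space \<Rightarrow> complex) \<Rightarrow> ('a \<Rightarrow> complex) \<Rightarrow> (real \<Rightarrow> 'a \<Rightarrow> complex) \<Rightarrow> bool" where
  "mild_solution u0 u1 u \<longleftrightarrow>
     continuous_into (sobolev 1) (sobolev_norm 1) u \<and>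
     C1_into L2 L2_norm u \<and>
     (\<exists>S. generates energy_space energy_norm wave_domain wave_operator S \<and>
        (\<forall>t\<ge>0. AE x in lborel. u t x = fst (S t (u0, u1)) x))"

definition data_size ::
    "('a::euclidean_space \<Rightarrow> complex) \<Rightarrow> ('a \<Rightarrow> complex) \<Rightarrow> real" where
  "data_size u0 u1 = L2_norm u0 + L2_norm u1 + L1_norm u0
     + L1_norm (\<lambda>x. complex_of_real (1 + norm x) * u1 x)"

end

theory Submission
  imports Defs "HOL-Probability.Probability"
begin

text \<open>
  Any semigroup generated by the operator is identified in Fourier space: for band-limited data the
  explicit solution of the ODE is a classical solution, so uniqueness for semigroups applies, and
  band-limited data are dense. The frequency of the mode \<open>\<xi>\<close> is
  \<open>\<omega> = sqrt (r\<^sup>2 - log\<^sup>2 (1 + r\<^sup>2) / 4)\<close> with \<open>r = \<bar>\<xi>\<bar>\<close>, real because \<open>log (1 + r\<^sup>2) \<le> r\<close>,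
  and \<open>r - \<omega> \<le> r\<^sup>3 / 4\<close>. Hence, with \<open>I\<^sub>0\<close> the size of the data,
  the transform of \<open>u(t)\<close> differs from \<open>P\<^sub>1 (1 + r\<^sup>2)\<^bsup>-t/2\<^esup> sin (r t) / r\<close> by at most
  \<open>4 I\<^sub>0 (1 + r\<^sup>2)\<^bsup>-t/4\<^esup>\<close>, whose norm is smaller by the factor \<open>t\<^bsup>-1/2\<^esup>\<close> than that of the profile
  \<open>(1 + r\<^sup>2)\<^bsup>-t/2\<^esup> sin (r t) / r\<close>. The norm of the profile is computed in polar coordinates.
\<close>

subsection \<open>The space \<open>L\<^sup>2\<close>\<close>

text \<open>Of the semigroup \<open>S\<close> in \<open>mild_solution\<close> only the generator is
  known, and its algebraic laws hold modulo null functions; so the graph of the generator has to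
  determine the orbits. Uniqueness needs the norms of \<open>S t\<close> bounded locally uniformly
  in \<open>t\<close>, whereas \<open>C0_semigroup\<close> bounds each \<open>S t\<close>
  separately; hence the uniform boundedness principle, in a form for seminorms. Restricting to |xi|
  <= R makes all symbols bounded, so Taylor's formula is uniform over the modes and the explicit
  solution is differentiable in the energy norm.

  The error bound arises as follows. By the weight 1 + |x| the transform of u1 differs from P1 by
  O(r), which cancels the factor 1/r of the propagator. Replacing the frequency by r costs a factor
  t r^2, and half of the damping absorbs it, since t r^2 <= 4 (1 + r^2)^(t/4) for t >= 4. The gain
  of t^(-1/2) leaves half of the profile in the lower bound once sqrt t exceeds a multiple of
  I0/|P1|; this is why t0 depends on the data while the constant does not.\<close>

lemma L2_borel: "f \<in> L2 \<Longrightarrow> f \<in> borel_measurable borel"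
  by (simp add: L2_def)

lemma L2_integrable: "f \<in> L2 \<Longrightarrow> integrable lborel (\<lambda>x. (cmod (f x))\<^sup>2)"
  by (simp add: L2_def)

lemma L2I:
  assumes "f \<in> borel_measurable borel" "(\<integral>\<^sup>+x. ennreal ((cmod (f x))\<^sup>2) \<partial>lborel) < \<infinity>"
  shows "f \<in> L2"
  using assms by (auto simp: L2_def integrable_iff_bounded)

lemma L2I_bound:
  assumes "f \<in> borel_measurable borel" "integrable lborel h" "AE x in lborel. (cmod (f x))\<^sup>2 \<le> h x"
  shows "f \<in> L2"
  using assms unfolding L2_def
  by (auto intro!: Bochner_Integration.integrable_bound[OF assms(2)] elim!: eventually_mono)

lemma L2_norm_nonneg [simp]: "0 \<le> L2_norm f"
  by (simp add: L2_norm_def)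

lemma L2_norm_sq: "(L2_norm f)\<^sup>2 = (\<integral>x. (cmod (f x))\<^sup>2 \<partial>lborel)"
  by (simp add: L2_norm_def)

lemma nn_integral_L2: "f \<in> L2 \<Longrightarrow> (\<integral>\<^sup>+x. ennreal ((cmod (f x))\<^sup>2) \<partial>lborel) = ennreal ((L2_norm f)\<^sup>2)"
  unfolding L2_norm_sq by (rule nn_integral_eq_integral) (auto simp: L2_def)

text \<open>Norm bounds are proved for the extended nonnegative integral, which never takes a
  default value; membership in \<open>L2\<close> and the bound on \<open>L2_norm\<close> then come
  together.\<close>

lemma L2_norm_le_nn:
  assumes "f \<in> borel_measurable borel" "(\<integral>\<^sup>+x. ennreal ((cmod (f x))\<^sup>2) \<partial>lborel) \<le> ennreal (c\<^sup>2)" "0 \<le> c"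
  shows "f \<in> L2" "L2_norm f \<le> c"
proof -
  show f: "f \<in> L2"
    using assms by (intro L2I) (auto intro: le_less_trans)
  have "ennreal ((L2_norm f)\<^sup>2) \<le> ennreal (c\<^sup>2)"
    using assms nn_integral_L2[OF f] by simp
  then have "(L2_norm f)\<^sup>2 \<le> c\<^sup>2"
    by (subst (asm) ennreal_le_iff) auto
  then show "L2_norm f \<le> c"
    using assms(3) by (rule power2_le_imp_le)
qed

lemma L2_norm_mono:
  assumes "g \<in> L2" "f \<in> borel_measurable borel" "AE x in lborel. cmod (f x) \<le> cmod (g x)"
  shows "f \<in> L2" "L2_norm f \<le> L2_norm g"
proof -
  have "(\<integral>\<^sup>+x. ennreal ((cmod (f x))\<^sup>2) \<partial>lborel) \<le> (\<integral>\<^sup>+x. ennreal ((cmod (g x))\<^sup>2) \<partial>lborel)"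
    using assms(3) by (intro nn_integral_mono_AE) (auto elim!: eventually_mono intro!: ennreal_leI power_mono)
  also have "\<dots> = ennreal ((L2_norm g)\<^sup>2)"
    by (rule nn_integral_L2[OF assms(1)])
  finally show "f \<in> L2" "L2_norm f \<le> L2_norm g"
    using L2_norm_le_nn[OF assms(2)] by auto
qed

lemma L2_norm_cong:
  assumes "AE x in lborel. f x = g x" "f \<in> borel_measurable borel" "g \<in> borel_measurable borel"
  shows "L2_norm f = L2_norm g"
  unfolding L2_norm_def using assms
  by (intro arg_cong[where f=sqrt] integral_cong_AE) (auto elim: eventually_mono)

lemma L2_cong:
  assumes "f \<in> L2" "AE x in lborel. f x = g x" "g \<in> borel_measurable borel"
  shows "g \<in> L2"
  using assms by (intro L2_norm_mono(1)[OF assms(1)]) (auto elim: eventually_mono)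

lemma L2_zero [simp]: "0 \<in> L2"
  by (simp add: L2_def zero_fun_def)

lemma L2_norm_zero [simp]: "L2_norm 0 = 0"
  by (simp add: L2_norm_def zero_fun_def)

lemmas L2_zero' [simp] = L2_zero[unfolded zero_fun_def] L2_norm_zero[unfolded zero_fun_def]

lemma L2_add:
  assumes "f \<in> L2" "g \<in> L2" shows "f + g \<in> L2"
proof (rule L2I_bound)
  show "f + g \<in> borel_measurable borel"
    using assms[THEN L2_borel] by (simp add: plus_fun_def)
  show "integrable lborel (\<lambda>x. 2 * (cmod (f x))\<^sup>2 + 2 * (cmod (g x))\<^sup>2)"
    using assms by (auto intro!: Bochner_Integration.integrable_add integrable_mult_right L2_integrable)
  have "(cmod (a + b))\<^sup>2 \<le> 2 * (cmod a)\<^sup>2 + 2 * (cmod b)\<^sup>2" for a b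
  proof -
    have "(cmod (a + b))\<^sup>2 \<le> (cmod a + cmod b)\<^sup>2"
      by (intro power_mono norm_triangle_ineq) auto
    also have "\<dots> \<le> 2 * (cmod a)\<^sup>2 + 2 * (cmod b)\<^sup>2"
      using zero_le_power2[of "cmod a - cmod b"] by (simp add: power2_eq_square algebra_simps)
    finally show ?thesis .
  qed
  then show "AE x in lborel. (cmod ((f + g) x))\<^sup>2 \<le> 2 * (cmod (f x))\<^sup>2 + 2 * (cmod (g x))\<^sup>2"
    by simp
qed

lemma L2_cmult: "f \<in> L2 \<Longrightarrow> (\<lambda>x. c * f x) \<in> L2"
  by (auto simp: L2_def norm_mult power_mult_distrib)

lemma L2_norm_cmult: "L2_norm (\<lambda>x. c * f x) = cmod c * L2_norm f"
  by (simp add: L2_norm_def norm_mult power_mult_distrib real_sqrt_mult)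

lemma L2_scaleR: "f \<in> L2 \<Longrightarrow> c *\<^sub>R f \<in> L2"
  using L2_cmult[of f "complex_of_real c"] by (simp add: scaleR_fun_def scaleR_conv_of_real)

lemma L2_norm_scaleR: "L2_norm (c *\<^sub>R f) = \<bar>c\<bar> * L2_norm f"
  using L2_norm_cmult[of "complex_of_real c"] by (simp add: scaleR_fun_def scaleR_conv_of_real)

lemma L2_uminus: "f \<in> L2 \<Longrightarrow> - f \<in> L2"
  using L2_scaleR[of f "-1"] by simp

lemma L2_diff: "f \<in> L2 \<Longrightarrow> g \<in> L2 \<Longrightarrow> f - g \<in> L2"
  using L2_add[of f "- g"] L2_uminus[of g] by (simp only: add_uminus_conv_diff)

lemma L2_cnj: "f \<in> L2 \<Longrightarrow> (\<lambda>x. cnj (f x)) \<in> L2"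
  by (auto simp: L2_def intro: borel_measurable_continuous_on[OF continuous_on_cnj[OF continuous_on_id]])

lemma L2_norm_cnj [simp]: "L2_norm (\<lambda>x. cnj (f x)) = L2_norm f"
  by (simp add: L2_norm_def)

lemma L2_Cauchy_Schwarz:
  assumes "f \<in> L2" "g \<in> L2"
  shows "integrable lborel (\<lambda>x. f x * g x)"
    and "(\<integral>x. cmod (f x) * cmod (g x) \<partial>lborel) \<le> L2_norm f * L2_norm g"
    and "cmod (\<integral>x. f x * g x \<partial>lborel) \<le> L2_norm f * L2_norm g"
proof -
  note [measurable] = assms[THEN L2_borel]
  have "(\<integral>\<^sup>+x. ennreal (cmod (f x)) * ennreal (cmod (g x)) \<partial>lborel)\<^sup>2
      \<le> (\<integral>\<^sup>+x. (ennreal (cmod (f x)))\<^sup>2 \<partial>lborel) * (\<integral>\<^sup>+x. (ennreal (cmod (g x)))\<^sup>2 \<partial>lborel)"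
    by (intro Cauchy_Schwarz_nn_integral) measurable
  also have "\<dots> = ennreal ((L2_norm f * L2_norm g)\<^sup>2)"
    using assms by (simp add: ennreal_power nn_integral_L2 ennreal_mult[symmetric] power_mult_distrib)
  also have "\<dots> = (ennreal (L2_norm f * L2_norm g))\<^sup>2"
    by (simp add: ennreal_power)
  finally have sq: "(\<integral>\<^sup>+x. ennreal (cmod (f x) * cmod (g x)) \<partial>lborel)\<^sup>2 \<le> (ennreal (L2_norm f * L2_norm g))\<^sup>2"
    by (simp add: ennreal_mult)
  have *: "(\<integral>\<^sup>+x. ennreal (cmod (f x) * cmod (g x)) \<partial>lborel) \<le> ennreal (L2_norm f * L2_norm g)"
  proof (cases "\<integral>\<^sup>+x. ennreal (cmod (f x) * cmod (g x)) \<partial>lborel")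
    case (real r)
    then have "r\<^sup>2 \<le> (L2_norm f * L2_norm g)\<^sup>2"
      using sq by (simp add: ennreal_power)
    then have "r \<le> L2_norm f * L2_norm g"
      by (rule power2_le_imp_le) simp
    then show ?thesis
      using real by (simp add: ennreal_leI)
  next
    case top
    then show ?thesis
      using sq by (simp add: ennreal_power top_unique)
  qed
  show I: "integrable lborel (\<lambda>x. f x * g x)"
    using * by (intro integrableI_bounded) (auto simp: norm_mult intro: le_less_trans)
  then have I': "integrable lborel (\<lambda>x. cmod (f x) * cmod (g x))"
    using integrable_norm[OF I] by (simp add: norm_mult)
  show 1: "(\<integral>x. cmod (f x) * cmod (g x) \<partial>lborel) \<le> L2_norm f * L2_norm g"
    using * by (simp add: nn_integral_eq_integral[OF I'])
  have "cmod (\<integral>x. f x * g x \<partial>lborel) \<le> (\<integral>x. cmod (f x * g x) \<partial>lborel)"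
    by (rule integral_norm_bound)
  with 1 show "cmod (\<integral>x. f x * g x \<partial>lborel) \<le> L2_norm f * L2_norm g"
    by (simp add: norm_mult)
qed

lemma L2_triangle:
  assumes "f \<in> L2" "g \<in> L2"
  shows "L2_norm (f + g) \<le> L2_norm f + L2_norm g"
proof -
  have I: "integrable lborel (\<lambda>x. cmod (f x) * cmod (g x))"
    using integrable_norm[OF L2_Cauchy_Schwarz(1)[OF assms]] by (simp add: norm_mult)
  note II = L2_integrable[OF assms(1)] L2_integrable[OF assms(2)]
  have "(L2_norm (f + g))\<^sup>2 = (\<integral>x. (cmod (f x + g x))\<^sup>2 \<partial>lborel)"
    by (simp add: L2_norm_sq)
  also have "\<dots> \<le> (\<integral>x. (cmod (f x))\<^sup>2 + 2 * (cmod (f x) * cmod (g x)) + (cmod (g x))\<^sup>2 \<partial>lborel)"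
  proof (rule integral_mono)
    show "integrable lborel (\<lambda>x. (cmod (f x + g x))\<^sup>2)"
      using L2_integrable[OF L2_add[OF assms]] by simp
    show "integrable lborel (\<lambda>x. (cmod (f x))\<^sup>2 + 2 * (cmod (f x) * cmod (g x)) + (cmod (g x))\<^sup>2)"
      using I II by auto
    fix x
    have "(cmod (f x + g x))\<^sup>2 \<le> (cmod (f x) + cmod (g x))\<^sup>2"
      by (intro power_mono norm_triangle_ineq) auto
    then show "(cmod (f x + g x))\<^sup>2 \<le> (cmod (f x))\<^sup>2 + 2 * (cmod (f x) * cmod (g x)) + (cmod (g x))\<^sup>2"
      by (simp add: power2_eq_square algebra_simps)
  qed
  also have "\<dots> = (L2_norm f)\<^sup>2 + 2 * (\<integral>x. cmod (f x) * cmod (g x) \<partial>lborel) + (L2_norm g)\<^sup>2"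
    using I II by (simp add: L2_norm_sq)
  also have "\<dots> \<le> (L2_norm f)\<^sup>2 + 2 * (L2_norm f * L2_norm g) + (L2_norm g)\<^sup>2"
    using L2_Cauchy_Schwarz(2)[OF assms] by simp
  also have "\<dots> = (L2_norm f + L2_norm g)\<^sup>2"
    by (simp add: power2_eq_square algebra_simps)
  finally show ?thesis
    by (rule power2_le_imp_le) simp
qed

lemma L2_norm_minus_commute: "L2_norm (f - g) = L2_norm (g - f)"
  by (simp add: L2_norm_def norm_minus_commute)

lemma L2_triangle_diff:
  assumes "f \<in> L2" "g \<in> L2" "h \<in> L2"
  shows "L2_norm (f - h) \<le> L2_norm (f - g) + L2_norm (g - h)"
  using L2_triangle[of "f - g" "g - h"] assms by (simp add: L2_diff)

lemma L2_norm_triangle_rev: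
  assumes "f \<in> L2" "g \<in> L2"
  shows "\<bar>L2_norm f - L2_norm g\<bar> \<le> L2_norm (f - g)"
  using L2_triangle[of "f - g" g] L2_triangle[of "g - f" f] assms L2_norm_minus_commute[of f g]
  by (simp add: L2_diff abs_le_iff)

section \<open>Limits, convergence theorems and completeness\<close>

lemma L2_norm_tendsto:
  assumes "\<And>k. u k \<in> L2" "g \<in> L2" "((\<lambda>k. L2_norm (u k - g)) \<longlongrightarrow> 0) F"
  shows "((\<lambda>k. L2_norm (u k)) \<longlongrightarrow> L2_norm g) F"
proof -
  have "((\<lambda>k. L2_norm (u k) - L2_norm g) \<longlongrightarrow> 0) F"
    by (rule Lim_null_comparison[OF _ assms(3)]) (simp add: L2_norm_triangle_rev assms)
  then show ?thesis
    by (simp add: LIM_zero_iff)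
qed

lemma L2_norm_eq_0_iff:
  assumes "f \<in> L2" shows "L2_norm f = 0 \<longleftrightarrow> (AE x in lborel. f x = 0)"
  using integral_nonneg_eq_0_iff_AE[OF L2_integrable[OF assms]] by (simp add: L2_norm_def)

lemma L2_norm_diff_eq_0_iff:
  assumes "f \<in> L2" "g \<in> L2" shows "L2_norm (f - g) = 0 \<longleftrightarrow> (AE x in lborel. f x = g x)"
  using L2_norm_eq_0_iff[OF L2_diff[OF assms]] by simp

lemma L2_limit_unique:
  assumes "\<And>k. u k \<in> L2" "g \<in> L2" "h \<in> L2" "F \<noteq> bot"
    and "((\<lambda>k. L2_norm (u k - g)) \<longlongrightarrow> 0) F" "((\<lambda>k. L2_norm (u k - h)) \<longlongrightarrow> 0) F"
  shows "AE x in lborel. g x = h x"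
proof -
  have "((\<lambda>k. L2_norm (u k - g) + L2_norm (u k - h)) \<longlongrightarrow> 0 + 0) F"
    by (intro tendsto_add assms)
  moreover have "L2_norm (g - h) \<le> L2_norm (u k - g) + L2_norm (u k - h)" for k
    using L2_triangle_diff[of g "u k" h] assms(1-3) L2_norm_minus_commute[of g "u k"] by simp
  ultimately have "L2_norm (g - h) \<le> 0"
    using assms(4) by (intro tendsto_lowerbound[where F=F and f="\<lambda>k. L2_norm (u k - g) + L2_norm (u k - h)"]) auto
  then have "L2_norm (g - h) = 0"
    using L2_norm_nonneg[of "g - h"] by simp
  then show ?thesis
    using assms by (simp add: L2_norm_diff_eq_0_iff)
qed

text \<open>Almost everywhere |f| <= |G| as well, so |u_k - f|^2 is dominated by the integrable
  function 4 |G|^2.\<close>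

lemma L2_dominated_convergence:
  fixes u :: "nat \<Rightarrow> 'a::euclidean_space \<Rightarrow> complex"
  assumes "\<And>k. u k \<in> borel_measurable borel" "f \<in> borel_measurable borel" "G \<in> L2"
    and "\<And>k. AE x in lborel. cmod (u k x) \<le> cmod (G x)"
    and "AE x in lborel. (\<lambda>k. u k x) \<longlonglongrightarrow> f x"
  shows "f \<in> L2" "(\<lambda>k. L2_norm (u k - f)) \<longlonglongrightarrow> 0"
proof -
  have fG: "AE x in lborel. cmod (f x) \<le> cmod (G x)"
  proof -
    have "AE x in lborel. \<forall>k. cmod (u k x) \<le> cmod (G x)"
      using assms(4) by (simp add: AE_all_countable)
    with assms(5) show ?thesis
    proof eventually_elim
      case (elim x)
      from elim(1) have "(\<lambda>k. cmod (u k x)) \<longlonglongrightarrow> cmod (f x)" by (rule tendsto_norm)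
      then show ?case by (rule tendsto_upperbound) (use elim in auto)
    qed
  qed
  then show "f \<in> L2"
    by (rule L2_norm_mono(1)[OF assms(3,2)])
  have "(\<lambda>k. \<integral>x. (cmod ((u k - f) x))\<^sup>2 \<partial>lborel) \<longlonglongrightarrow> (\<integral>x. 0 \<partial>(lborel :: 'a measure))"
  proof (rule integral_dominated_convergence[where w="\<lambda>x. 4 * (cmod (G x))\<^sup>2"])
    show "integrable lborel (\<lambda>x. 4 * (cmod (G x))\<^sup>2)"
      using L2_integrable[OF assms(3)] by simp
    show "(\<lambda>x. (cmod ((u k - f) x))\<^sup>2) \<in> borel_measurable lborel" for k
      using assms(1)[of k] assms(2) by simp
    show "AE x in lborel. (\<lambda>k. (cmod ((u k - f) x))\<^sup>2) \<longlonglongrightarrow> 0"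
      using assms(5)
    proof eventually_elim
      case (elim x)
      then have "(\<lambda>k. (cmod (u k x - f x))\<^sup>2) \<longlonglongrightarrow> (cmod (f x - f x))\<^sup>2"
        by (intro tendsto_intros)
      then show ?case by simp
    qed
    show "AE x in lborel. norm ((cmod ((u k - f) x))\<^sup>2) \<le> 4 * (cmod (G x))\<^sup>2" for k
      using assms(4)[of k] fG
    proof eventually_elim
      case (elim x)
      have "(cmod (u k x - f x))\<^sup>2 \<le> (2 * cmod (G x))\<^sup>2"
        using elim norm_triangle_ineq4[of "u k x" "f x"] by (intro power_mono) auto
      then show ?case by (simp add: power2_eq_square)
    qed
  qed auto
  then have "(\<lambda>k. sqrt (\<integral>x. (cmod ((u k - f) x))\<^sup>2 \<partial>lborel)) \<longlonglongrightarrow> sqrt 0"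
    by (intro tendsto_intros) simp
  then show "(\<lambda>k. L2_norm (u k - f)) \<longlonglongrightarrow> 0"
    by (simp add: L2_norm_def)
qed

text \<open>Fatou's lemma for the squares. The limit is only assumed measurable, and its square
  integrability is part of the conclusion; both completeness and the identification of limits rely
  on this.\<close>

lemma L2_norm_Fatou:
  fixes u :: "nat \<Rightarrow> 'a::euclidean_space \<Rightarrow> complex"
  assumes "\<And>k. u k \<in> L2" "\<And>k. L2_norm (u k) \<le> c" "g \<in> borel_measurable borel"
    and "AE x in lborel. (\<lambda>k. u k x) \<longlonglongrightarrow> g x"
  shows "g \<in> L2" "L2_norm g \<le> c"
proof -
  have c: "0 \<le> c" using L2_norm_nonneg[of "u 0"] assms(2)[of 0] by linarith
  have "(\<integral>\<^sup>+x. ennreal ((cmod (g x))\<^sup>2) \<partial>lborel) = (\<integral>\<^sup>+x. liminf (\<lambda>k. ennreal ((cmod (u k x))\<^sup>2)) \<partial>lborel)"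
  proof (rule nn_integral_cong_AE)
    show "AE x in lborel. ennreal ((cmod (g x))\<^sup>2) = liminf (\<lambda>k. ennreal ((cmod (u k x))\<^sup>2))"
      using assms(4)
    proof eventually_elim
      case (elim x)
      then have "(\<lambda>k. ennreal ((cmod (u k x))\<^sup>2)) \<longlonglongrightarrow> ennreal ((cmod (g x))\<^sup>2)"
        by (intro tendsto_intros)
      then show ?case
        by (intro lim_imp_Liminf[symmetric]) auto
    qed
  qed
  also have "\<dots> \<le> liminf (\<lambda>k. \<integral>\<^sup>+x. ennreal ((cmod (u k x))\<^sup>2) \<partial>lborel)"
    using assms(1)[THEN L2_borel] by (intro nn_integral_liminf) auto
  also have "\<dots> \<le> ennreal (c\<^sup>2)"
    using assms(1,2)
    by (intro Liminf_le always_eventually) (auto simp: nn_integral_L2 intro!: ennreal_leI power_mono)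
  finally show "g \<in> L2" "L2_norm g \<le> c"
    using L2_norm_le_nn[OF assms(3) _ c] by auto
qed

text \<open>The partial sums of |u_(k+1) - u_k| have norm at most the sum of 2^(-k), hence at most
  2. By monotone convergence the full sum is finite almost everywhere, and there the telescoping
  series converges absolutely.\<close>

lemma summable_L2_AE_convergent:
  fixes u :: "nat \<Rightarrow> 'a::euclidean_space \<Rightarrow> complex"
  assumes u: "\<And>k. u k \<in> L2" and b: "\<And>k. L2_norm (u (Suc k) - u k) \<le> (1/2)^k"
  shows "AE x in lborel. convergent (\<lambda>k. u k x)"
proof -
  define d where "d k x = cmod (u (Suc k) x - u k x)" for k x
  have [measurable]: "u k \<in> borel_measurable borel" for k using u L2_borel by auto
  define s where "s N = (\<lambda>x. complex_of_real (\<Sum>k<N. d k x))" for N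
  have d_meas[measurable]: "d k \<in> borel_measurable borel" for k
    unfolding d_def by measurable
  have dL: "(\<lambda>x. complex_of_real (d k x)) \<in> L2" and
    dn: "L2_norm (\<lambda>x. complex_of_real (d k x)) = L2_norm (u (Suc k) - u k)" for k
    using L2_diff[OF u[of "Suc k"] u[of k]] by (auto simp: d_def L2_def L2_norm_def)
  have sL: "s N \<in> L2 \<and> L2_norm (s N) \<le> 2" for N
  proof -
    have "s N \<in> L2 \<and> L2_norm (s N) \<le> (\<Sum>k<N. (1/2)^k)"
    proof (induction N)
      case 0
      have "s 0 = 0" by (simp add: s_def fun_eq_iff)
      then show ?case by simp
    next
      case (Suc N)
      have e: "s (Suc N) = s N + (\<lambda>x. complex_of_real (d N x))"
        by (simp add: s_def fun_eq_iff)
      show ?case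
        using Suc dn[of N] b[of N] L2_triangle[OF _ dL, of "s N" N] L2_add[OF _ dL, of "s N" N]
        unfolding e[symmetric] by simp
    qed
    moreover have "(\<Sum>k<N. (1/2)^k) \<le> (2::real)"
    proof -
      have "(\<Sum>k<N. (1/2)^k) = 2 - 2 * (1/2::real)^N"
        by (induction N) auto
      then show ?thesis by simp
    qed
    ultimately show ?thesis by linarith
  qed
  have "(\<integral>\<^sup>+x. (\<Squnion>N. ennreal ((\<Sum>k<N. d k x)\<^sup>2)) \<partial>lborel) = (\<Squnion>N. \<integral>\<^sup>+x. ennreal ((\<Sum>k<N. d k x)\<^sup>2) \<partial>lborel)"
  proof (rule nn_integral_monotone_convergence_SUP)
    show "incseq (\<lambda>i x. ennreal ((\<Sum>k<i. d k x)\<^sup>2))"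
      by (auto simp: incseq_def le_fun_def d_def intro!: ennreal_leI power_mono sum_mono2 sum_nonneg)
  qed measurable
  also have "\<dots> \<le> ennreal (2\<^sup>2)"
  proof (rule SUP_least)
    fix N
    have "ennreal ((L2_norm (s N))\<^sup>2) \<le> ennreal (2\<^sup>2)"
      using sL[of N] by (intro ennreal_leI power_mono) auto
    then show "(\<integral>\<^sup>+x. ennreal ((\<Sum>k<N. d k x)\<^sup>2) \<partial>lborel) \<le> ennreal (2\<^sup>2)"
      using nn_integral_L2[of "s N"] sL[of N] by (simp only: s_def norm_of_real power2_abs)
  qed
  finally have fin: "(\<integral>\<^sup>+x. (\<Squnion>N. ennreal ((\<Sum>k<N. d k x)\<^sup>2)) \<partial>lborel) \<noteq> \<infinity>"
    by (auto simp: top_unique)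
  have "AE x in lborel. (\<Squnion>N. ennreal ((\<Sum>k<N. d k x)\<^sup>2)) \<noteq> \<infinity>"
    by (rule nn_integral_PInf_AE[OF _ fin]) measurable
  then show ?thesis
  proof eventually_elim
    case (elim x)
    then obtain B where B: "(\<Squnion>N. ennreal ((\<Sum>k<N. d k x)\<^sup>2)) = ennreal B" "0 \<le> B"
      by (cases "(\<Squnion>N. ennreal ((\<Sum>k<N. d k x)\<^sup>2))") (auto simp: infinity_ennreal_def)
    have "(\<Sum>k<N. d k x) \<le> sqrt B" for N
    proof -
      have "ennreal ((\<Sum>k<N. d k x)\<^sup>2) \<le> ennreal B"
        unfolding B(1)[symmetric] by (rule SUP_upper) simp
      then show ?thesis using B(2) by (intro real_le_rsqrt) simp
    qed
    then have "(\<Sum>k\<le>n. d k x) \<le> sqrt B" for n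
      by (simp only: lessThan_Suc_atMost[symmetric])
    then have "summable (\<lambda>k. d k x)"
      by (intro bounded_imp_summable[where B="sqrt B"]) (auto simp: d_def)
    then have "summable (\<lambda>k. u (Suc k) x - u k x)"
      unfolding d_def by (rule summable_norm_cancel)
    then have "convergent (\<lambda>n. \<Sum>k<n. u (Suc k) x - u k x)"
      by (simp add: summable_iff_convergent)
    then have "convergent (\<lambda>n. u n x - u 0 x)"
      by (simp only: sum_lessThan_telescope[of "\<lambda>k. u k x"])
    then show ?case
      using convergent_add_const_right_iff[of "\<lambda>n. u n x" "- u 0 x"] by simp
  qed
qed

theorem L2_complete:
  fixes u :: "nat \<Rightarrow> 'a::euclidean_space \<Rightarrow> complex"
  assumes u: "\<And>k. u k \<in> L2"
    and c: "\<And>e. e > 0 \<Longrightarrow> \<exists>N. \<forall>m\<ge>N. \<forall>n\<ge>N. L2_norm (u m - u n) < e"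
  obtains g where "g \<in> L2" "(\<lambda>k. L2_norm (u k - g)) \<longlonglongrightarrow> 0"
proof -
  obtain N where N: "\<And>j m n. m \<ge> N j \<Longrightarrow> n \<ge> N j \<Longrightarrow> L2_norm (u m - u n) < (1/2)^j"
    using c[of "(1/2)^_"] by simp metis
  \<comment> \<open>Summing the \<open>N i\<close> and adding j makes r nondecreasing with r j >= N
    j, so no recursive choice of a subsequence is required.\<close>
  define r where "r j = (\<Sum>i\<le>j. N i) + j" for j
  have rN: "N j \<le> r j" for j
    unfolding r_def using member_le_sum[of j "{..j}" N] by simp
  have rmono: "r j \<le> r (Suc j)" for j
    unfolding r_def by simp
  have rN': "N j \<le> r (Suc j)" for j
    using rN[of j] rmono[of j] by simp
  have "AE x in lborel. convergent (\<lambda>k. u (r k) x)"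
    using N rN rN' by (intro summable_L2_AE_convergent u) (auto intro!: less_imp_le)
  define g where "g x = lim (\<lambda>k. u (r k) x)" for x
  have [measurable]: "u k \<in> borel_measurable borel" for k using u L2_borel by auto
  have g_meas[measurable]: "g \<in> borel_measurable borel"
    unfolding g_def by measurable
  have conv: "AE x in lborel. (\<lambda>k. u (r k) x) \<longlonglongrightarrow> g x"
    using \<open>AE x in lborel. convergent (\<lambda>k. u (r k) x)\<close>
    by eventually_elim (simp add: g_def convergent_LIMSEQ_iff)
  \<comment> \<open>Fatou for \<open>u m - u (r (k + j))\<close> as k grows gives membership of
    \<open>u m - g\<close> and the rate at once. It applies to every m >= N j, so the whole sequence
    is controlled and not only the subsequence.\<close>
  have key: "u m - g \<in> L2 \<and> L2_norm (u m - g) \<le> (1/2)^j" if "m \<ge> N j" for m j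
  proof -
    have "AE x in lborel. (\<lambda>k. (u m - u (r (k + j))) x) \<longlonglongrightarrow> (u m - g) x"
      using conv
    proof eventually_elim
      case (elim x)
      then show ?case
        by (auto intro!: tendsto_diff dest: LIMSEQ_ignore_initial_segment[where k=j])
    qed
    moreover have "L2_norm (u m - u (r (k + j))) \<le> (1/2)^j" for k
    proof -
      have "r j \<le> r (k + j)"
        using lift_Suc_mono_le[of r j "k + j"] rmono by simp
      then show ?thesis
        using that rN[of j] N[of j m "r (k + j)"] by simp
    qed
    moreover have "u m - g \<in> borel_measurable borel"
      by (simp add: fun_diff_def)
    ultimately show ?thesis
      using L2_norm_Fatou[of "\<lambda>k. u m - u (r (k + j))" "(1/2)^j" "u m - g"] u by (auto simp: L2_diff)
  qed
  show thesis
  proof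
    have "g = u (N 0) - (u (N 0) - g)" by simp
    then show "g \<in> L2" using key[of 0 "N 0"] u[of "N 0"] by (metis L2_diff order_refl)
    show "(\<lambda>k. L2_norm (u k - g)) \<longlonglongrightarrow> 0"
    proof (rule LIMSEQ_I)
      fix e :: real assume "0 < e"
      then obtain j where "(1/2)^j < e" using real_arch_pow_inv[of e "1/2"] by auto
      then show "\<exists>no. \<forall>n\<ge>no. norm (L2_norm (u n - g) - 0) < e"
        using key[of j] by (intro exI[of _ "N j"]) (auto intro: le_less_trans)
    qed
  qed
qed

subsection \<open>Fourier transform and Plancherel on \<open>L\<^sup>1 \<inter> L\<^sup>2\<close>\<close>

lemma nn_integral_euclidean_affine:
  fixes f :: "'a::euclidean_space \<Rightarrow> ennreal"
  assumes "f \<in> borel_measurable borel" "c \<noteq> 0"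
  shows "(\<integral>\<^sup>+x. f x \<partial>lborel) = ennreal (\<bar>c\<bar> ^ DIM('a)) * (\<integral>\<^sup>+x. f (t + c *\<^sub>R x) \<partial>lborel)"
  using assms
  by (subst lborel_affine[of c t]) (simp_all add: nn_integral_density nn_integral_distr nn_integral_cmult ennreal_power)

lemma integrable_euclidean_affine:
  fixes f :: "'a::euclidean_space \<Rightarrow> 'b::{banach, second_countable_topology}"
  assumes "integrable lborel f" "c \<noteq> 0"
  shows "integrable lborel (\<lambda>x. f (t + c *\<^sub>R x))"
proof -
  have [measurable]: "f \<in> borel_measurable borel"
    using assms(1) by (simp add: integrable_iff_bounded)
  have "ennreal (\<bar>c\<bar> ^ DIM('a)) * (\<integral>\<^sup>+x. norm (f (t + c *\<^sub>R x)) \<partial>lborel) < \<infinity>"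
    using assms nn_integral_euclidean_affine[of "\<lambda>x. norm (f x)" c t] by (simp add: integrable_iff_bounded)
  then show ?thesis
    using assms(2) unfolding integrable_iff_bounded by (auto simp: ennreal_mult_less_top)
qed

lemma integral_euclidean_affine:
  fixes f :: "'a::euclidean_space \<Rightarrow> 'b::{banach, second_countable_topology}"
  assumes "f \<in> borel_measurable borel" "c \<noteq> 0"
  shows "(\<integral>x. f x \<partial>lborel) = (\<bar>c\<bar> ^ DIM('a)) *\<^sub>R (\<integral>x. f (t + c *\<^sub>R x) \<partial>lborel)"
  using assms
  by (subst lborel_affine[of c t]) (simp_all add: integral_density integral_distr)

lemma integral_reflect_translate:
  fixes f :: "'a::euclidean_space \<Rightarrow> 'b::{banach, second_countable_topology}"
  assumes "f \<in> borel_measurable borel"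
  shows "(\<integral>x. f (t - x) \<partial>lborel) = (\<integral>x. f x \<partial>lborel)"
  using integral_euclidean_affine[OF assms, of "-1" t] by simp

lemma integral_translate:
  fixes f :: "'a::euclidean_space \<Rightarrow> 'b::{banach, second_countable_topology}"
  assumes "f \<in> borel_measurable borel"
  shows "(\<integral>x. f (x - t) \<partial>lborel) = (\<integral>x. f x \<partial>lborel)"
  using integral_euclidean_affine[OF assms, of 1 "- t"] by simp

lemma integrable_translate:
  fixes f :: "'a::euclidean_space \<Rightarrow> 'b::{banach, second_countable_topology}"
  assumes "integrable lborel f"
  shows "integrable lborel (\<lambda>x. f (x - t))"
  using integrable_euclidean_affine[OF assms, of 1 "- t"] by simp

section \<open>The Fourier integral of an integrable function\<close>

lemma L1_borel: "f \<in> L1 \<Longrightarrow> f \<in> borel_measurable borel"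
  by (simp add: L1_def integrable_iff_bounded)

lemma measurable_fourier_kernel [measurable]:
  "(\<lambda>p. exp (- \<i> * complex_of_real (fst p \<bullet> snd p)))
    \<in> borel_measurable (borel \<Otimes>\<^sub>M (borel :: 'a::euclidean_space measure))"
proof -
  have "continuous_on UNIV (\<lambda>p::'a \<times> 'a. exp (- \<i> * complex_of_real (fst p \<bullet> snd p)))"
    by (intro continuous_intros)
  then show ?thesis
    unfolding borel_prod by (rule borel_measurable_continuous_onI)
qed

lemma norm_fourier_kernel [simp]: "cmod (exp (- (\<i> * complex_of_real x))) = 1"
  using norm_exp_i_times[of "-x"] by simp

lemma fourier_measurable:
  assumes [measurable]: "f \<in> borel_measurable borel"
  shows "fourier f \<in> borel_measurable borel"
proof -
  have "(\<lambda>p. exp (- \<i> * complex_of_real (fst p \<bullet> snd p)) * f (fst p)) \<in> borel_measurable (borel \<Otimes>\<^sub>M borel)"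
    by measurable
  then have "(\<lambda>p. exp (- \<i> * complex_of_real (fst p \<bullet> snd p)) * f (fst p)) \<circ> (\<lambda>(x, y). (y, x))
      \<in> borel_measurable (borel \<Otimes>\<^sub>M lborel)"
    by (intro measurable_comp[OF _ _ ]) measurable
  then have "(\<lambda>(\<xi>, x). exp (- \<i> * complex_of_real (x \<bullet> \<xi>)) * f x) \<in> borel_measurable (borel \<Otimes>\<^sub>M lborel)"
    by (simp add: comp_def case_prod_beta)
  from lborel.borel_measurable_lebesgue_integral[OF this] show ?thesis
    unfolding fourier_def[abs_def] .
qed

lemma fourier_integrable:
  assumes "f \<in> L1"
  shows "integrable lborel (\<lambda>x. exp (- \<i> * complex_of_real (x \<bullet> \<xi>)) * f x)"
proof -
  have [measurable]: "f \<in> borel_measurable borel" using L1_borel[OF assms] .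
  have [measurable]: "(\<lambda>x. exp (- \<i> * complex_of_real (x \<bullet> \<xi>))) \<in> borel_measurable borel"
    by (intro borel_measurable_continuous_onI continuous_intros)
  show ?thesis
  proof (rule Bochner_Integration.integrable_bound)
    show "integrable lborel f"
      using assms by (simp add: L1_def)
    show "AE x in lborel. cmod (exp (- \<i> * complex_of_real (x \<bullet> \<xi>)) * f x) \<le> cmod (f x)"
      by (simp add: norm_mult)
  qed measurable
qed

lemma fourier_bound:
  assumes "f \<in> L1"
  shows "cmod (fourier f \<xi>) \<le> L1_norm f"
proof -
  have "cmod (fourier f \<xi>) \<le> (\<integral>x. cmod (exp (- \<i> * complex_of_real (x \<bullet> \<xi>)) * f x) \<partial>lborel)"
    unfolding fourier_def by (rule integral_norm_bound)
  then show ?thesis by (simp add: norm_mult L1_norm_def)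
qed

text \<open>Tonelli, with translation invariance in the inner integral. The shift by c x covers two
  kernels: c = 0 for products f(x) g(y), and c = 1 for the integrand of the autocorrelation.\<close>

lemma integrable_pair_lborel:
  fixes F :: "'a::euclidean_space \<times> 'a \<Rightarrow> complex"
  assumes "F \<in> borel_measurable (borel \<Otimes>\<^sub>M borel)" "integrable lborel f" "integrable lborel g"
    and "\<And>x y. cmod (F (x, y)) \<le> cmod (f x) * cmod (g (y - c *\<^sub>R x))"
  shows "integrable (lborel \<Otimes>\<^sub>M lborel) F"
proof (rule integrableI_bounded)
  have [measurable]: "f \<in> borel_measurable borel" "g \<in> borel_measurable borel"
    using assms(2,3) by (simp_all add: integrable_iff_bounded)
  have "(\<integral>\<^sup>+p. ennreal (cmod (F p)) \<partial>(lborel \<Otimes>\<^sub>M lborel))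
      \<le> (\<integral>\<^sup>+p. ennreal (cmod (f (fst p))) * ennreal (cmod (g (snd p - c *\<^sub>R fst p))) \<partial>(lborel \<Otimes>\<^sub>M lborel))"
    using assms(4) by (intro nn_integral_mono) (auto simp: ennreal_mult[symmetric] intro!: ennreal_leI)
  also have "\<dots> = (\<integral>\<^sup>+x. \<integral>\<^sup>+y. ennreal (cmod (f x)) * ennreal (cmod (g (y - c *\<^sub>R x))) \<partial>lborel \<partial>lborel)"
    by (subst lborel.nn_integral_fst[symmetric]) auto
  also have "\<dots> = (\<integral>\<^sup>+x. ennreal (cmod (f x)) * (\<integral>\<^sup>+y. ennreal (cmod (g y)) \<partial>lborel) \<partial>lborel)"
  proof (intro nn_integral_cong)
    fix x
    show "(\<integral>\<^sup>+y. ennreal (cmod (f x)) * ennreal (cmod (g (y - c *\<^sub>R x))) \<partial>lborel)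
        = ennreal (cmod (f x)) * (\<integral>\<^sup>+y. ennreal (cmod (g y)) \<partial>lborel)"
      using nn_integral_euclidean_affine[of "\<lambda>y. ennreal (cmod (g y))" 1 "- (c *\<^sub>R x)"]
      by (subst nn_integral_cmult) simp_all
  qed
  also have "\<dots> = (\<integral>\<^sup>+x. ennreal (cmod (f x)) \<partial>lborel) * (\<integral>\<^sup>+y. ennreal (cmod (g y)) \<partial>lborel)"
    by (rule nn_integral_multc) auto
  also have "\<dots> < \<infinity>"
    using assms(2,3) by (auto simp: integrable_iff_bounded ennreal_mult_less_top)
  finally show "(\<integral>\<^sup>+p. ennreal (cmod (F p)) \<partial>(lborel \<Otimes>\<^sub>M lborel)) < \<infinity>" .
qed (use assms(1) in simp)

text \<open>Fubini for the kernel exp(-i x.xi), which is symmetric in x and xi. It moves the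
  transform onto a test function whose transform is explicit.\<close>

lemma fourier_multiplication_formula:
  fixes f g :: "'a::euclidean_space \<Rightarrow> complex"
  assumes "f \<in> L1" "g \<in> L1"
  shows "(\<integral>\<xi>. fourier f \<xi> * g \<xi> \<partial>lborel) = (\<integral>x. f x * fourier g x \<partial>lborel)"
proof -
  note [measurable] = assms[THEN L1_borel]
  have "integrable (lborel \<Otimes>\<^sub>M lborel)
      (\<lambda>p. exp (- \<i> * complex_of_real (fst p \<bullet> snd p)) * f (fst p) * g (snd p))"
    using assms by (intro integrable_pair_lborel[of _ f g 0]) (auto simp: L1_def norm_mult)
  then have "(\<integral>\<xi>. (\<integral>x. exp (- \<i> * complex_of_real (x \<bullet> \<xi>)) * f x * g \<xi> \<partial>lborel) \<partial>lborel)
     = (\<integral>x. (\<integral>\<xi>. exp (- \<i> * complex_of_real (x \<bullet> \<xi>)) * f x * g \<xi> \<partial>lborel) \<partial>lborel)"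
    by (intro lborel_pair.Fubini_integral) (simp add: case_prod_beta')
  also have "(\<lambda>x. (\<integral>\<xi>. exp (- \<i> * complex_of_real (x \<bullet> \<xi>)) * f x * g \<xi> \<partial>lborel))
      = (\<lambda>x. f x * fourier g x)"
  proof (rule ext)
    fix x
    have "(\<integral>\<xi>. exp (- \<i> * complex_of_real (x \<bullet> \<xi>)) * f x * g \<xi> \<partial>lborel)
      = (\<integral>\<xi>. f x * (exp (- \<i> * complex_of_real (\<xi> \<bullet> x)) * g \<xi>) \<partial>lborel)"
      by (simp add: inner_commute mult_ac)
    also have "\<dots> = f x * fourier g x"
      unfolding fourier_def by (rule integral_mult_right_zero)
    finally show "(\<integral>\<xi>. exp (- \<i> * complex_of_real (x \<bullet> \<xi>)) * f x * g \<xi> \<partial>lborel) = f x * fourier g x" .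
  qed
  also have "(\<lambda>\<xi>. (\<integral>x. exp (- \<i> * complex_of_real (x \<bullet> \<xi>)) * f x * g \<xi> \<partial>lborel))
      = (\<lambda>\<xi>. fourier f \<xi> * g \<xi>)"
    unfolding fourier_def by simp
  finally show ?thesis .
qed

section \<open>Autocorrelation\<close>

definition autocorrelation :: "('a::euclidean_space \<Rightarrow> complex) \<Rightarrow> 'a \<Rightarrow> complex" where
  "autocorrelation f h = (\<integral>x. f x * cnj (f (x - h)) \<partial>lborel)"

lemma borel_measurable_cnj [measurable (raw)]:
  "f \<in> borel_measurable M \<Longrightarrow> (\<lambda>x. cnj (f x)) \<in> borel_measurable M"
  by (rule borel_measurable_continuous_on[OF continuous_on_cnj[OF continuous_on_id]])

text \<open>\<open>autocorrelation f\<close> is the convolution of \<open>f\<close> with its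
  conjugate reflection. Its transform is a squared modulus and its value at 0 is the squared L2
  norm, so the Plancherel identity becomes Fourier inversion for this one function at the
  origin.\<close>

lemma fourier_autocorrelation:
  fixes f :: "'a::euclidean_space \<Rightarrow> complex"
  assumes f: "f \<in> L1"
  shows "autocorrelation f \<in> L1"
    and "fourier (autocorrelation f) \<xi> = complex_of_real ((cmod (fourier f \<xi>))\<^sup>2)"
proof -
  note [measurable] = L1_borel[OF f]
  let ?G = "\<lambda>p. exp (- \<i> * complex_of_real (snd p \<bullet> \<xi>)) * (f (fst p) * cnj (f (fst p - snd p)))"
  have ex[measurable]: "(\<lambda>x. exp (- \<i> * complex_of_real (x \<bullet> \<xi>))) \<in> borel_measurable borel"
    by (intro borel_measurable_continuous_onI continuous_intros)
  \<comment> \<open>The reflection enters because \<open>f (x - h)\<close> is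
    \<open>g (h - x)\<close> with \<open>g y = f (- y)\<close>, the shape demanded by the case c =
    1.\<close>
  have rint: "integrable lborel (\<lambda>x. f (- x))"
    using integrable_euclidean_affine[of f "-1" 0] f by (simp add: L1_def)
  have int1: "integrable (lborel \<Otimes>\<^sub>M lborel) (\<lambda>p. f (fst p) * cnj (f (fst p - snd p)))"
    using f by (intro integrable_pair_lborel[OF _ _ rint, of _ f 1]) (auto simp: L1_def norm_mult)
  have int: "integrable (lborel \<Otimes>\<^sub>M lborel) ?G"
    by (intro Bochner_Integration.integrable_bound[OF int1]) (auto simp: norm_mult)
  from lborel_pair.integrable_snd[of "\<lambda>x h. f x * cnj (f (x - h))"] int1
  show "autocorrelation f \<in> L1"
    unfolding L1_def autocorrelation_def[abs_def] by (simp add: case_prod_beta')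
  have "fourier (autocorrelation f) \<xi>
      = (\<integral>h. (\<integral>x. exp (- \<i> * complex_of_real (h \<bullet> \<xi>)) * (f x * cnj (f (x - h))) \<partial>lborel) \<partial>lborel)"
    unfolding fourier_def autocorrelation_def by simp
  also have "\<dots> = (\<integral>x. (\<integral>h. exp (- \<i> * complex_of_real (h \<bullet> \<xi>)) * (f x * cnj (f (x - h))) \<partial>lborel) \<partial>lborel)"
    using int by (intro lborel_pair.Fubini_integral) (simp add: case_prod_beta')
  also have "\<dots> = (\<integral>x. exp (- \<i> * complex_of_real (x \<bullet> \<xi>)) * f x * cnj (fourier f \<xi>) \<partial>lborel)"
  proof (intro Bochner_Integration.integral_cong refl)
    fix x
    have "(\<integral>h. exp (- \<i> * complex_of_real (h \<bullet> \<xi>)) * (f x * cnj (f (x - h))) \<partial>lborel)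
       = (\<integral>y. exp (- \<i> * complex_of_real ((x - y) \<bullet> \<xi>)) * (f x * cnj (f y)) \<partial>lborel)"
      using integral_reflect_translate[of "\<lambda>y. exp (- \<i> * complex_of_real ((x - y) \<bullet> \<xi>)) * (f x * cnj (f y))" x]
      by simp
    also have "\<dots> = (\<integral>y. exp (- \<i> * complex_of_real (x \<bullet> \<xi>)) * f x
        * cnj (exp (- \<i> * complex_of_real (y \<bullet> \<xi>)) * f y) \<partial>lborel)"
    proof (intro Bochner_Integration.integral_cong refl)
      fix y
      have "exp (- \<i> * complex_of_real ((x - y) \<bullet> \<xi>))
          = exp (- \<i> * complex_of_real (x \<bullet> \<xi>)) * cnj (exp (- \<i> * complex_of_real (y \<bullet> \<xi>)))"
        by (simp add: exp_cnj inner_diff_left algebra_simps flip: exp_add)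
      then show "exp (- \<i> * complex_of_real ((x - y) \<bullet> \<xi>)) * (f x * cnj (f y))
        = exp (- \<i> * complex_of_real (x \<bullet> \<xi>)) * f x * cnj (exp (- \<i> * complex_of_real (y \<bullet> \<xi>)) * f y)"
        by (simp only: complex_cnj_mult mult_ac)
    qed
    also have "\<dots> = exp (- \<i> * complex_of_real (x \<bullet> \<xi>)) * f x * cnj (fourier f \<xi>)"
      unfolding fourier_def Bochner_Integration.integral_mult_right_zero Bochner_Integration.integral_cnj ..
    finally show "(\<integral>h. exp (- \<i> * complex_of_real (h \<bullet> \<xi>)) * (f x * cnj (f (x - h))) \<partial>lborel)
       = exp (- \<i> * complex_of_real (x \<bullet> \<xi>)) * f x * cnj (fourier f \<xi>)" .
  qed
  also have "\<dots> = fourier f \<xi> * cnj (fourier f \<xi>)"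
    unfolding fourier_def by (rule Bochner_Integration.integral_mult_left_zero)
  also have "\<dots> = complex_of_real ((cmod (fourier f \<xi>))\<^sup>2)"
    by (simp only: complex_norm_square[symmetric])
  finally show "fourier (autocorrelation f) \<xi> = complex_of_real ((cmod (fourier f \<xi>))\<^sup>2)" .
qed

lemma fourier_scale:
  fixes g :: "'a::euclidean_space \<Rightarrow> complex"
  assumes "g \<in> borel_measurable borel" "c > 0"
  shows "fourier (\<lambda>x. g (x /\<^sub>R c)) h = (c ^ DIM('a)) *\<^sub>R fourier g (c *\<^sub>R h)"
proof -
  have [measurable]: "g \<in> borel_measurable borel" by fact
  have ex[measurable]: "(\<lambda>x. exp (- \<i> * complex_of_real (x \<bullet> h))) \<in> borel_measurable borel"
    by (intro borel_measurable_continuous_onI continuous_intros)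
  show ?thesis
    unfolding fourier_def
    using assms(2) by (subst integral_euclidean_affine[of _ c 0]) auto
qed

section \<open>The Gaussian and its transform\<close>

definition gauss :: "'a::euclidean_space \<Rightarrow> real" where
  "gauss x = exp (- (norm x)\<^sup>2 / 2)"

lemma gauss_measurable [measurable]: "gauss \<in> borel_measurable borel"
  unfolding gauss_def[abs_def] by measurable

text \<open>This is the characteristic function of the standard normal distribution at -s, freed
  from the normalising factor 1/sqrt(2 pi).\<close>

lemma gauss_1D:
  "integrable lborel (\<lambda>x::real. exp (- \<i> * complex_of_real (x * s)) * complex_of_real (exp (- x\<^sup>2 / 2)))"
  "(\<integral>(x::real). exp (- \<i> * complex_of_real (x * s)) * complex_of_real (exp (- x\<^sup>2 / 2)) \<partial>lborel)
     = complex_of_real (sqrt (2 * pi) * exp (- s\<^sup>2 / 2))"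
proof -
  have [measurable]: "(\<lambda>x. exp (- \<i> * complex_of_real (x * s))) \<in> borel_measurable borel"
    by (intro borel_measurable_continuous_onI continuous_intros)
  have "integrable lborel (\<lambda>x. sqrt (2 * pi) * std_normal_density x)"
    using integrable_std_normal_moment[of 0] by (intro integrable_mult_right) simp
  then have i: "integrable lborel (\<lambda>x::real. exp (- x\<^sup>2 / 2))"
    by (simp add: std_normal_density_def)
  show "integrable lborel (\<lambda>x::real. exp (- \<i> * complex_of_real (x * s)) * complex_of_real (exp (- x\<^sup>2 / 2)))"
    by (rule Bochner_Integration.integrable_bound[OF i]) (auto simp: norm_mult)
  have "complex_of_real (exp (- s\<^sup>2 / 2)) = char std_normal_distribution (- s)"
    by (simp add: char_std_normal_distribution)
  also have "\<dots> = (\<integral>x. std_normal_density x *\<^sub>R iexp (- s * x) \<partial>lborel)"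
    unfolding char_def by (subst integral_density) auto
  also have "\<dots> = (\<integral>x. complex_of_real (1 / sqrt (2 * pi))
      * (exp (- \<i> * complex_of_real (x * s)) * complex_of_real (exp (- x\<^sup>2 / 2))) \<partial>lborel)"
    by (intro Bochner_Integration.integral_cong refl)
      (simp add: std_normal_density_def scaleR_conv_of_real mult_ac)
  also have "\<dots> = complex_of_real (1 / sqrt (2 * pi))
      * (\<integral>x. exp (- \<i> * complex_of_real (x * s)) * complex_of_real (exp (- x\<^sup>2 / 2)) \<partial>lborel)"
    by (rule integral_mult_right_zero)
  finally have "complex_of_real (sqrt (2 * pi)) * complex_of_real (exp (- s\<^sup>2 / 2))
    = complex_of_real (sqrt (2 * pi)) * (complex_of_real (1 / sqrt (2 * pi))
      * (\<integral>x. exp (- \<i> * complex_of_real (x * s)) * complex_of_real (exp (- x\<^sup>2 / 2)) \<partial>lborel))"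
    by simp
  also have "\<dots> = (\<integral>x. exp (- \<i> * complex_of_real (x * s)) * complex_of_real (exp (- x\<^sup>2 / 2)) \<partial>lborel)"
    by (simp flip: of_real_mult mult.assoc)
  finally show "(\<integral>(x::real). exp (- \<i> * complex_of_real (x * s)) * complex_of_real (exp (- x\<^sup>2 / 2)) \<partial>lborel)
     = complex_of_real (sqrt (2 * pi) * exp (- s\<^sup>2 / 2))"
    by simp
qed

lemma integral_lborel_prod:
  fixes f :: "'a::euclidean_space \<Rightarrow> real \<Rightarrow> complex"
  assumes "\<And>b. b \<in> Basis \<Longrightarrow> integrable lborel (f b)"
  shows "integrable lborel (\<lambda>x::'a. \<Prod>b\<in>Basis. f b (x \<bullet> b))"
    and "(\<integral>x. (\<Prod>b\<in>Basis. f b (x \<bullet> b)) \<partial>lborel) = (\<Prod>b\<in>Basis. (\<integral>x. f b x \<partial>lborel))"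
proof -
  interpret P: product_sigma_finite "\<lambda>_::'a. lborel :: real measure" ..
  have [measurable]: "b \<in> Basis \<Longrightarrow> f b \<in> borel_measurable borel" for b
    using assms[of b] by (simp add: integrable_iff_bounded)
  have m: "(\<lambda>x::'a. \<Prod>b\<in>Basis. f b (x \<bullet> b)) \<in> borel_measurable borel"
    by measurable
  have s: "(\<lambda>g. \<Prod>b\<in>Basis. f b ((\<Sum>b\<in>Basis. g b *\<^sub>R b) \<bullet> b)) = (\<lambda>g. \<Prod>b\<in>Basis. f b (g b))"
    by (intro ext prod.cong) (auto simp: inner_sum_left inner_Basis if_distrib cong: if_cong)
  have sm: "(\<lambda>g. \<Sum>b\<in>Basis. g b *\<^sub>R (b::'a)) \<in> measurable (Pi\<^sub>M Basis (\<lambda>_. lborel)) borel"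
    by measurable
  show "integrable lborel (\<lambda>x::'a. \<Prod>b\<in>Basis. f b (x \<bullet> b))"
    unfolding lborel_eq[where 'a='a]
    using P.product_integrable_prod[of Basis f] assms m sm
    by (subst integrable_distr_eq) (auto simp: s)
  show "(\<integral>x. (\<Prod>b\<in>Basis. f b (x \<bullet> b)) \<partial>lborel) = (\<Prod>b\<in>Basis. (\<integral>x. f b x \<partial>lborel))"
    unfolding lborel_eq[where 'a='a]
    using P.product_integral_prod[of Basis f] assms m sm
    by (subst integral_distr) (auto simp: s)
qed

lemma fourier_gauss:
  fixes z :: "'a::euclidean_space"
  shows "(\<lambda>x::'a. complex_of_real (gauss x)) \<in> L1"
    and "fourier (\<lambda>x. complex_of_real (gauss x)) z = complex_of_real (sqrt (2 * pi) ^ DIM('a) * gauss z)"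
proof -
  have g: "gauss x = (\<Prod>b\<in>Basis. exp (- (x \<bullet> b)\<^sup>2 / 2))" for x :: 'a
    unfolding gauss_def norm_eq_sqrt_inner
    by (subst euclidean_inner) (simp add: exp_sum[symmetric] sum_nonneg power2_eq_square sum_negf sum_divide_distrib)
  have e: "exp (- \<i> * complex_of_real (x \<bullet> z)) * complex_of_real (gauss x)
     = (\<Prod>b\<in>Basis. exp (- \<i> * complex_of_real ((x \<bullet> b) * (z \<bullet> b))) * complex_of_real (exp (- (x \<bullet> b)\<^sup>2 / 2)))" for x z :: 'a
  proof -
    have "exp (- \<i> * complex_of_real (x \<bullet> z)) = (\<Prod>b\<in>Basis. exp (- \<i> * complex_of_real ((x \<bullet> b) * (z \<bullet> b))))"
      by (subst euclidean_inner[of x z]) (simp add: exp_sum[symmetric] sum_distrib_left sum_negf)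
    then show ?thesis by (simp only: g of_real_prod prod.distrib)
  qed
  note i = integral_lborel_prod[where f="\<lambda>b t. exp (- \<i> * complex_of_real (t * (z \<bullet> b))) * complex_of_real (exp (- t\<^sup>2 / 2))" for z :: 'a,
      OF gauss_1D(1)]
  \<comment> \<open>At frequency 0 the oscillating factor is 1, so the product integrand is the
    Gaussian itself.\<close>
  from i(1)[of 0] e[of _ 0] show "(\<lambda>x::'a. complex_of_real (gauss x)) \<in> L1"
    by (simp add: L1_def)
  show "fourier (\<lambda>x. complex_of_real (gauss x)) z = complex_of_real (sqrt (2 * pi) ^ DIM('a) * gauss z)"
    unfolding fourier_def e i(2) gauss_1D(2) unfolding g by (simp add: prod.distrib)
qed

lemma integral_gauss: "(\<integral>x. gauss x \<partial>(lborel :: 'a::euclidean_space measure)) = sqrt (2 * pi) ^ DIM('a)"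
proof -
  have "complex_of_real (\<integral>x. gauss x \<partial>(lborel :: 'a measure)) = fourier (\<lambda>x::'a. complex_of_real (gauss x)) 0"
    by (simp add: fourier_def)
  also have "\<dots> = complex_of_real (sqrt (2 * pi) ^ DIM('a))"
    unfolding fourier_gauss by (simp add: gauss_def)
  finally show ?thesis by (simp only: of_real_eq_iff)
qed

section \<open>Continuity of translation in L1 and L2\<close>

lemma LIMSEQ_lessD:
  fixes X :: "nat \<Rightarrow> real"
  assumes "X \<longlonglongrightarrow> l" "l < e"
  obtains N where "\<And>n. n \<ge> N \<Longrightarrow> X n < e"
  using order_tendstoD(2)[OF assms] unfolding eventually_sequentially by blast

text \<open>A three-epsilon argument: by translation invariance the errors f - g at x and at x - h
  have the same integral. It serves both the base case and the limit case of the induction over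
  integrable functions.\<close>

lemma translation_continuous_L1_close:
  fixes f :: "'a::euclidean_space \<Rightarrow> 'b::{banach, second_countable_topology}"
  assumes f: "integrable lborel f"
    and close: "\<And>e. e > 0 \<Longrightarrow> \<exists>g. integrable lborel g \<and> (\<integral>x. norm (f x - g x) \<partial>lborel) < e \<and>
       (\<lambda>k. \<integral>x. norm (g x - g (x - h k)) \<partial>lborel) \<longlonglongrightarrow> 0"
  shows "(\<lambda>k. \<integral>x. norm (f x - f (x - h k)) \<partial>lborel) \<longlonglongrightarrow> 0"
proof (rule LIMSEQ_I)
  fix e :: real assume "0 < e"
  then obtain g where g: "integrable lborel g" and fg: "(\<integral>x. norm (f x - g x) \<partial>lborel) < e / 3"
    and lim: "(\<lambda>k. \<integral>x. norm (g x - g (x - h k)) \<partial>lborel) \<longlonglongrightarrow> 0"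
    using close[of "e / 3"] by auto
  note it = integrable_translate[OF f] integrable_translate[OF g]
  have [measurable]: "f \<in> borel_measurable borel" "g \<in> borel_measurable borel"
    using f g by (simp_all add: integrable_iff_bounded)
  obtain N where N: "\<And>k. k \<ge> N \<Longrightarrow> norm ((\<integral>x. norm (g x - g (x - h k)) \<partial>lborel) - 0) < e / 3"
    using LIMSEQ_D[OF lim, of "e / 3"] \<open>0 < e\<close> by auto
  show "\<exists>no. \<forall>k\<ge>no. norm ((\<integral>x. norm (f x - f (x - h k)) \<partial>lborel) - 0) < e"
  proof (intro exI[of _ N] allI impI)
    fix k assume "k \<ge> N"
    have "(\<integral>x. norm (f x - f (x - h k)) \<partial>lborel)
      \<le> (\<integral>x. norm (f x - g x) + norm (g x - g (x - h k)) + norm (f (x - h k) - g (x - h k)) \<partial>lborel)"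
    proof (rule integral_mono)
      fix x
      show "norm (f x - f (x - h k)) \<le> norm (f x - g x) + norm (g x - g (x - h k)) + norm (f (x - h k) - g (x - h k))"
        using norm_triangle_ineq4[of "(f x - g x) + (g x - g (x - h k))" "f (x - h k) - g (x - h k)"]
          norm_triangle_ineq[of "f x - g x" "g x - g (x - h k)"] by simp
    qed (use f g it in \<open>auto intro!: Bochner_Integration.integrable_add Bochner_Integration.integrable_norm Bochner_Integration.integrable_diff\<close>)
    also have "\<dots> = (\<integral>x. norm (f x - g x) \<partial>lborel) + (\<integral>x. norm (g x - g (x - h k)) \<partial>lborel)
        + (\<integral>x. norm (f (x - h k) - g (x - h k)) \<partial>lborel)"
      using f g it by simp
    also have "(\<integral>x. norm (f (x - h k) - g (x - h k)) \<partial>lborel) = (\<integral>x. norm (f x - g x) \<partial>lborel)"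
      by (rule integral_translate[of "\<lambda>x. norm (f x - g x)"]) measurable
    finally show "norm ((\<integral>x. norm (f x - f (x - h k)) \<partial>lborel) - 0) < e"
      using N[OF \<open>k \<ge> N\<close>] fg by simp
  qed
qed

text \<open>
  The positive and negative parts of \<open>1\<^sub>U(x) - 1\<^sub>U(x - h)\<close> have equal integrals, and the positive
  part vanishes near every point of \<open>U\<close> as \<open>h \<rightarrow> 0\<close>.
\<close>

lemma translation_continuous_open:
  fixes U :: "'a::euclidean_space set"
  assumes U: "open U" "emeasure lborel U < \<infinity>" and h: "h \<longlonglongrightarrow> 0"
  shows "(\<lambda>k. \<integral>x. norm (indicator U x - indicator U (x - h k) :: real) \<partial>lborel) \<longlonglongrightarrow> 0"
proof -
  have [measurable]: "U \<in> sets borel" using U by auto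
  have iU: "integrable lborel (indicator U :: 'a \<Rightarrow> real)"
    using U by simp
  let ?p = "\<lambda>k x. max 0 (indicator U x - indicator U (x - h k) :: real)"
  have it: "integrable lborel (\<lambda>x. indicator U (x - h k) :: real)" for k
    by (rule integrable_translate[OF iU])
  have ip: "integrable lborel (?p k)" for k
    using iU it[of k] by (intro Bochner_Integration.integrable_max) auto
  have lim: "(\<lambda>k. \<integral>x. ?p k x \<partial>lborel) \<longlonglongrightarrow> (\<integral>x. 0 \<partial>(lborel :: 'a measure))"
  proof (rule integral_dominated_convergence[where w="indicator U"])
    show "AE x in lborel. (\<lambda>k. ?p k x) \<longlonglongrightarrow> 0"
    proof (rule AE_I2)
      fix x :: 'a
      show "(\<lambda>k. ?p k x) \<longlonglongrightarrow> 0"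
      proof (cases "x \<in> U")
        case True
        have "(\<lambda>k. x - h k) \<longlonglongrightarrow> x - 0" by (intro tendsto_intros h)
        then have "\<forall>\<^sub>F k in sequentially. x - h k \<in> U"
          using topological_tendstoD[of "\<lambda>k. x - h k" x sequentially U] U True by simp
        then have "\<forall>\<^sub>F k in sequentially. ?p k x = 0"
          by eventually_elim (simp add: True)
        then show ?thesis by (simp add: tendsto_eventually)
      next
        case False
        then have "?p k x = 0" for k by (simp add: indicator_def)
        then show ?thesis by simp
      qed
    qed
    show "AE x in lborel. norm (?p k x) \<le> indicator U x" for k
      by (intro AE_I2) (auto simp: indicator_def)
  qed (use iU in measurable)
  have "(\<integral>x. norm (indicator U x - indicator U (x - h k) :: real) \<partial>lborel) = 2 * (\<integral>x. ?p k x \<partial>lborel)" for k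
  proof -
    have "(\<integral>x. norm (indicator U x - indicator U (x - h k) :: real) \<partial>lborel)
       = (\<integral>x. 2 * ?p k x - (indicator U x - indicator U (x - h k)) \<partial>lborel)"
      by (intro Bochner_Integration.integral_cong) (auto simp: max_def)
    also have "\<dots> = 2 * (\<integral>x. ?p k x \<partial>lborel) - ((\<integral>x. indicator U x \<partial>lborel) - (\<integral>x. indicator U (x - h k) \<partial>lborel))"
      using iU it[of k] ip[of k] by simp
    also have "(\<integral>x. indicator U (x - h k) \<partial>lborel) = (\<integral>x. (indicator U x :: real) \<partial>lborel)"
      by (rule integral_translate) measurable
    finally show ?thesis by simp
  qed
  with tendsto_mult_right_zero[of "\<lambda>k. \<integral>x. ?p k x \<partial>lborel" sequentially 2] lim show ?thesis
    by simp
qed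

text \<open>Induction over integrable functions reduces the claim to the indicator of a set of
  finite measure. Outer regularity replaces this set by an open one, where translations behave well
  pointwise.\<close>

lemma translation_continuous_L1:
  fixes f :: "'a::euclidean_space \<Rightarrow> 'b::{banach, second_countable_topology}"
  assumes f: "integrable lborel f" and h: "h \<longlonglongrightarrow> 0"
  shows "(\<lambda>k. \<integral>x. norm (f x - f (x - h k)) \<partial>lborel) \<longlonglongrightarrow> 0"
  using f
proof (induction rule: integrable_induct)
  case (base A c)
  have [measurable]: "A \<in> sets borel" using base by simp
  show ?case
  proof (rule translation_continuous_L1_close)
    show "integrable lborel (\<lambda>x. indicator A x *\<^sub>R c)"
      using base by (auto simp: integrable_indicator_iff)
    fix e :: real assume "0 < e"
    \<comment> \<open>The summand 1 avoids a division by zero when c = 0.\<close>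
    define e' where "e' = e / (norm c + 1)"
    have e': "e' > 0" using \<open>0 < e\<close> by (simp add: e'_def add_nonneg_pos)
    obtain U where U: "open U" "A \<subseteq> U" "emeasure lborel (U - A) < ennreal e'"
      using outer_regular_lborel[of A e'] e' by auto
    have [measurable]: "U \<in> sets borel" using U by auto
    have "emeasure lborel U = emeasure lborel A + emeasure lborel (U - A)"
      using U(2) by (subst plus_emeasure) (auto simp: Un_absorb1)
    then have finU: "emeasure lborel U < \<infinity>"
      using base(2) U(3) by (auto intro: order_less_trans)
    have mUA: "measure lborel (U - A) < e'"
    proof -
      have "emeasure lborel (U - A) = ennreal (measure lborel (U - A))"
        using U(3) by (intro emeasure_eq_ennreal_measure) auto
      then show ?thesis using U(3) by (simp add: ennreal_less_iff)
    qed
    show "\<exists>g. integrable lborel g \<and> (\<integral>x. norm (indicator A x *\<^sub>R c - g x) \<partial>lborel) < e \<and>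
       (\<lambda>k. \<integral>x. norm (g x - g (x - h k)) \<partial>lborel) \<longlonglongrightarrow> 0"
    proof (intro exI[of _ "\<lambda>x. indicator U x *\<^sub>R c"] conjI)
      show "integrable lborel (\<lambda>x. indicator U x *\<^sub>R c)"
        using finU by auto
      have "(\<integral>x. norm (indicator A x *\<^sub>R c - indicator U x *\<^sub>R c) \<partial>lborel) = (\<integral>x. indicator (U - A) x * norm c \<partial>lborel)"
        using U(2) by (intro Bochner_Integration.integral_cong) (auto simp: indicator_def)
      also have "\<dots> = measure lborel (U - A) * norm c"
        by simp
      also have "\<dots> \<le> e' * norm c"
        using mUA by (intro mult_right_mono) auto
      also have "\<dots> < e' * (norm c + 1)"
        using e' by simp
      also have "\<dots> = e"
        unfolding e'_def using norm_ge_zero[of c] by (simp add: add_nonneg_eq_0_iff)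
      finally show "(\<integral>x. norm (indicator A x *\<^sub>R c - indicator U x *\<^sub>R c) \<partial>lborel) < e" .
      have "(\<lambda>k. (\<integral>x. norm (indicator U x - indicator U (x - h k) :: real) \<partial>lborel) * norm c) \<longlonglongrightarrow> 0"
        by (rule tendsto_mult_left_zero[OF translation_continuous_open[OF U(1) finU h]])
      then show "(\<lambda>k. \<integral>x. norm (indicator U x *\<^sub>R c - indicator U (x - h k) *\<^sub>R c) \<partial>lborel) \<longlonglongrightarrow> 0"
        by (simp flip: scaleR_diff_left)
    qed
  qed
next
  case (add f g)
  have [measurable]: "f \<in> borel_measurable borel" "g \<in> borel_measurable borel"
    using add by (simp_all add: integrable_iff_bounded)
  note it = integrable_translate[OF add(1)] integrable_translate[OF add(2)]
  have "(\<lambda>k. (\<integral>x. norm (f x - f (x - h k)) \<partial>lborel) + (\<integral>x. norm (g x - g (x - h k)) \<partial>lborel)) \<longlonglongrightarrow> 0"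
    using tendsto_add[OF add(3,4)] by simp
  then show ?case
  proof (rule Lim_null_comparison[rotated], intro always_eventually allI)
    fix k
    have "(\<integral>x. norm (f x + g x - (f (x - h k) + g (x - h k))) \<partial>lborel)
      \<le> (\<integral>x. norm (f x - f (x - h k)) + norm (g x - g (x - h k)) \<partial>lborel)"
      using add(1,2) it
      by (intro integral_mono) (auto simp: add_diff_add intro: norm_triangle_ineq)
    also have "\<dots> = (\<integral>x. norm (f x - f (x - h k)) \<partial>lborel) + (\<integral>x. norm (g x - g (x - h k)) \<partial>lborel)"
      using add(1,2) it by simp
    finally show "norm (\<integral>x. norm (f x + g x - (f (x - h k) + g (x - h k))) \<partial>lborel)
       \<le> (\<integral>x. norm (f x - f (x - h k)) \<partial>lborel) + (\<integral>x. norm (g x - g (x - h k)) \<partial>lborel)"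
      by simp
  qed
next
  case (lim f s)
  show ?case
  proof (rule translation_continuous_L1_close[OF lim(4)])
    fix e :: real assume "0 < e"
    have [measurable]: "f \<in> borel_measurable borel" "s i \<in> borel_measurable borel" for i
      using lim(4) lim(1)[of i] by (simp_all add: integrable_iff_bounded)
    have "(\<lambda>i. \<integral>x. norm (f x - s i x) \<partial>lborel) \<longlonglongrightarrow> (\<integral>x. 0 \<partial>(lborel :: 'a measure))"
    proof (rule integral_dominated_convergence[where w="\<lambda>x. 3 * norm (f x)"])
      show "integrable lborel (\<lambda>x. 3 * norm (f x))" using lim(4) by simp
      show "AE x in lborel. (\<lambda>i. norm (f x - s i x)) \<longlonglongrightarrow> 0"
      proof (rule AE_I2)
        fix x :: 'a
        have "(\<lambda>i. norm (f x - s i x)) \<longlonglongrightarrow> norm (f x - f x)"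
          by (intro tendsto_intros lim(2)) auto
        then show "(\<lambda>i. norm (f x - s i x)) \<longlonglongrightarrow> 0" by simp
      qed
      show "AE x in lborel. norm (norm (f x - s i x)) \<le> 3 * norm (f x)" for i
      proof (rule AE_I2)
        fix x :: 'a
        show "norm (norm (f x - s i x)) \<le> 3 * norm (f x)"
          using lim(3)[of x i] norm_triangle_ineq4[of "f x" "s i x"] by simp
      qed
    qed measurable
    then have "\<exists>i. (\<integral>x. norm (f x - s i x) \<partial>lborel) < e"
      using \<open>0 < e\<close> by (auto elim!: LIMSEQ_lessD[of _ _ e])
    then show "\<exists>g. integrable lborel g \<and> (\<integral>x. norm (f x - g x) \<partial>lborel) < e \<and>
       (\<lambda>k. \<integral>x. norm (g x - g (x - h k)) \<partial>lborel) \<longlonglongrightarrow> 0"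
      using lim(1,5) by blast
  qed
qed

lemma L2_translate:
  assumes "f \<in> L2" shows "(\<lambda>x. f (x - t)) \<in> L2" "L2_norm (\<lambda>x. f (x - t)) = L2_norm f"
proof -
  have [measurable]: "f \<in> borel_measurable borel" using L2_borel[OF assms] .
  show "(\<lambda>x. f (x - t)) \<in> L2"
    using integrable_translate[OF L2_integrable[OF assms], of t] by (simp add: L2_def)
  show "L2_norm (\<lambda>x. f (x - t)) = L2_norm f"
    unfolding L2_norm_def by (subst integral_translate[of "\<lambda>x. (cmod (f x))\<^sup>2"]) auto
qed

text \<open>Cutting off both values and support yields bounded members of L1; boundedness is what
  turns an L1 estimate of differences into an L2 estimate.\<close>

lemma L2_bounded_approx:
  fixes f :: "'a::euclidean_space \<Rightarrow> complex"
  assumes f: "f \<in> L2"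
  obtains u where "\<And>k. u k \<in> L1" "\<And>k. u k \<in> L2" "\<And>k x. cmod (u k x) \<le> real k"
    "(\<lambda>k. L2_norm (u k - f)) \<longlonglongrightarrow> 0"
proof
  define u where "u k x = (if cmod (f x) \<le> real k \<and> norm x \<le> real k then f x else 0)" for k x
  have [measurable]: "f \<in> borel_measurable borel" using L2_borel[OF f] .
  have um[measurable]: "u k \<in> borel_measurable borel" for k
    unfolding u_def[abs_def] by measurable
  show uk: "u k \<in> L2" for k
    by (intro L2_norm_mono(1)[OF f]) (auto simp: u_def)
  show "cmod (u k x) \<le> real k" for k x by (simp add: u_def)
  show "u k \<in> L1" for k
  proof -
    have "integrable lborel (\<lambda>x::'a. indicator (cball 0 (real k)) x * real k)"
      using emeasure_lborel_cball_finite[of 0 "real k"] by (intro integrable_mult_left) auto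
    then show ?thesis
      unfolding L1_def mem_Collect_eq
      by (rule Bochner_Integration.integrable_bound) (auto simp: u_def indicator_def)
  qed
  show "(\<lambda>k. L2_norm (u k - f)) \<longlonglongrightarrow> 0"
  proof (rule L2_dominated_convergence(2)[OF _ _ f])
    show "AE x in lborel. (\<lambda>k. u k x) \<longlonglongrightarrow> f x"
    proof (rule AE_I2)
      fix x
      obtain N where "max (cmod (f x)) (norm x) \<le> real N" using real_arch_simple by blast
      then have "\<forall>\<^sub>F k in sequentially. u k x = f x"
        unfolding eventually_sequentially u_def by (intro exI[of _ N]) auto
      then show "(\<lambda>k. u k x) \<longlonglongrightarrow> f x" by (rule tendsto_eventually)
    qed
  qed (auto simp: u_def)
qed

lemma translation_continuous_L2:
  fixes f :: "'a::euclidean_space \<Rightarrow> complex"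
  assumes f: "f \<in> L2" and h: "h \<longlonglongrightarrow> 0"
  shows "(\<lambda>k. L2_norm (f - (\<lambda>x. f (x - h k)))) \<longlonglongrightarrow> 0"
proof (rule LIMSEQ_I)
  fix e :: real assume "0 < e"
  obtain u where u: "\<And>k. u k \<in> L1" "\<And>k. u k \<in> L2" "\<And>k x. cmod (u k x) \<le> real k"
    "(\<lambda>k. L2_norm (u k - f)) \<longlonglongrightarrow> 0"
    using L2_bounded_approx[OF f] by blast
  obtain j where j: "L2_norm (u j - f) < e / 3"
    using LIMSEQ_D[OF u(4), of "e / 3"] \<open>0 < e\<close> by auto
  have [measurable]: "u j \<in> borel_measurable borel" using L2_borel u by auto
  have iu: "integrable lborel (u j)" using u(1) by (simp add: L1_def)
  \<comment> \<open>With d = u(x) - u(x - t) and |u| <= j one has |d|^2 <= 2 j |d|, so continuity of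
    translation in L1 applies.\<close>
  have sq: "(L2_norm (u j - (\<lambda>x. u j (x - t))))\<^sup>2 \<le> 2 * real j * (\<integral>x. cmod (u j x - u j (x - t)) \<partial>lborel)" for t
  proof -
    have "(L2_norm (u j - (\<lambda>x. u j (x - t))))\<^sup>2 = (\<integral>x. (cmod (u j x - u j (x - t)))\<^sup>2 \<partial>lborel)"
      by (simp add: L2_norm_sq)
    also have "\<dots> \<le> (\<integral>x. 2 * real j * cmod (u j x - u j (x - t)) \<partial>lborel)"
    proof (rule integral_mono)
      show "integrable lborel (\<lambda>x. (cmod (u j x - u j (x - t)))\<^sup>2)"
        using L2_integrable[OF L2_diff[OF u(2)[of j] L2_translate(1)[OF u(2)[of j], of t]]] by simp
      show "integrable lborel (\<lambda>x. 2 * real j * cmod (u j x - u j (x - t)))"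
        using iu integrable_translate[OF iu] by auto
      fix x
      have "cmod (u j x - u j (x - t)) \<le> 2 * real j"
        using norm_triangle_ineq4[of "u j x" "u j (x - t)"] u(3)[of j x] u(3)[of j "x - t"] by simp
      then show "(cmod (u j x - u j (x - t)))\<^sup>2 \<le> 2 * real j * cmod (u j x - u j (x - t))"
        unfolding power2_eq_square by (intro mult_right_mono) auto
    qed
    finally show ?thesis by simp
  qed
  have "(\<lambda>k. sqrt (2 * real j * (\<integral>x. cmod (u j x - u j (x - h k)) \<partial>lborel))) \<longlonglongrightarrow> sqrt (2 * real j * 0)"
    by (intro tendsto_intros translation_continuous_L1[OF iu h])
  then obtain N where N: "\<And>k. k \<ge> N \<Longrightarrow> sqrt (2 * real j * (\<integral>x. cmod (u j x - u j (x - h k)) \<partial>lborel)) < e / 3"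
    using \<open>0 < e\<close> by (elim LIMSEQ_lessD[of _ _ "e / 3"]) auto
  show "\<exists>no. \<forall>k\<ge>no. norm (L2_norm (f - (\<lambda>x. f (x - h k))) - 0) < e"
  proof (intro exI[of _ N] allI impI)
    fix k assume "k \<ge> N"
    let ?T = "\<lambda>f x. f (x - h k)"
    have T: "?T f \<in> L2" "?T (u j) \<in> L2" "u j \<in> L2"
      using L2_translate(1) f u(2) by auto
    have 1: "L2_norm (u j - ?T (u j)) < e / 3"
      using N[OF \<open>k \<ge> N\<close>] real_le_rsqrt[OF sq[of "h k"]] by linarith
    have 2: "L2_norm (?T (u j) - ?T f) = L2_norm (u j - f)"
      using L2_translate(2)[OF L2_diff[OF u(2)[of j] f], of "h k"] by (simp add: fun_diff_def)
    have "L2_norm (f - ?T f) \<le> L2_norm (f - u j) + L2_norm (u j - ?T f)"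
      using f T by (intro L2_triangle_diff)
    also have "L2_norm (u j - ?T f) \<le> L2_norm (u j - ?T (u j)) + L2_norm (?T (u j) - ?T f)"
      using T by (intro L2_triangle_diff)
    finally have "L2_norm (f - ?T f) < e"
      using 1 2 j L2_norm_minus_commute[of f "u j"] by linarith
    then show "norm (L2_norm (f - (\<lambda>x. f (x - h k))) - 0) < e"
      by (simp only: diff_zero real_norm_def abs_of_nonneg L2_norm_nonneg)
  qed
qed

section \<open>Gaussian summation and the Plancherel identity\<close>

lemma autocorrelation_bound:
  assumes "f \<in> L2"
  shows "cmod (autocorrelation f h) \<le> (L2_norm f)\<^sup>2"
  using L2_Cauchy_Schwarz(3)[OF assms L2_cnj[OF L2_translate(1)[OF assms]], of h] L2_translate(2)[OF assms, of h]
  by (simp add: autocorrelation_def power2_eq_square)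

lemma autocorrelation_0: "autocorrelation f 0 = complex_of_real ((L2_norm f)\<^sup>2)"
  by (simp add: autocorrelation_def L2_norm_sq complex_norm_square[symmetric] del: of_real_power)

lemma autocorrelation_tendsto:
  fixes f :: "'a::euclidean_space \<Rightarrow> complex"
  assumes f: "f \<in> L2" and h: "h \<longlonglongrightarrow> 0"
  shows "(\<lambda>k. autocorrelation f (h k)) \<longlonglongrightarrow> autocorrelation f 0"
proof -
  have "(\<lambda>k. L2_norm f * L2_norm (f - (\<lambda>x. f (x - h k)))) \<longlonglongrightarrow> 0"
    by (rule tendsto_mult_right_zero[OF translation_continuous_L2[OF f h]])
  then have "(\<lambda>k. autocorrelation f (h k) - autocorrelation f 0) \<longlonglongrightarrow> 0"
  proof (rule Lim_null_comparison[rotated], intro always_eventually allI)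
    fix k
    let ?d = "\<lambda>x. cnj ((f - (\<lambda>x. f (x - h k))) x)"
    have d: "f - (\<lambda>x. f (x - h k)) \<in> L2" using L2_diff[OF f L2_translate(1)[OF f]] .
    have "autocorrelation f (h k) - autocorrelation f 0
        = (\<integral>x. f x * cnj (f (x - h k)) - f x * cnj (f x) \<partial>lborel)"
      unfolding autocorrelation_def
      using L2_Cauchy_Schwarz(1)[OF f L2_cnj[OF L2_translate(1)[OF f]]] L2_Cauchy_Schwarz(1)[OF f L2_cnj[OF f]]
      by simp
    also have "\<dots> = - (\<integral>x. f x * ?d x \<partial>lborel)"
      by (subst Bochner_Integration.integral_minus[symmetric]) (auto simp: algebra_simps intro!: Bochner_Integration.integral_cong)
    finally show "cmod (autocorrelation f (h k) - autocorrelation f 0) \<le> L2_norm f * L2_norm (f - (\<lambda>x. f (x - h k)))"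
      using L2_Cauchy_Schwarz(3)[OF f L2_cnj[OF d]] by (simp del: minus_apply)
  qed
  then show ?thesis by (simp add: LIM_zero_iff)
qed

text \<open>|fourier f|^2 is integrated against Gaussians increasing to 1. The multiplication
  formula turns this into an average of the autocorrelation over Gaussians concentrating at 0, which
  tends to a multiple of its value at 0 by dominated convergence. Monotone convergence on the
  Fourier side then gives integrability and the value together.\<close>

theorem Plancherel_L1_L2:
  fixes f :: "'a::euclidean_space \<Rightarrow> complex"
  assumes f1: "f \<in> L1" and f2: "f \<in> L2"
  shows "fourier f \<in> L2" "(L2_norm (fourier f))\<^sup>2 = (2 * pi) ^ DIM('a) * (L2_norm f)\<^sup>2"
proof -
  \<comment> \<open>c is both the factor in the transform of the Gaussian and its integral, so the
    limit carries c * c = (2 pi)^n.\<close>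
  define c where "c = sqrt (2 * pi) ^ DIM('a)"
  have c: "c \<ge> 0" "c * c = (2 * pi) ^ DIM('a)" "c\<^sup>2 = (2 * pi) ^ DIM('a)"
  proof -
    show "c \<ge> 0" by (simp add: c_def)
    show "c * c = (2 * pi) ^ DIM('a)"
      unfolding c_def power_mult_distrib[symmetric] by simp
    then show "c\<^sup>2 = (2 * pi) ^ DIM('a)" by (simp add: power2_eq_square)
  qed
  note A1 = fourier_autocorrelation(1)[OF f1]
  have [measurable]: "fourier f \<in> borel_measurable borel" "autocorrelation f \<in> borel_measurable borel"
    using fourier_measurable L1_borel f1 A1 by auto
  \<comment> \<open>Widening Gaussians, increasing to 1 in k, with transforms that concentrate at
    0.\<close>
  define w where "w k \<xi> = gauss (\<xi> /\<^sub>R real (Suc k))" for k :: nat and \<xi> :: 'a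
  have [measurable]: "w k \<in> borel_measurable borel" for k unfolding w_def[abs_def] by measurable
  \<comment> \<open>The physical side after substituting h = z / (k + 1): the Gaussian is fixed and
    the shrinking sits in the argument of the autocorrelation.\<close>
  define J where "J k = (\<integral>(z::'a). autocorrelation f (z /\<^sub>R real (Suc k)) * complex_of_real (c * gauss z) \<partial>lborel)" for k
  have gi: "integrable lborel (gauss :: 'a \<Rightarrow> real)"
    using integrable_norm[of lborel "\<lambda>x::'a. complex_of_real (gauss x)"] fourier_gauss(1)[where 'a='a]
    by (simp add: L1_def gauss_def[abs_def])
  have wL1: "(\<lambda>x. complex_of_real (w k x)) \<in> L1" for k
    using integrable_euclidean_affine[of "\<lambda>x::'a. complex_of_real (gauss x)" "inverse (real (Suc k))" 0] fourier_gauss(1)[where 'a='a]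
    by (simp add: L1_def w_def[abs_def])
  have J: "(\<integral>\<xi>. complex_of_real ((cmod (fourier f \<xi>))\<^sup>2) * complex_of_real (w k \<xi>) \<partial>lborel) = J k" for k
  proof -
    have "(\<integral>\<xi>. complex_of_real ((cmod (fourier f \<xi>))\<^sup>2) * complex_of_real (w k \<xi>) \<partial>lborel)
      = (\<integral>\<xi>. fourier (autocorrelation f) \<xi> * complex_of_real (w k \<xi>) \<partial>lborel)"
      by (simp add: fourier_autocorrelation(2)[OF f1])
    also have "\<dots> = (\<integral>h. autocorrelation f h * fourier (\<lambda>x. complex_of_real (w k x)) h \<partial>lborel)"
      by (rule fourier_multiplication_formula[OF A1 wL1])
    also have "fourier (\<lambda>x. complex_of_real (w k x)) = (\<lambda>h. real (Suc k) ^ DIM('a) *\<^sub>R complex_of_real (c * gauss (real (Suc k) *\<^sub>R h)))"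
      using fourier_scale[of "\<lambda>x::'a. complex_of_real (gauss x)" "real (Suc k)"]
      by (simp add: w_def[abs_def] fourier_gauss(2) c_def fun_eq_iff)
    also have "(\<integral>h. autocorrelation f h * (real (Suc k) ^ DIM('a) *\<^sub>R complex_of_real (c * gauss (real (Suc k) *\<^sub>R h))) \<partial>lborel) = J k"
      unfolding J_def by (subst integral_euclidean_affine[of _ "inverse (real (Suc k))" 0]) (auto simp: power_inverse)
    finally show ?thesis .
  qed
  have Jlim: "J \<longlonglongrightarrow> (\<integral>z. autocorrelation f 0 * complex_of_real (c * gauss z) \<partial>(lborel :: 'a measure))"
    unfolding J_def
  proof (rule integral_dominated_convergence[where w="\<lambda>z. (L2_norm f)\<^sup>2 * (c * gauss z)"])
    show "integrable lborel (\<lambda>z::'a. (L2_norm f)\<^sup>2 * (c * gauss z))" using gi by simp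
    show "AE z in lborel. (\<lambda>k. autocorrelation f (z /\<^sub>R real (Suc k)) * complex_of_real (c * gauss z))
        \<longlonglongrightarrow> autocorrelation f 0 * complex_of_real (c * gauss z)"
    proof (intro AE_I2 tendsto_intros autocorrelation_tendsto[OF f2])
      fix z :: 'a
      show "(\<lambda>k. z /\<^sub>R real (Suc k)) \<longlonglongrightarrow> 0"
        using tendsto_scaleR[OF LIMSEQ_inverse_real_of_nat tendsto_const[of z]] by simp
    qed
    show "AE z in lborel. norm (autocorrelation f (z /\<^sub>R real (Suc k)) * complex_of_real (c * gauss z)) \<le> (L2_norm f)\<^sup>2 * (c * gauss z)" for k
    proof (rule AE_I2)
      fix z :: 'a
      have "0 \<le> c * gauss z" using c by (simp add: gauss_def)
      then show "norm (autocorrelation f (z /\<^sub>R real (Suc k)) * complex_of_real (c * gauss z)) \<le> (L2_norm f)\<^sup>2 * (c * gauss z)"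
        using autocorrelation_bound[OF f2, of "z /\<^sub>R real (Suc k)"] unfolding norm_mult norm_of_real
        by (simp add: mult_right_mono)
    qed
  qed measurable
  have Jlim': "J \<longlonglongrightarrow> complex_of_real ((2 * pi) ^ DIM('a) * (L2_norm f)\<^sup>2)"
  proof -
    have "(\<integral>z. autocorrelation f 0 * complex_of_real (c * gauss z) \<partial>(lborel :: 'a measure))
       = complex_of_real ((L2_norm f)\<^sup>2) * complex_of_real (\<integral>z. c * gauss z \<partial>(lborel :: 'a measure))"
      unfolding autocorrelation_0 by (subst integral_mult_right_zero) (simp only: integral_complex_of_real)
    also have "(\<integral>z. c * gauss z \<partial>(lborel :: 'a measure)) = c * c"
      by (simp add: integral_gauss c_def)
    also have "complex_of_real ((L2_norm f)\<^sup>2) * complex_of_real (c * c) = complex_of_real ((2 * pi) ^ DIM('a) * (L2_norm f)\<^sup>2)"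
      unfolding c(2) by (simp add: mult.commute)
    finally show ?thesis using Jlim by simp
  qed
  have wb: "0 \<le> w k \<xi>" "w k \<xi> \<le> 1" for k \<xi>
    by (auto simp: w_def gauss_def)
  \<comment> \<open>Square integrability of \<open>fourier f\<close> is still open here; under the
    Gaussian weight the uniform bound by \<open>L1_norm f\<close> suffices.\<close>
  have A0: "integrable lborel (\<lambda>\<xi>. (cmod (fourier f \<xi>))\<^sup>2 * w k \<xi>)" for k
  proof (rule Bochner_Integration.integrable_bound)
    show "integrable lborel (\<lambda>\<xi>. (L1_norm f)\<^sup>2 * w k \<xi>)"
      using integrable_norm[of lborel "\<lambda>x. complex_of_real (w k x)"] wL1[of k] wb
      by (intro integrable_mult_right) (simp add: L1_def)
    show "AE \<xi> in lborel. norm ((cmod (fourier f \<xi>))\<^sup>2 * w k \<xi>) \<le> norm ((L1_norm f)\<^sup>2 * w k \<xi>)"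
      using fourier_bound[OF f1] wb by (intro AE_I2) (auto simp: abs_mult intro!: mult_right_mono power_mono)
  qed measurable
  have Jr: "Re (J k) = (\<integral>\<xi>. (cmod (fourier f \<xi>))\<^sup>2 * w k \<xi> \<partial>lborel)" for k
    unfolding J[symmetric] of_real_mult[symmetric] integral_complex_of_real by simp
  have lim: "(\<lambda>k. \<integral>\<xi>. (cmod (fourier f \<xi>))\<^sup>2 * w k \<xi> \<partial>lborel) \<longlonglongrightarrow> (2 * pi) ^ DIM('a) * (L2_norm f)\<^sup>2"
    using tendsto_Re[OF Jlim'] by (simp add: Jr)
  have mono: "w k \<xi> \<le> w (Suc k) \<xi>" for k \<xi>
    unfolding w_def gauss_def
    by (auto intro!: mult_left_mono power_mono simp: power_mult_distrib divide_simps)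
  have wlim: "(\<lambda>k. w k \<xi>) \<longlonglongrightarrow> 1" for \<xi>
  proof -
    have "(\<lambda>k. exp (- (inverse (real (Suc k)) * norm \<xi>)\<^sup>2 / 2)) \<longlonglongrightarrow> exp (- (0 * norm \<xi>)\<^sup>2 / 2)"
      by (intro tendsto_intros LIMSEQ_inverse_real_of_nat) auto
    then show ?thesis by (simp add: w_def gauss_def)
  qed
  have "has_bochner_integral lborel (\<lambda>\<xi>. (cmod (fourier f \<xi>))\<^sup>2) ((2 * pi) ^ DIM('a) * (L2_norm f)\<^sup>2)"
  proof (rule has_bochner_integral_monotone_convergence[where f="\<lambda>k \<xi>. (cmod (fourier f \<xi>))\<^sup>2 * w k \<xi>"])
    show "AE \<xi> in lborel. mono (\<lambda>k. (cmod (fourier f \<xi>))\<^sup>2 * w k \<xi>)"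
      using mono by (auto simp: mono_iff_le_Suc intro!: mult_left_mono)
    show "AE \<xi> in lborel. (\<lambda>k. (cmod (fourier f \<xi>))\<^sup>2 * w k \<xi>) \<longlonglongrightarrow> (cmod (fourier f \<xi>))\<^sup>2"
      using tendsto_mult_left[OF wlim] by (intro AE_I2) fastforce
  qed (use A0 lim in auto)
  then show "fourier f \<in> L2" "(L2_norm (fourier f))\<^sup>2 = (2 * pi) ^ DIM('a) * (L2_norm f)\<^sup>2"
    by (auto simp: L2_def L2_norm_sq has_bochner_integral_iff)
qed

subsection \<open>Fourier transform on \<open>L\<^sup>2\<close>\<close>

lemma L2_integral_tendsto:
  assumes u: "\<And>k. u k \<in> L2" "f \<in> L2" "(\<lambda>k. L2_norm (u k - f)) \<longlonglongrightarrow> 0"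
    and v: "\<And>k. v k \<in> L2" "g \<in> L2" "(\<lambda>k. L2_norm (v k - g)) \<longlonglongrightarrow> 0"
  shows "(\<lambda>k::nat. \<integral>x. u k x * v k x \<partial>lborel) \<longlonglongrightarrow> (\<integral>x. f x * g x \<partial>lborel)"
proof -
  have "(\<lambda>k. L2_norm (u k - f) * L2_norm (v k) + L2_norm f * L2_norm (v k - g)) \<longlonglongrightarrow> 0 * L2_norm g + L2_norm f * 0"
    by (intro tendsto_intros u v L2_norm_tendsto)
  then have "(\<lambda>k. L2_norm (u k - f) * L2_norm (v k) + L2_norm f * L2_norm (v k - g)) \<longlonglongrightarrow> 0"
    by simp
  then have "(\<lambda>k. (\<integral>x. u k x * v k x \<partial>lborel) - (\<integral>x. f x * g x \<partial>lborel)) \<longlonglongrightarrow> 0"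
  proof (rule Lim_null_comparison[rotated], intro always_eventually allI)
    fix k
    note i = L2_Cauchy_Schwarz(1)
    have d: "u k - f \<in> L2" "v k - g \<in> L2" using u v by (auto intro: L2_diff)
    have "(\<integral>x. u k x * v k x \<partial>lborel) - (\<integral>x. f x * g x \<partial>lborel)
        = (\<integral>x. u k x * v k x - f x * g x \<partial>lborel)"
      using i[OF u(1) v(1), of k k] i[OF u(2) v(2)] by simp
    also have "\<dots> = (\<integral>x. (u k - f) x * v k x + f x * (v k - g) x \<partial>lborel)"
      by (intro Bochner_Integration.integral_cong) (auto simp: algebra_simps)
    also have "\<dots> = (\<integral>x. (u k - f) x * v k x \<partial>lborel) + (\<integral>x. f x * (v k - g) x \<partial>lborel)"
      by (rule Bochner_Integration.integral_add[OF i[OF d(1) v(1)] i[OF u(2) d(2)]])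
    finally have e: "(\<integral>x. u k x * v k x \<partial>lborel) - (\<integral>x. f x * g x \<partial>lborel)
        = (\<integral>x. (u k - f) x * v k x \<partial>lborel) + (\<integral>x. f x * (v k - g) x \<partial>lborel)" .
    show "cmod ((\<integral>x. u k x * v k x \<partial>lborel) - (\<integral>x. f x * g x \<partial>lborel))
       \<le> L2_norm (u k - f) * L2_norm (v k) + L2_norm f * L2_norm (v k - g)"
      unfolding e
      using norm_triangle_ineq L2_Cauchy_Schwarz(3)[OF d(1) v(1)] L2_Cauchy_Schwarz(3)[OF u(2) d(2)]
      by (rule order_trans[OF _ add_mono])
  qed
  then show ?thesis by (simp add: LIM_zero_iff)
qed

lemma L2_norm_diff_sq:
  assumes "f \<in> L2" "g \<in> L2"
  shows "(L2_norm (f - g))\<^sup>2 = (L2_norm f)\<^sup>2 + (L2_norm g)\<^sup>2 - 2 * Re (\<integral>x. f x * cnj (g x) \<partial>lborel)"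
proof -
  note i = L2_Cauchy_Schwarz(1)[OF assms(1) L2_cnj[OF assms(2)]]
  define R where "R x = Re (f x * cnj (g x))" for x
  have R: "integrable lborel R" "(\<integral>x. R x \<partial>lborel) = Re (\<integral>x. f x * cnj (g x) \<partial>lborel)"
    unfolding R_def[abs_def] using integrable_Re[OF i] integral_Re[OF i] by auto
  have "(L2_norm (f - g))\<^sup>2 = (\<integral>x. (cmod (f x))\<^sup>2 + (cmod (g x))\<^sup>2 - 2 * R x \<partial>lborel)"
    unfolding L2_norm_sq
  proof (intro Bochner_Integration.integral_cong refl)
    fix x
    show "(cmod ((f - g) x))\<^sup>2 = (cmod (f x))\<^sup>2 + (cmod (g x))\<^sup>2 - 2 * R x"
      unfolding cmod_power2 R_def by (simp add: power2_eq_square algebra_simps)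
  qed
  also have "\<dots> = (L2_norm f)\<^sup>2 + (L2_norm g)\<^sup>2 - 2 * (\<integral>x. R x \<partial>lborel)"
    using R(1) L2_integrable[OF assms(1)] L2_integrable[OF assms(2)] by (simp add: L2_norm_sq)
  finally show ?thesis unfolding R(2) .
qed

text \<open>The function inside the limit that defines \<open>fourier_L2\<close>, named so that this
  limit can be manipulated.\<close>

definition truncation :: "real \<Rightarrow> ('a::euclidean_space \<Rightarrow> complex) \<Rightarrow> 'a \<Rightarrow> complex" where
  "truncation R f = (\<lambda>x. if norm x \<le> R then f x else 0)"

lemma truncation_measurable [measurable (raw)]:
  assumes [measurable]: "f \<in> borel_measurable borel"
  shows "truncation R f \<in> borel_measurable borel"
  unfolding truncation_def by measurable

lemma truncation_L2: "f \<in> L2 \<Longrightarrow> truncation R f \<in> L2"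
  by (rule L2_norm_mono(1)) (auto simp: L2_borel truncation_measurable, simp add: truncation_def)

text \<open>The indicator of a ball is in \<open>L2\<close>, so Cauchy--Schwarz makes its product
  with \<open>f\<close> integrable.\<close>

lemma truncation_L1:
  fixes f :: "'a::euclidean_space \<Rightarrow> complex"
  assumes "f \<in> L2" shows "truncation R f \<in> L1"
proof -
  have m: "(\<lambda>x::'a. if norm x \<le> R then 1 else 0 :: complex) \<in> borel_measurable borel"
    by measurable
  have i: "integrable lborel (\<lambda>x::'a. indicator (cball 0 R) x :: real)"
    using emeasure_lborel_cball_finite[of "0::'a" R] by simp
  have ind: "(\<lambda>x::'a. if norm x \<le> R then 1 else 0 :: complex) \<in> L2"
    by (rule L2I_bound[OF m i]) (auto simp: indicator_def)
  have "(\<lambda>x. f x * (if norm x \<le> R then 1 else 0)) = truncation R f"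
    by (auto simp: truncation_def fun_eq_iff)
  then show ?thesis
    using L2_Cauchy_Schwarz(1)[OF assms ind] by (simp add: L1_def)
qed

lemma truncation_tendsto:
  fixes f :: "'a::euclidean_space \<Rightarrow> complex"
  assumes "f \<in> L2"
  shows "((\<lambda>R. L2_norm (truncation R f - f)) \<longlongrightarrow> 0) at_top"
proof (rule tendsto_at_topI_sequentially)
  fix X :: "nat \<Rightarrow> real" assume X: "filterlim X at_top sequentially"
  note [measurable] = L2_borel[OF assms]
  show "(\<lambda>k. L2_norm (truncation (X k) f - f)) \<longlonglongrightarrow> 0"
  proof (rule L2_dominated_convergence(2)[OF _ _ assms])
    show "AE x in lborel. (\<lambda>k. truncation (X k) f x) \<longlonglongrightarrow> f x"
    proof (rule AE_I2)
      fix x :: 'a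
      have "\<forall>\<^sub>F k in sequentially. norm x \<le> X k"
        using X by (simp add: filterlim_at_top)
      then have "\<forall>\<^sub>F k in sequentially. truncation (X k) f x = f x"
        by eventually_elim (simp add: truncation_def)
      then show "(\<lambda>k. truncation (X k) f x) \<longlonglongrightarrow> f x" by (rule tendsto_eventually)
    qed
  qed (auto simp: truncation_def)
qed

lemma truncation_tendsto_seq:
  fixes f :: "'a::euclidean_space \<Rightarrow> complex"
  assumes "f \<in> L2"
  shows "(\<lambda>k. L2_norm (truncation (real k) f - f)) \<longlonglongrightarrow> 0"
  using filterlim_compose[OF truncation_tendsto[OF assms] filterlim_real_sequentially] .

section \<open>Existence of the limit that defines the transform\<close>

lemma fourier_diff:
  assumes "f \<in> L1" "g \<in> L1" shows "fourier (f - g) = fourier f - fourier g"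
  using fourier_integrable[OF assms(1)] fourier_integrable[OF assms(2)]
  by (auto simp: fourier_def fun_eq_iff right_diff_distrib)

lemma fourier_add:
  assumes "f \<in> L1" "g \<in> L1" shows "fourier (f + g) = fourier f + fourier g"
  using fourier_integrable[OF assms(1)] fourier_integrable[OF assms(2)]
  by (auto simp: fourier_def fun_eq_iff distrib_left)

lemma fourier_cmult: "fourier (\<lambda>x. c * f x) = (\<lambda>\<xi>. c * fourier f \<xi>)"
proof
  fix \<xi>
  have "fourier (\<lambda>x. c * f x) \<xi> = (\<integral>x. c * (exp (- \<i> * complex_of_real (x \<bullet> \<xi>)) * f x) \<partial>lborel)"
    unfolding fourier_def by (simp add: mult_ac)
  then show "fourier (\<lambda>x. c * f x) \<xi> = c * fourier f \<xi>"
    unfolding fourier_def integral_mult_right_zero .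
qed

lemma L1_diff: "f \<in> L1 \<Longrightarrow> g \<in> L1 \<Longrightarrow> f - g \<in> L1"
  by (simp add: L1_def fun_diff_def)

lemma fourier_norm_L1_L2:
  fixes f :: "'a::euclidean_space \<Rightarrow> complex"
  assumes "f \<in> L1" "f \<in> L2"
  shows "L2_norm (fourier f) = sqrt ((2 * pi) ^ DIM('a)) * L2_norm f"
  using arg_cong[OF Plancherel_L1_L2(2)[OF assms], of sqrt] by (simp add: real_sqrt_mult)

lemma fourier_norm_diff_L1_L2:
  fixes f :: "'a::euclidean_space \<Rightarrow> complex"
  assumes "f \<in> L1" "f \<in> L2" "g \<in> L1" "g \<in> L2"
  shows "L2_norm (fourier f - fourier g) = sqrt ((2 * pi) ^ DIM('a)) * L2_norm (f - g)"
  using fourier_norm_L1_L2[OF L1_diff[OF assms(1,3)] L2_diff[OF assms(2,4)]] fourier_diff[OF assms(1,3)] by metis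

text \<open>Along integer radii the transforms form a Cauchy sequence by Plancherel, and
  completeness gives g. The defining limit runs over real R; letting the integer radius k tend to
  infinity in the triangle inequality bounds the distance to g by a multiple of the truncation error
  at R.\<close>

lemma fourier_L2_exists:
  fixes f :: "'a::euclidean_space \<Rightarrow> complex"
  assumes f: "f \<in> L2"
  shows "\<exists>g. g \<in> L2 \<and> ((\<lambda>R. L2_norm (fourier (truncation R f) - g)) \<longlongrightarrow> 0) at_top"
proof -
  let ?c = "sqrt ((2 * pi) ^ DIM('a))"
  note t1 = truncation_L1[OF f] note t2 = truncation_L2[OF f]
  note F2 = Plancherel_L1_L2(1)[OF t1 t2]
  have d: "L2_norm (fourier (truncation R f) - fourier (truncation S f))
      \<le> ?c * (L2_norm (truncation R f - f) + L2_norm (truncation S f - f))" for R S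
    unfolding fourier_norm_diff_L1_L2[OF t1 t2 t1 t2]
    using L2_triangle_diff[OF t2[of R] f t2[of S]] L2_norm_minus_commute[of f "truncation S f"]
    by (intro mult_left_mono) auto
  obtain g where g: "g \<in> L2" "(\<lambda>k. L2_norm (fourier (truncation (real k) f) - g)) \<longlonglongrightarrow> 0"
  proof (rule L2_complete[of "\<lambda>k. fourier (truncation (real k) f)"])
    fix e :: real assume "0 < e"
    have "(\<lambda>k. ?c * L2_norm (truncation (real k) f - f)) \<longlonglongrightarrow> 0"
      by (rule tendsto_mult_right_zero[OF truncation_tendsto_seq[OF f]])
    then obtain N where N: "\<And>k. k \<ge> N \<Longrightarrow> ?c * L2_norm (truncation (real k) f - f) < e / 2"
      using \<open>0 < e\<close> by (elim LIMSEQ_lessD[of _ _ "e / 2"]) auto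
    have "L2_norm (fourier (truncation (real m) f) - fourier (truncation (real n) f)) < e" if "m \<ge> N" "n \<ge> N" for m n
      using d[of "real m" "real n"] N[OF that(1)] N[OF that(2)] unfolding distrib_left by linarith
    then show "\<exists>N. \<forall>m\<ge>N. \<forall>n\<ge>N. L2_norm (fourier (truncation (real m) f) - fourier (truncation (real n) f)) < e"
      by blast
  qed (use F2 in auto)
  have "((\<lambda>R. L2_norm (fourier (truncation R f) - g)) \<longlongrightarrow> 0) at_top"
  proof (rule Lim_null_comparison)
    have "L2_norm (fourier (truncation R f) - g) \<le> ?c * L2_norm (truncation R f - f)" for R
    proof (rule tendsto_lowerbound)
      show "(\<lambda>k. ?c * (L2_norm (truncation R f - f) + L2_norm (truncation (real k) f - f))
          + L2_norm (fourier (truncation (real k) f) - g)) \<longlonglongrightarrow> ?c * L2_norm (truncation R f - f)"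
        using tendsto_add[OF tendsto_mult[OF tendsto_const[of ?c] tendsto_add[OF tendsto_const[of "L2_norm (truncation R f - f)"] truncation_tendsto_seq[OF f]]] g(2)]
        by (simp only: add_0_right)
      show "\<forall>\<^sub>F k in sequentially. L2_norm (fourier (truncation R f) - g)
          \<le> ?c * (L2_norm (truncation R f - f) + L2_norm (truncation (real k) f - f)) + L2_norm (fourier (truncation (real k) f) - g)"
      proof (intro always_eventually allI)
        fix k
        show "L2_norm (fourier (truncation R f) - g)
          \<le> ?c * (L2_norm (truncation R f - f) + L2_norm (truncation (real k) f - f)) + L2_norm (fourier (truncation (real k) f) - g)"
          using L2_triangle_diff[OF F2[of R] F2[of "real k"] g(1)] d[of R "real k"] by linarith
      qed
    qed simp
    then show "\<forall>\<^sub>F R in at_top. norm (L2_norm (fourier (truncation R f) - g)) \<le> ?c * L2_norm (truncation R f - f)"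
      unfolding real_norm_def abs_of_nonneg[OF L2_norm_nonneg] by (intro always_eventually allI)
    show "((\<lambda>R. ?c * L2_norm (truncation R f - f)) \<longlongrightarrow> 0) at_top"
      by (rule tendsto_mult_right_zero[OF truncation_tendsto[OF f]])
  qed
  with g(1) show ?thesis by blast
qed

lemma
  assumes "f \<in> L2"
  shows fourier_L2_L2: "fourier_L2 f \<in> L2"
    and fourier_L2_limit: "((\<lambda>R. L2_norm (fourier (truncation R f) - fourier_L2 f)) \<longlongrightarrow> 0) at_top"
  using someI_ex[OF fourier_L2_exists[OF assms]] unfolding fourier_L2_def truncation_def by auto

text \<open>The truncations in the definition may be replaced by any approximating sequence in L1
  and L2, because by Plancherel the two sequences of transforms have distance tending to 0.\<close>

lemma fourier_L2_approx:
  fixes f :: "'a::euclidean_space \<Rightarrow> complex"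
  assumes f: "f \<in> L2" and u: "\<And>k. u k \<in> L1" "\<And>k. u k \<in> L2" "(\<lambda>k. L2_norm (u k - f)) \<longlonglongrightarrow> 0"
  shows "(\<lambda>k. L2_norm (fourier (u k) - fourier_L2 f)) \<longlonglongrightarrow> 0"
proof (rule Lim_null_comparison)
  let ?c = "sqrt ((2 * pi) ^ DIM('a))"
  let ?t = "\<lambda>k. truncation (real k) f"
  note t1 = truncation_L1[OF f] note t2 = truncation_L2[OF f]
  note F2 = Plancherel_L1_L2(1)[OF t1 t2] Plancherel_L1_L2(1)[OF u(1,2)] fourier_L2_L2[OF f]
  have "(\<lambda>k. L2_norm (fourier (?t k) - fourier_L2 f)) \<longlonglongrightarrow> 0"
    using filterlim_compose[OF fourier_L2_limit[OF f] filterlim_real_sequentially] .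
  from tendsto_add[OF tendsto_mult[OF tendsto_const[of ?c] tendsto_add[OF u(3) truncation_tendsto_seq[OF f]]] this]
  show "(\<lambda>k. ?c * (L2_norm (u k - f) + L2_norm (?t k - f)) + L2_norm (fourier (?t k) - fourier_L2 f)) \<longlonglongrightarrow> 0"
    by (simp only: add_0_right mult_zero_right)
  have "L2_norm (fourier (u k) - fourier_L2 f)
      \<le> ?c * (L2_norm (u k - f) + L2_norm (?t k - f)) + L2_norm (fourier (?t k) - fourier_L2 f)" for k
  proof -
    have "L2_norm (fourier (u k) - fourier (?t k)) \<le> ?c * (L2_norm (u k - f) + L2_norm (?t k - f))"
      unfolding fourier_norm_diff_L1_L2[OF u(1,2) t1 t2]
      using L2_triangle_diff[OF u(2)[of k] f t2[of k]] L2_norm_minus_commute[of f "?t k"]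
      by (intro mult_left_mono) auto
    then show ?thesis
      using L2_triangle_diff[OF F2(2)[of k] F2(1)[of k] F2(3)] by linarith
  qed
  then show "\<forall>\<^sub>F k in sequentially. norm (L2_norm (fourier (u k) - fourier_L2 f))
      \<le> ?c * (L2_norm (u k - f) + L2_norm (?t k - f)) + L2_norm (fourier (?t k) - fourier_L2 f)"
    by (intro always_eventually allI) (simp only: real_norm_def abs_of_nonneg L2_norm_nonneg)
qed

lemma fourier_L2_trunc_seq:
  assumes "f \<in> L2"
  shows "(\<lambda>k. L2_norm (fourier (truncation (real k) f) - fourier_L2 f)) \<longlonglongrightarrow> 0"
  by (rule filterlim_compose[OF fourier_L2_limit[OF assms] filterlim_real_sequentially])

text \<open>The constant sequence \<open>f\<close> approximates itself, so both transforms are L2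
  limits of the constant sequence \<open>fourier f\<close>.\<close>

lemma fourier_L2_eq_fourier:
  assumes "f \<in> L1" "f \<in> L2"
  shows "AE \<xi> in lborel. fourier_L2 f \<xi> = fourier f \<xi>"
proof (rule L2_limit_unique[of "\<lambda>_. fourier f", OF _ _ _ sequentially_bot])
  show "(\<lambda>k. L2_norm (fourier f - fourier_L2 f)) \<longlonglongrightarrow> 0"
    by (rule fourier_L2_approx[OF assms(2)]) (use assms in auto)
qed (use assms Plancherel_L1_L2(1) fourier_L2_L2 in auto)

theorem Plancherel:
  fixes f :: "'a::euclidean_space \<Rightarrow> complex"
  assumes f: "f \<in> L2"
  shows "L2_norm (fourier_L2 f) = sqrt ((2 * pi) ^ DIM('a)) * L2_norm f"
proof (rule LIMSEQ_unique)
  note t1 = truncation_L1[OF f] note t2 = truncation_L2[OF f]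
  show "(\<lambda>k. L2_norm (fourier (truncation (real k) f))) \<longlonglongrightarrow> L2_norm (fourier_L2 f)"
    by (intro L2_norm_tendsto fourier_L2_trunc_seq f fourier_L2_L2 Plancherel_L1_L2(1) t1 t2)
  show "(\<lambda>k. L2_norm (fourier (truncation (real k) f))) \<longlonglongrightarrow> sqrt ((2 * pi) ^ DIM('a)) * L2_norm f"
    unfolding fourier_norm_L1_L2[OF t1 t2]
    by (intro tendsto_intros L2_norm_tendsto truncation_tendsto_seq f t2)
qed

section \<open>Linearity, injectivity and surjectivity of the transform\<close>

lemma fourier_L2_add:
  fixes f :: "'a::euclidean_space \<Rightarrow> complex"
  assumes f: "f \<in> L2" and g: "g \<in> L2"
  shows "AE \<xi> in lborel. fourier_L2 (f + g) \<xi> = fourier_L2 f \<xi> + fourier_L2 g \<xi>"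
proof -
  let ?u = "\<lambda>k. truncation (real k) (f + g)"
  note L = truncation_L1 truncation_L2
  have F: "fourier (truncation R h) \<in> L2" if "h \<in> L2" for R and h :: "'a \<Rightarrow> complex"
    using Plancherel_L1_L2(1) L that by blast
  have e: "fourier (?u k) = fourier (truncation (real k) f) + fourier (truncation (real k) g)" for k
  proof -
    have "?u k = truncation (real k) f + truncation (real k) g"
      by (auto simp: truncation_def fun_eq_iff)
    then show ?thesis
      using fourier_add[OF L(1)[OF f] L(1)[OF g]] by simp
  qed
  have "AE \<xi> in lborel. fourier_L2 (f + g) \<xi> = (fourier_L2 f + fourier_L2 g) \<xi>"
  proof (rule L2_limit_unique[of "\<lambda>k. fourier (?u k)", OF _ _ _ sequentially_bot])
    show "(\<lambda>k. L2_norm (fourier (?u k) - fourier_L2 (f + g))) \<longlonglongrightarrow> 0"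
      by (intro fourier_L2_trunc_seq L2_add f g)
    show "(\<lambda>k. L2_norm (fourier (?u k) - (fourier_L2 f + fourier_L2 g))) \<longlonglongrightarrow> 0"
    proof (rule Lim_null_comparison)
      show "(\<lambda>k. L2_norm (fourier (truncation (real k) f) - fourier_L2 f) + L2_norm (fourier (truncation (real k) g) - fourier_L2 g)) \<longlonglongrightarrow> 0"
        using tendsto_add[OF fourier_L2_trunc_seq[OF f] fourier_L2_trunc_seq[OF g]] by (simp only: add_0_right)
      show "\<forall>\<^sub>F k in sequentially. norm (L2_norm (fourier (?u k) - (fourier_L2 f + fourier_L2 g)))
         \<le> L2_norm (fourier (truncation (real k) f) - fourier_L2 f) + L2_norm (fourier (truncation (real k) g) - fourier_L2 g)"
        unfolding e add_diff_add real_norm_def abs_of_nonneg[OF L2_norm_nonneg]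
        by (intro always_eventually allI L2_triangle L2_diff F f g fourier_L2_L2)
    qed
  qed (intro F L2_add f g fourier_L2_L2)+
  then show ?thesis by simp
qed

lemma fourier_L2_cmult:
  fixes f :: "'a::euclidean_space \<Rightarrow> complex"
  assumes f: "f \<in> L2"
  shows "AE \<xi> in lborel. fourier_L2 (\<lambda>x. c * f x) \<xi> = c * fourier_L2 f \<xi>"
proof -
  let ?u = "\<lambda>k. truncation (real k) (\<lambda>x. c * f x)"
  note L = truncation_L1 truncation_L2
  have F: "fourier (truncation R h) \<in> L2" if "h \<in> L2" for R and h :: "'a \<Rightarrow> complex"
    using Plancherel_L1_L2(1) L that by blast
  have t: "?u k = (\<lambda>x. c * truncation (real k) f x)" for k
    by (auto simp: truncation_def fun_eq_iff)
  have e: "fourier (?u k) = (\<lambda>\<xi>. c * fourier (truncation (real k) f) \<xi>)" for k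
    unfolding t by (rule fourier_cmult)
  show ?thesis
  proof (rule L2_limit_unique[of "\<lambda>k. fourier (?u k)", OF _ _ _ sequentially_bot])
    show "(\<lambda>k. L2_norm (fourier (?u k) - fourier_L2 (\<lambda>x. c * f x))) \<longlonglongrightarrow> 0"
      by (intro fourier_L2_trunc_seq L2_cmult f)
    have "(\<lambda>\<xi>. c * fourier (truncation (real k) f) \<xi>) - (\<lambda>\<xi>. c * fourier_L2 f \<xi>)
        = (\<lambda>\<xi>. c * (fourier (truncation (real k) f) - fourier_L2 f) \<xi>)" for k
      by (auto simp: fun_eq_iff algebra_simps)
    then show "(\<lambda>k. L2_norm (fourier (?u k) - (\<lambda>\<xi>. c * fourier_L2 f \<xi>))) \<longlonglongrightarrow> 0"
      unfolding e using tendsto_mult_right_zero[OF fourier_L2_trunc_seq[OF f], of "cmod c"]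
      by (simp only: L2_norm_cmult)
  qed (intro F L2_cmult f fourier_L2_L2)+
qed

lemma fourier_L2_diff:
  fixes f :: "'a::euclidean_space \<Rightarrow> complex"
  assumes f: "f \<in> L2" and g: "g \<in> L2"
  shows "AE \<xi> in lborel. fourier_L2 (f - g) \<xi> = fourier_L2 f \<xi> - fourier_L2 g \<xi>"
proof -
  have e: "f - g = f + (\<lambda>x. - 1 * g x)" by (auto simp: fun_eq_iff)
  show ?thesis
    using fourier_L2_add[OF f L2_cmult[OF g, of "-1"]] fourier_L2_cmult[OF g, of "-1"]
    unfolding e[symmetric] by eventually_elim simp
qed

lemma fourier_L2_scaleR:
  fixes f :: "'a::euclidean_space \<Rightarrow> complex"
  assumes f: "f \<in> L2"
  shows "AE \<xi> in lborel. fourier_L2 (c *\<^sub>R f) \<xi> = complex_of_real c * fourier_L2 f \<xi>"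
  using fourier_L2_cmult[OF f, of "complex_of_real c"] by (simp add: scaleR_fun_def scaleR_conv_of_real)

lemma fourier_L2_norm_diff:
  fixes f :: "'a::euclidean_space \<Rightarrow> complex"
  assumes f: "f \<in> L2" and g: "g \<in> L2"
  shows "L2_norm (fourier_L2 f - fourier_L2 g) = sqrt ((2 * pi) ^ DIM('a)) * L2_norm (f - g)"
proof -
  have "L2_norm (fourier_L2 f - fourier_L2 g) = L2_norm (fourier_L2 (f - g))"
    using fourier_L2_diff[OF f g] L2_borel L2_diff fourier_L2_L2 f g
    by (intro L2_norm_cong) (auto elim: eventually_mono)
  then show ?thesis
    using Plancherel[OF L2_diff[OF f g]] by simp
qed

text \<open>By Plancherel the norms of the two differences agree up to a positive factor. Functions
  obtained by choice, such as values of \<open>inv_fourier_L2\<close>, are compared through their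
  transforms in this way.\<close>

lemma fourier_L2_eq_iff:
  fixes f :: "'a::euclidean_space \<Rightarrow> complex"
  assumes f: "f \<in> L2" and g: "g \<in> L2"
  shows "(AE \<xi> in lborel. fourier_L2 f \<xi> = fourier_L2 g \<xi>) \<longleftrightarrow> (AE x in lborel. f x = g x)"
  using fourier_L2_norm_diff[OF f g] L2_norm_diff_eq_0_iff[OF f g]
    L2_norm_diff_eq_0_iff[OF fourier_L2_L2[OF f] fourier_L2_L2[OF g]] by simp

lemma fourier_L2_multiplication_formula:
  fixes f g :: "'a::euclidean_space \<Rightarrow> complex"
  assumes f: "f \<in> L2" and g: "g \<in> L2"
  shows "(\<integral>\<xi>. fourier_L2 f \<xi> * g \<xi> \<partial>lborel) = (\<integral>x. f x * fourier_L2 g x \<partial>lborel)"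
proof (rule LIMSEQ_unique)
  have F: "fourier (truncation R h) \<in> L2" if "h \<in> L2" for R and h :: "'a \<Rightarrow> complex"
    using Plancherel_L1_L2(1) truncation_L1 truncation_L2 that by blast
  show "(\<lambda>k. \<integral>\<xi>. fourier (truncation (real k) f) \<xi> * truncation (real k) g \<xi> \<partial>lborel)
     \<longlonglongrightarrow> (\<integral>\<xi>. fourier_L2 f \<xi> * g \<xi> \<partial>lborel)"
    by (intro L2_integral_tendsto F f g fourier_L2_L2 fourier_L2_trunc_seq truncation_tendsto_seq truncation_L2)
  show "(\<lambda>k. \<integral>\<xi>. fourier (truncation (real k) f) \<xi> * truncation (real k) g \<xi> \<partial>lborel)
     \<longlonglongrightarrow> (\<integral>x. f x * fourier_L2 g x \<partial>lborel)"
    unfolding fourier_multiplication_formula[OF truncation_L1[OF f] truncation_L1[OF g]]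
    by (intro L2_integral_tendsto F f g fourier_L2_L2 fourier_L2_trunc_seq truncation_tendsto_seq truncation_L2)
qed

text \<open>
  With \<open>c = (2 * pi) ^ n\<close> and \<open>h\<close> the conjugate of the transform of the conjugate of \<open>g\<close>, the
  multiplication formula and Plancherel give \<open>\<parallel>F h - c g\<parallel>\<^sup>2 = c\<^sup>2 \<parallel>g\<parallel>\<^sup>2 - 2 c\<^sup>2 \<parallel>g\<parallel>\<^sup>2 + c\<^sup>2 \<parallel>g\<parallel>\<^sup>2 = 0\<close>.
\<close>

theorem fourier_L2_surj:
  fixes g :: "'a::euclidean_space \<Rightarrow> complex"
  assumes g: "g \<in> L2"
  obtains f where "f \<in> L2" "AE \<xi> in lborel. fourier_L2 f \<xi> = g \<xi>"
proof -
  define c where "c = (2 * pi) ^ DIM('a)"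
  have c: "c > 0" by (simp add: c_def)
  define g' where "g' = (\<lambda>x. cnj (g x))"
  define h where "h = (\<lambda>x. cnj (fourier_L2 g' x))"
  have g': "g' \<in> L2" unfolding g'_def by (rule L2_cnj[OF g])
  have Fg': "fourier_L2 g' \<in> L2" by (rule fourier_L2_L2[OF g'])
  have h: "h \<in> L2" unfolding h_def by (rule L2_cnj[OF Fg'])
  have Fh: "fourier_L2 h \<in> L2" by (rule fourier_L2_L2[OF h])
  have cg: "(\<lambda>x. complex_of_real c * g x) \<in> L2" by (rule L2_cmult[OF g])
  have n1: "(L2_norm (fourier_L2 g'))\<^sup>2 = c * (L2_norm g)\<^sup>2"
    unfolding Plancherel[OF g'] using c by (simp add: power_mult_distrib c_def g'_def)
  have n2: "(L2_norm (fourier_L2 h))\<^sup>2 = c * (c * (L2_norm g)\<^sup>2)"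
    unfolding Plancherel[OF h] n1[symmetric] using c by (simp add: power_mult_distrib c_def h_def)
  have n3: "(L2_norm (\<lambda>x. complex_of_real c * g x))\<^sup>2 = c * (c * (L2_norm g)\<^sup>2)"
    by (simp add: L2_norm_cmult power_mult_distrib power2_eq_square)
  have "(\<integral>x. fourier_L2 h x * cnj (complex_of_real c * g x) \<partial>lborel)
      = complex_of_real c * (\<integral>x. fourier_L2 h x * g' x \<partial>lborel)"
    unfolding integral_mult_right_zero[symmetric] by (simp add: g'_def mult_ac)
  also have "\<dots> = complex_of_real c * (\<integral>x. h x * fourier_L2 g' x \<partial>lborel)"
    by (simp only: fourier_L2_multiplication_formula[OF h g'])
  also have "(\<integral>x. h x * fourier_L2 g' x \<partial>lborel) = (\<integral>x. complex_of_real ((cmod (fourier_L2 g' x))\<^sup>2) \<partial>lborel)"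
    unfolding h_def by (simp only: complex_norm_square mult.commute)
  also have "\<dots> = complex_of_real ((L2_norm (fourier_L2 g'))\<^sup>2)"
    unfolding L2_norm_sq by (rule integral_complex_of_real)
  also have "complex_of_real c * complex_of_real ((L2_norm (fourier_L2 g'))\<^sup>2) = complex_of_real (c * (c * (L2_norm g)\<^sup>2))"
    unfolding n1 by simp
  finally have "(L2_norm (fourier_L2 h - (\<lambda>x. complex_of_real c * g x)))\<^sup>2 = 0"
    unfolding L2_norm_diff_sq[OF Fh cg] n2 n3 by simp
  then have eq: "AE \<xi> in lborel. fourier_L2 h \<xi> = complex_of_real c * g \<xi>"
    using L2_norm_diff_eq_0_iff[OF Fh cg] by simp
  show thesis
  proof
    show "(\<lambda>x. complex_of_real (1 / c) * h x) \<in> L2" by (rule L2_cmult[OF h])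
    show "AE \<xi> in lborel. fourier_L2 (\<lambda>x. complex_of_real (1 / c) * h x) \<xi> = g \<xi>"
      using fourier_L2_cmult[OF h, of "complex_of_real (1 / c)"] eq
      by eventually_elim (use c in simp)
  qed
qed

lemma
  assumes "g \<in> L2"
  shows inv_fourier_L2_L2: "inv_fourier_L2 g \<in> L2"
    and fourier_inv_fourier_L2: "AE \<xi> in lborel. fourier_L2 (inv_fourier_L2 g) \<xi> = g \<xi>"
proof -
  have "\<exists>f. f \<in> L2 \<and> (AE \<xi> in lborel. fourier_L2 f \<xi> = g \<xi>)"
    using fourier_L2_surj[OF assms] by metis
  from someI_ex[OF this] show "inv_fourier_L2 g \<in> L2" "AE \<xi> in lborel. fourier_L2 (inv_fourier_L2 g) \<xi> = g \<xi>"
    unfolding inv_fourier_L2_def by auto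
qed

subsection \<open>Seminormed spaces and semigroups\<close>

text \<open>A carrier with a seminorm replaces the quotient by null vectors. The laws are imposed on
  \<open>X\<close> only: a norm given by a Bochner integral is 0 by default where the integral
  diverges.\<close>

locale seminormed_subspace =
  fixes X :: "'v::real_vector set" and N :: "'v \<Rightarrow> real"
  assumes zero_in: "0 \<in> X"
    and add_in: "\<And>x y. x \<in> X \<Longrightarrow> y \<in> X \<Longrightarrow> x + y \<in> X"
    and scale_in: "\<And>c x. x \<in> X \<Longrightarrow> c *\<^sub>R x \<in> X"
    and N_triangle: "\<And>x y. x \<in> X \<Longrightarrow> y \<in> X \<Longrightarrow> N (x + y) \<le> N x + N y"
    and N_scale: "\<And>c x. x \<in> X \<Longrightarrow> N (c *\<^sub>R x) = \<bar>c\<bar> * N x"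
begin

lemma minus_in: "x \<in> X \<Longrightarrow> - x \<in> X"
  using scale_in[of x "-1"] by simp

lemma diff_in: "x \<in> X \<Longrightarrow> y \<in> X \<Longrightarrow> x - y \<in> X"
  using add_in[of x "- y"] minus_in[of y] by simp

lemmas in_intros = zero_in add_in scale_in minus_in diff_in

lemma N_minus: "x \<in> X \<Longrightarrow> N (- x) = N x"
  using N_scale[of x "-1"] by simp

lemma N_minus_commute: "x \<in> X \<Longrightarrow> y \<in> X \<Longrightarrow> N (x - y) = N (y - x)"
  using N_minus[of "x - y"] by (simp add: diff_in)

lemma N_zero: "N 0 = 0"
  using N_scale[OF zero_in, of 0] by simp

lemma N_nonneg: "x \<in> X \<Longrightarrow> 0 \<le> N x"
  using N_triangle[of x "- x"] N_minus[of x] N_zero by (simp add: minus_in)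

lemma N_triangle_diff: "x \<in> X \<Longrightarrow> y \<in> X \<Longrightarrow> N (x - y) \<le> N x + N y"
  using N_triangle[of x "- y"] N_minus[of y] by (simp add: minus_in)

lemma N_triangle3: "x \<in> X \<Longrightarrow> y \<in> X \<Longrightarrow> z \<in> X \<Longrightarrow> N (x - z) \<le> N (x - y) + N (y - z)"
  using N_triangle[of "x - y" "y - z"] by (simp add: diff_in)

lemma N_le_diff: "x \<in> X \<Longrightarrow> y \<in> X \<Longrightarrow> N x \<le> N y + N (x - y)"
  using N_triangle[of y "x - y"] by (simp add: diff_in)

definition bounded_on :: "('v \<Rightarrow> 'v) \<Rightarrow> real \<Rightarrow> bool" where
  "bounded_on T M \<longleftrightarrow> 0 \<le> M \<and> (\<forall>x\<in>X. N (T x) \<le> M * N x)"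

text \<open>Linearity in the form that \<open>C0_semigroup\<close> provides, with errors of seminorm
  zero; such errors are absorbed by \<open>N_le_diff\<close>.\<close>

definition linear_mod :: "('v \<Rightarrow> 'v) \<Rightarrow> bool" where
  "linear_mod T \<longleftrightarrow> (\<forall>x\<in>X. T x \<in> X) \<and>
     (\<forall>x\<in>X. \<forall>y\<in>X. N (T (x + y) - (T x + T y)) = 0) \<and>
     (\<forall>c. \<forall>x\<in>X. N (T (c *\<^sub>R x) - c *\<^sub>R T x) = 0)"

lemma linear_mod_in: "linear_mod T \<Longrightarrow> x \<in> X \<Longrightarrow> T x \<in> X"
  by (simp add: linear_mod_def)

lemma linear_mod_diff:
  assumes T: "linear_mod T" and xy: "x \<in> X" "y \<in> X"
  shows "N (T (x - y) - (T x - T y)) = 0"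
proof -
  have "N (T ((x - y) + y) - (T (x - y) + T y)) = 0"
    using T xy diff_in unfolding linear_mod_def by blast
  then have "N (T x - (T (x - y) + T y)) = 0" by simp
  moreover have "T (x - y) - (T x - T y) = - (T x - (T (x - y) + T y))" by simp
  ultimately show ?thesis
    using N_minus[of "T x - (T (x - y) + T y)"] T xy by (metis linear_mod_in in_intros)
qed

lemma linear_mod_diff_bound:
  assumes T: "linear_mod T" "bounded_on T M" and xy: "x \<in> X" "y \<in> X"
  shows "N (T x - T y) \<le> M * N (x - y)"
proof -
  have i: "T x \<in> X" "T y \<in> X" "T (x - y) \<in> X"
    using T xy by (auto intro: linear_mod_in in_intros)
  have "N (T x - T y) \<le> N (T (x - y)) + N ((T x - T y) - T (x - y))"
    using i by (intro N_le_diff in_intros)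
  also have "N ((T x - T y) - T (x - y)) = 0"
    using linear_mod_diff[OF T(1) xy] i N_minus_commute by (metis diff_in)
  finally show ?thesis
    using T(2) diff_in[OF xy] unfolding bounded_on_def by fastforce
qed

lemma linear_mod_scale:
  assumes T: "linear_mod T" and x: "x \<in> X"
  shows "N (T (c *\<^sub>R x)) = \<bar>c\<bar> * N (T x)"
proof -
  have i: "T x \<in> X" "T (c *\<^sub>R x) \<in> X"
    using T x by (auto intro: linear_mod_in in_intros)
  have z: "N (T (c *\<^sub>R x) - c *\<^sub>R T x) = 0"
    using T x unfolding linear_mod_def by blast
  have "N (T (c *\<^sub>R x)) \<le> N (c *\<^sub>R T x) + N (T (c *\<^sub>R x) - c *\<^sub>R T x)"
    using i by (intro N_le_diff in_intros)
  moreover have "N (c *\<^sub>R T x) \<le> N (T (c *\<^sub>R x)) + N (c *\<^sub>R T x - T (c *\<^sub>R x))"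
    using i by (intro N_le_diff in_intros)
  moreover have "N (c *\<^sub>R T x - T (c *\<^sub>R x)) = 0"
    using z i N_minus_commute scale_in by metis
  ultimately show ?thesis using z N_scale[OF i(1), of c] by linarith
qed

text \<open>The operator norm: the infimum of all bounds is itself a bound, as is seen by dividing
  by N x where this is positive.\<close>

lemma optimal_bound:
  assumes T: "linear_mod T" and B: "bounded_on T M"
  obtains m where "bounded_on T m" "\<And>K. bounded_on T K \<Longrightarrow> m \<le> K"
proof -
  define A where "A = {K. bounded_on T K}"
  define m where "m = Inf A"
  have M: "M \<in> A" using B by (simp add: A_def)
  have bdd: "bdd_below A" by (auto simp: A_def bounded_on_def intro!: bdd_belowI[of _ 0])
  have le: "m \<le> K" if "K \<in> A" for K
    unfolding m_def by (rule cInf_lower[OF that bdd])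
  have m0: "0 \<le> m"
    unfolding m_def using M by (intro cInf_greatest) (auto simp: A_def bounded_on_def)
  have "N (T x) \<le> m * N x" if x: "x \<in> X" for x
  proof (cases "N x = 0")
    case True
    then show ?thesis using B x unfolding bounded_on_def by force
  next
    case False
    then have p: "N x > 0" using N_nonneg[OF x] by simp
    have "N (T x) / N x \<le> m"
      unfolding m_def
    proof (rule cInf_greatest)
      show "A \<noteq> {}" using M by auto
      fix K assume "K \<in> A"
      then have "N (T x) \<le> K * N x" using x by (auto simp: A_def bounded_on_def)
      then show "N (T x) / N x \<le> K" using p by (simp add: pos_divide_le_eq)
    qed
    then show ?thesis using p by (simp add: pos_divide_le_eq)
  qed
  then have "bounded_on T m" using m0 by (simp add: bounded_on_def)
  then show thesis using that le by (simp add: A_def)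
qed

text \<open>This supplies one hump: a vector of prescribed norm r on which T nearly attains its
  operator norm m. Since m > 0, the number 2/3 m is not a bound, and a vector violating it is
  rescaled.\<close>

lemma near_optimal_vector:
  assumes T: "linear_mod T" and B: "bounded_on T M" and K: "\<not> bounded_on T K" "0 \<le> K" and r: "0 < r"
  obtains m y where "bounded_on T m" "K < m" "y \<in> X" "N y = r" "2 / 3 * m * r < N (T y)"
proof -
  obtain m where m: "bounded_on T m" "\<And>K. bounded_on T K \<Longrightarrow> m \<le> K"
    using optimal_bound[OF T B] by blast
  have Km: "K < m"
  proof (rule ccontr)
    assume "\<not> K < m"
    then have mK: "m \<le> K" by simp
    have "N (T x) \<le> K * N x" if "x \<in> X" for x
      using m(1) that mult_right_mono[OF mK N_nonneg[OF that]] unfolding bounded_on_def by force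
    with K show False by (simp add: bounded_on_def)
  qed
  then have "\<not> bounded_on T (2 / 3 * m)"
    using m(2)[of "2 / 3 * m"] K(2) by auto
  then obtain y where y: "y \<in> X" "2 / 3 * m * N y < N (T y)"
    using Km K(2) by (auto simp: bounded_on_def not_le)
  have "N y \<noteq> 0"
    using y m(1) unfolding bounded_on_def by force
  then have p: "N y > 0" using N_nonneg[OF y(1)] by simp
  show thesis
  proof (rule that[OF m(1) Km])
    let ?y = "(r / N y) *\<^sub>R y"
    show "?y \<in> X" using y by (simp add: scale_in)
    show "N ?y = r" using p r by (simp add: N_scale[OF y(1)])
    have "2 / 3 * m * r = (r / N y) * (2 / 3 * m * N y)" using p by simp
    also have "\<dots> < (r / N y) * N (T y)" using y(2) p r by (intro mult_strict_left_mono) auto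
    also have "\<dots> = N (T ?y)" using linear_mod_scale[OF T y(1), of "r / N y"] p r by simp
    finally show "2 / 3 * m * r < N (T ?y)" .
  qed
qed

end

section \<open>Completeness and the uniform boundedness principle\<close>

locale banach_subspace = seminormed_subspace +
  assumes complete: "\<And>x :: nat \<Rightarrow> 'a. (\<And>n. x n \<in> X) \<Longrightarrow>
    (\<And>e. e > 0 \<Longrightarrow> \<exists>n0. \<forall>m\<ge>n0. \<forall>n\<ge>n0. N (x m - x n) < e) \<Longrightarrow>
    \<exists>l\<in>X. (\<lambda>n. N (x n - l)) \<longlonglongrightarrow> 0"
begin

text \<open>Sokal's gliding hump argument.\<close>

theorem uniform_boundedness:
  fixes T :: "nat \<Rightarrow> 'a \<Rightarrow> 'a"
  assumes T: "\<And>k. linear_mod (T k)" and B: "\<And>k. \<exists>M. bounded_on (T k) M"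
    and pw: "\<And>x. x \<in> X \<Longrightarrow> \<exists>C. \<forall>k. N (T k x) \<le> C"
  shows "\<exists>M. \<forall>k. bounded_on (T k) M"
proof (rule ccontr)
  assume unb: "\<not> ?thesis"
  have "\<exists>k m y. bounded_on (T k) m \<and> 4 ^ n < m \<and> y \<in> X \<and> N y = (1/3) ^ n \<and> 2 / 3 * m * (1/3) ^ n < N (T k y)" for n :: nat
  proof -
    obtain k where k: "\<not> bounded_on (T k) (4 ^ n)" using unb by blast
    obtain M where M: "bounded_on (T k) M" using B by blast
    have p: "(0::real) \<le> 4 ^ n" "(0::real) < (1/3) ^ n" by auto
    obtain m y where "bounded_on (T k) m" "4 ^ n < m" "y \<in> X" "N y = (1/3) ^ n" "2 / 3 * m * (1/3) ^ n < N (T k y)"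
      by (rule near_optimal_vector[OF T M k p])
    then show ?thesis by blast
  qed
  then obtain k m y where k: "\<And>n. bounded_on (T (k n)) (m n)" "\<And>n. 4 ^ n < m n" "\<And>n. y n \<in> X"
     "\<And>n. N (y n) = (1/3) ^ n" "\<And>n. 2 / 3 * m n * (1/3) ^ n < N (T (k n) (y n))"
    by metis
  \<comment> \<open>Of \<open>x + y n\<close> and \<open>x - y n\<close> the one with the larger
    image is kept. The images differ by 2 \<open>T (y n)\<close> up to null vectors, so the larger
    one has norm at least that of \<open>T (y n)\<close>.\<close>
  define x where "x = rec_nat 0 (\<lambda>n x. if N (T (k n) (x - y n)) \<le> N (T (k n) (x + y n)) then x + y n else x - y n)"
  have x0: "x 0 = 0" and xS: "x (Suc n) = (if N (T (k n) (x n - y n)) \<le> N (T (k n) (x n + y n)) then x n + y n else x n - y n)" for n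
    by (simp_all add: x_def)
  have xX: "x n \<in> X" for n
    by (induction n) (auto simp: x0 xS intro: in_intros k)
  have step: "N (x (Suc n) - x n) = (1/3) ^ n" for n
    using k(4)[of n] N_minus[OF k(3)[of n]] by (simp add: xS)
  have TS: "N (T (k n) (y n)) \<le> N (T (k n) (x (Suc n)))" for n
  proof -
    let ?T = "T (k n)"
    let ?a = "x n + y n" and ?b = "x n - y n"
    have ab: "?a \<in> X" "?b \<in> X" by (intro in_intros xX k)+
    have i: "?a \<in> X" "?b \<in> X" "?T ?a \<in> X" "?T ?b \<in> X" "?T (y n) \<in> X"
      using ab k(3) linear_mod_in[OF T] by auto
    have e: "?a - ?b = 2 *\<^sub>R y n" by (simp add: scaleR_2)
    have "2 * N (?T (y n)) = N (?T (?a - ?b))"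
      unfolding e using linear_mod_scale[OF T k(3), of "k n" 2 n] by simp
    also have "\<dots> \<le> N (?T ?a - ?T ?b) + N (?T (?a - ?b) - (?T ?a - ?T ?b))"
      by (rule N_le_diff[OF linear_mod_in[OF T diff_in[OF i(1,2)]] diff_in[OF i(3,4)]])
    also have "N (?T (?a - ?b) - (?T ?a - ?T ?b)) = 0"
      using i by (intro linear_mod_diff T)
    also have "N (?T ?a - ?T ?b) + 0 \<le> N (?T ?a) + N (?T ?b)"
      using N_triangle_diff[OF i(3,4)] by simp
    finally show ?thesis by (simp add: xS)
  qed
  \<comment> \<open>The remaining steps add up to at most 3^(-n) (1 + 1/3 + 1/9 + ...) = 3/2
    3^(-n).\<close>
  have tail: "N (x (n + j) - x n) \<le> 3 / 2 * (1/3) ^ n" for n j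
  proof -
    have "N (x (n + j) - x n) \<le> 3 / 2 * (1/3) ^ n - 3 / 2 * (1/3) ^ (n + j)"
    proof (induction j)
      case 0 then show ?case by (simp add: N_zero)
    next
      case (Suc j)
      have "N (x (n + Suc j) - x n) \<le> N (x (Suc (n + j)) - x (n + j)) + N (x (n + j) - x n)"
        using N_triangle3[OF xX xX xX] by simp
      then show ?case using Suc step[of "n + j"] by simp
    qed
    also have "\<dots> \<le> 3 / 2 * (1/3) ^ n" by simp
    finally show ?thesis .
  qed
  obtain l where l: "l \<in> X" "(\<lambda>n. N (x n - l)) \<longlonglongrightarrow> 0"
  proof -
    have "\<exists>n0. \<forall>p\<ge>n0. \<forall>q\<ge>n0. N (x p - x q) < e" if "e > 0" for e
    proof -
      have "0 < e / 3" using that by simp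
      from real_arch_pow_inv[OF this, of "1/3"] obtain n0 where n0: "(1/3::real) ^ n0 < e / 3"
        by auto
      have tp: "N (x p - x n0) \<le> 3 / 2 * (1/3) ^ n0" if "p \<ge> n0" for p
        using tail[of n0 "p - n0"] that by simp
      have "N (x p - x q) < e" if "p \<ge> n0" "q \<ge> n0" for p q
        using N_triangle3[OF xX[of p] xX[of n0] xX[of q]] N_minus_commute[OF xX[of q] xX[of n0]]
          tp[OF that(1)] tp[OF that(2)] n0 by linarith
      then show ?thesis by blast
    qed
    from complete[of x, OF xX this] that show thesis by blast
  qed
  have lim: "N (l - x n) \<le> 3 / 2 * (1/3) ^ n" for n
  proof (rule tendsto_lowerbound)
    show "(\<lambda>j. N (x (j + n) - l) + 3 / 2 * (1/3) ^ n) \<longlonglongrightarrow> 3 / 2 * (1/3) ^ n"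
      using tendsto_add[OF LIMSEQ_ignore_initial_segment[OF l(2), of n] tendsto_const[of "3 / 2 * (1/3::real) ^ n"]] by simp
    show "\<forall>\<^sub>F j in sequentially. N (l - x n) \<le> N (x (j + n) - l) + 3 / 2 * (1/3) ^ n"
    proof (intro always_eventually allI)
      fix j
      show "N (l - x n) \<le> N (x (j + n) - l) + 3 / 2 * (1/3) ^ n"
        using N_triangle3[OF l(1) xX[of "j + n"] xX[of n]] N_minus_commute[OF l(1) xX[of "j + n"]] tail[of n j]
        by (simp add: add.commute)
    qed
  qed simp
  \<comment> \<open>The hump contributes at least 2/3 m 3^(-n), and all later steps change the image
    by at most m 3/2 3^(-n-1) = 1/2 m 3^(-n). What is left is 1/6 m 3^(-n), and m > 4^n.\<close>
  have big: "1 / 6 * (4/3) ^ n \<le> N (T (k n) l)" for n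
  proof -
    have i: "T (k n) l \<in> X" "T (k n) (x (Suc n)) \<in> X"
      using linear_mod_in[OF T] l xX by auto
    have m0: "0 \<le> m n" using k(1)[of n] by (simp add: bounded_on_def)
    have "2 / 3 * m n * (1/3) ^ n \<le> N (T (k n) (x (Suc n)))"
      using k(5)[of n] TS[of n] by linarith
    also have "\<dots> \<le> N (T (k n) l) + N (T (k n) (x (Suc n)) - T (k n) l)"
      using i by (intro N_le_diff)
    also have "N (T (k n) (x (Suc n)) - T (k n) l) \<le> m n * N (x (Suc n) - l)"
      by (rule linear_mod_diff_bound[OF T k(1) xX l(1)])
    also have "\<dots> \<le> m n * (3 / 2 * (1/3) ^ Suc n)"
      using lim[of "Suc n"] N_minus_commute[OF l(1) xX[of "Suc n"]] m0 by (intro mult_left_mono) auto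
    finally have "1 / 6 * (m n * (1/3) ^ n) \<le> N (T (k n) l)" by simp
    moreover have "4 ^ n * (1/3) ^ n \<le> m n * (1/3) ^ n"
      using k(2)[of n] by (intro mult_right_mono) auto
    moreover have "(4 ^ n * (1/3) ^ n :: real) = (4/3) ^ n"
      by (simp flip: power_mult_distrib)
    ultimately show ?thesis by linarith
  qed
  obtain C where C: "\<And>k. N (T k l) \<le> C" using pw[OF l(1)] by blast
  obtain n where "6 * C < (4/3) ^ n" using real_arch_pow[of "4/3" "6 * C"] by auto
  then show False using big[of n] C[of "k n"] by simp
qed

end

section \<open>Semigroups: local boundedness and uniqueness of classical solutions\<close>

locale C0_semigroup_on = banach_subspace +
  fixes S :: "real \<Rightarrow> 'a \<Rightarrow> 'a"
  assumes sg: "C0_semigroup X N S"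
begin

lemma S_in: "0 \<le> t \<Longrightarrow> x \<in> X \<Longrightarrow> S t x \<in> X"
  using sg unfolding C0_semigroup_def by blast

lemma S_linear: "0 \<le> t \<Longrightarrow> linear_mod (S t)"
  using sg unfolding C0_semigroup_def linear_mod_def by blast

lemma S_bounded: assumes "0 \<le> t" shows "\<exists>M. bounded_on (S t) M"
proof -
  have "\<forall>t\<ge>0. \<exists>M. \<forall>x\<in>X. N (S t x) \<le> M * N x"
    using sg unfolding C0_semigroup_def by (elim conjE)
  then obtain M where M: "\<And>x. x \<in> X \<Longrightarrow> N (S t x) \<le> M * N x"
    using assms by metis
  have "N (S t x) \<le> \<bar>M\<bar> * N x" if "x \<in> X" for x
    using M[OF that] mult_right_mono[OF abs_ge_self[of M] N_nonneg[OF that]] by linarith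
  then show ?thesis by (auto simp: bounded_on_def intro!: exI[of _ "\<bar>M\<bar>"])
qed

lemma S_zero: "x \<in> X \<Longrightarrow> N (S 0 x - x) = 0"
  using sg unfolding C0_semigroup_def by blast

lemma S_add: "0 \<le> s \<Longrightarrow> 0 \<le> t \<Longrightarrow> x \<in> X \<Longrightarrow> N (S (s + t) x - S s (S t x)) = 0"
  using sg unfolding C0_semigroup_def by blast

lemma S_continuous_0: "x \<in> X \<Longrightarrow> ((\<lambda>t. N (S t x - x)) \<longlongrightarrow> 0) (at_right 0)"
  using sg unfolding C0_semigroup_def by blast

lemma at_right_0_D:
  assumes "((\<lambda>t::real. F t) \<longlongrightarrow> (0::real)) (at_right 0)" "0 < e"
  obtains d where "0 < d" "\<And>t. 0 < t \<Longrightarrow> t < d \<Longrightarrow> \<bar>F t\<bar> < e"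
proof -
  from tendstoD[OF assms] have "\<forall>\<^sub>F t in at_right 0. \<bar>F t\<bar> < e" by simp
  then show thesis using that unfolding eventually_at_right_field by auto
qed

text \<open>Otherwise there are times t_n <= 1/(n+1) at which n is not a bound. Strong continuity at
  0 bounds every orbit along these times, so uniform boundedness gives a common bound M, and any n
  >= M contradicts the choice of t_n.\<close>

lemma S_bounded_near_0: "\<exists>d>0. \<exists>M. \<forall>t\<in>{0..d}. bounded_on (S t) M"
proof (rule ccontr)
  assume "\<not> ?thesis"
  then have "\<forall>n::nat. \<exists>t\<in>{0..1 / real (Suc n)}. \<not> bounded_on (S t) (real n)"
    by (metis of_nat_0_less_iff zero_less_Suc zero_less_divide_1_iff)
  then obtain t where t: "\<And>n. t n \<in> {0..1 / real (Suc n)}" "\<And>n. \<not> bounded_on (S (t n)) (real n)"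
    by metis
  have t0: "0 \<le> t n" for n using t(1)[of n] by simp
  have "\<exists>M. \<forall>n. bounded_on (S (t n)) M"
  proof (rule uniform_boundedness)
    fix x assume x: "x \<in> X"
    obtain d where d: "0 < d" "\<And>t. 0 < t \<Longrightarrow> t < d \<Longrightarrow> \<bar>N (S t x - x)\<bar> < 1"
      using at_right_0_D[OF S_continuous_0[OF x], of 1] by auto
    have near: "N (S s x) \<le> N x + 1" if "0 \<le> s" "s < d" for s
      using N_le_diff[OF S_in[OF that(1) x] x] S_zero[OF x] d(2)[of s] that by (cases "s = 0") auto
    obtain n0 where n0: "1 / real (Suc n0) < d" using nat_approx_posE[OF d(1)] by blast
    \<comment> \<open>The finitely many early times are covered by a maximum, the later ones by
      continuity at 0; both bounds are nonnegative and can be added.\<close>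
    have "N (S (t n) x) \<le> Max ((\<lambda>n. N (S (t n) x)) ` {..n0}) + \<bar>N x + 1\<bar>" for n
    proof (cases "n \<le> n0")
      case True
      then have "N (S (t n) x) \<le> Max ((\<lambda>n. N (S (t n) x)) ` {..n0})" by (intro Max_ge) auto
      then show ?thesis by linarith
    next
      case False
      have "t n \<le> 1 / real (Suc n)" using t(1)[of n] by simp
      also have "\<dots> \<le> 1 / real (Suc n0)" using False by (intro divide_left_mono) auto
      finally have "N (S (t n) x) \<le> N x + 1" using near[of "t n"] t0[of n] n0 by simp
      moreover have "0 \<le> Max ((\<lambda>n. N (S (t n) x)) ` {..n0})"
        using N_nonneg[OF S_in[OF t0[of 0] x]] by (intro order_trans[OF _ Max_ge[of _ "N (S (t 0) x)"]]) auto
      ultimately show ?thesis by linarith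
    qed
    then show "\<exists>C. \<forall>n. N (S (t n) x) \<le> C" by blast
  qed (use t0 S_linear S_bounded in auto)
  then obtain M where M: "\<And>n. bounded_on (S (t n)) M" by blast
  obtain n where n: "M \<le> real n" using real_arch_simple by blast
  have "bounded_on (S (t n)) (real n)"
    using M[of n] mult_right_mono[OF n N_nonneg] unfolding bounded_on_def by force
  with t(2) show False by blast
qed

lemma S_add_bound:
  assumes "0 \<le> s" "0 \<le> t" "bounded_on (S s) M" "bounded_on (S t) L"
  shows "bounded_on (S (s + t)) (M * L)"
  unfolding bounded_on_def
proof (intro conjI ballI)
  show "0 \<le> M * L" using assms unfolding bounded_on_def by simp
  fix x assume x: "x \<in> X"
  have "N (S (s + t) x) \<le> N (S s (S t x)) + N (S (s + t) x - S s (S t x))"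
    using assms x by (intro N_le_diff S_in) auto
  also have "\<dots> = N (S s (S t x))"
    using S_add[OF assms(1,2) x] by simp
  also have "\<dots> \<le> M * N (S t x)"
    using assms(3) S_in[OF assms(2) x] unfolding bounded_on_def by blast
  also have "\<dots> \<le> M * (L * N x)"
    using assms(3,4) x unfolding bounded_on_def by (intro mult_left_mono) auto
  finally show "N (S (s + t) x) \<le> M * L * N x" by (simp add: mult.assoc)
qed

text \<open>The semigroup law propagates the bound near 0 in steps of length d.\<close>

lemma S_locally_bounded: "\<exists>M. \<forall>t\<in>{0..a}. bounded_on (S t) M"
proof -
  obtain d M where d: "d > 0" "\<And>t. t \<in> {0..d} \<Longrightarrow> bounded_on (S t) M"
    using S_bounded_near_0 by blast
  \<comment> \<open>With M' >= 1 the powers increase, so the bound for more steps also serves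
    shorter times.\<close>
  define M' where "M' = max M 1"
  have M': "bounded_on (S t) M'" if "t \<in> {0..d}" for t
    using d(2)[OF that] mult_right_mono[OF _ N_nonneg, of M M'] unfolding bounded_on_def M'_def by force
  have "\<forall>t\<in>{0..real n * d}. bounded_on (S t) (M' ^ Suc n)" for n
  proof (induction n)
    case 0 then show ?case using M'[of 0] d(1) by simp
  next
    case (Suc n)
    show ?case
    proof
      fix t assume t: "t \<in> {0..real (Suc n) * d}"
      show "bounded_on (S t) (M' ^ Suc (Suc n))"
      proof (cases "t \<le> d")
        case True
        have "M' \<le> M' ^ Suc (Suc n)" using self_le_power[of M' "Suc (Suc n)"] by (simp add: M'_def)
        then show ?thesis
          using M'[of t] t True mult_right_mono[OF _ N_nonneg, of M' "M' ^ Suc (Suc n)"] unfolding bounded_on_def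
          by (force simp del: power_Suc)
      next
        case False
        then have "t - d \<in> {0..real n * d}" using t by (simp add: algebra_simps)
        then have "bounded_on (S (t - d)) (M' ^ Suc n)" using Suc by blast
        from S_add_bound[OF _ _ M' this, of d] show ?thesis using False d(1) by simp
      qed
    qed
  qed
  moreover obtain n where "a \<le> real n * d"
    using reals_Archimedean3[OF d(1)] less_imp_le by blast
  ultimately show ?thesis by (metis atLeastAtMost_iff order_trans)
qed

lemma generator_D:
  assumes "(x, y) \<in> infinitesimal_generator X N S" "0 < e"
  obtains d where "0 < d" "\<And>h. 0 < h \<Longrightarrow> h < d \<Longrightarrow> N (S h x - x - h *\<^sub>R y) \<le> e * h"
proof -
  have x: "x \<in> X" "y \<in> X" and lim: "((\<lambda>h. N ((1 / h) *\<^sub>R (S h x - x) - y)) \<longlongrightarrow> 0) (at_right 0)"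
    using assms(1) by (auto simp: infinitesimal_generator_def)
  obtain d where d: "0 < d" "\<And>h. 0 < h \<Longrightarrow> h < d \<Longrightarrow> \<bar>N ((1 / h) *\<^sub>R (S h x - x) - y)\<bar> < e"
    using at_right_0_D[OF lim assms(2)] by blast
  show thesis
  proof (rule that[OF d(1)])
    fix h :: real assume h: "0 < h" "h < d"
    have i: "(1 / h) *\<^sub>R (S h x - x) - y \<in> X"
      using x h S_in by (intro in_intros) auto
    have "S h x - x - h *\<^sub>R y = h *\<^sub>R ((1 / h) *\<^sub>R (S h x - x) - y)"
      using h by (simp add: scaleR_diff_right)
    then have "N (S h x - x - h *\<^sub>R y) = h * N ((1 / h) *\<^sub>R (S h x - x) - y)"
      using N_scale[OF i, of h] h by simp
    also have "\<dots> \<le> h * e"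
      using d(2)[OF h] h by (intro mult_left_mono) auto
    finally show "N (S h x - x - h *\<^sub>R y) \<le> e * h" by (simp add: mult.commute)
  qed
qed

text \<open>
  The map \<open>s \<mapsto> S (a - s) (W s)\<close> has derivative zero.
\<close>

theorem classical_solution_unique:
  assumes a: "0 \<le> a"
    and gen: "\<And>s. s \<in> {0..a} \<Longrightarrow> (W s, y s) \<in> infinitesimal_generator X N S"
    and der: "\<And>s e. s \<in> {0..a} \<Longrightarrow> 0 < e \<Longrightarrow>
       \<exists>d>0. \<forall>r\<in>{0..a}. \<bar>r - s\<bar> < d \<longrightarrow> N (W r - W s - (r - s) *\<^sub>R y s) \<le> e * \<bar>r - s\<bar>"
  shows "N (S a (W 0) - W a) = 0"
proof -
  obtain M0 where M0: "\<And>t. t \<in> {0..a} \<Longrightarrow> bounded_on (S t) M0"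
    using S_locally_bounded by blast
  define M where "M = max M0 1"
  have M1: "1 \<le> M" by (simp add: M_def)
  have M: "bounded_on (S t) M" if "t \<in> {0..a}" for t
    using M0[OF that] mult_right_mono[OF _ N_nonneg, of M0 M] unfolding bounded_on_def M_def by force
  have WX: "W s \<in> X" "y s \<in> X" if "s \<in> {0..a}" for s
    using gen[OF that] by (auto simp: infinitesimal_generator_def)
  define f where "f s = S (a - s) (W s)" for s
  have fX: "f s \<in> X" if "s \<in> {0..a}" for s
    using that WX S_in by (simp add: f_def)
  \<comment> \<open>For s <= r the operator S(a - s) factors as S(a - r) S(r - s) up to null
    vectors, so f r - f s is the image under S(a - r) of W r - S(r - s)(W s).\<close>
  have forward: "N (f r - f s) \<le> M * N (W r - S (r - s) (W s))" if "s \<in> {0..a}" "r \<in> {0..a}" "s \<le> r" for s r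
  proof -
    have i: "S (r - s) (W s) \<in> X" "S (a - r) (S (r - s) (W s)) \<in> X"
      using that WX S_in by auto
    have e: "N (f s - S (a - r) (S (r - s) (W s))) = 0"
      using S_add[of "a - r" "r - s" "W s"] that WX by (simp add: f_def)
    have "N (f r - f s) \<le> N (f r - S (a - r) (S (r - s) (W s))) + N (S (a - r) (S (r - s) (W s)) - f s)"
      using that i fX by (intro N_triangle3) auto
    also have "N (S (a - r) (S (r - s) (W s)) - f s) = 0"
      using e N_minus_commute[OF i(2) fX[OF that(1)]] by simp
    also have "N (f r - S (a - r) (S (r - s) (W s))) \<le> M * N (W r - S (r - s) (W s))"
      unfolding f_def using that i WX by (intro linear_mod_diff_bound S_linear M) auto
    finally show ?thesis by simp
  qed
  have small: "\<exists>d>0. \<forall>r\<in>{0..a}. \<bar>r - s\<bar> < d \<longrightarrow> N (f r - f s) \<le> e * \<bar>r - s\<bar>"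
    if s: "s \<in> {0..a}" and e: "0 < e" for s e
  proof -
    \<comment> \<open>Each case below produces at most 3 M e' h, and \<open>forward\<close> costs
      another factor M.\<close>
    define e' where "e' = e / (4 * M * M)"
    have e': "e' > 0" using e M1 by (simp add: e'_def)
    obtain d1 where d1: "d1 > 0" "\<And>r. r \<in> {0..a} \<Longrightarrow> \<bar>r - s\<bar> < d1 \<Longrightarrow> N (W r - W s - (r - s) *\<^sub>R y s) \<le> e' * \<bar>r - s\<bar>"
      using der[OF s e'] by blast
    obtain d2 where d2: "d2 > 0" "\<And>h. 0 < h \<Longrightarrow> h < d2 \<Longrightarrow> N (S h (W s) - W s - h *\<^sub>R y s) \<le> e' * h"
      using generator_D[OF gen[OF s] e'] by blast
    obtain d3 where d3: "d3 > 0" "\<And>h. 0 < h \<Longrightarrow> h < d3 \<Longrightarrow> \<bar>N (S h (y s) - y s)\<bar> < e'"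
      using at_right_0_D[OF S_continuous_0[OF WX(2)[OF s]] e'] by blast
    show ?thesis
    proof (intro exI[of _ "min d1 (min d2 d3)"] conjI ballI impI)
      show "0 < min d1 (min d2 d3)" using d1 d2 d3 by simp
      fix r assume r: "r \<in> {0..a}" and rs: "\<bar>r - s\<bar> < min d1 (min d2 d3)"
      note X = WX[OF s] WX[OF r]
      have bound: "M * (3 * M * e' * h) \<le> e * h" if "0 \<le> h" for h
      proof -
        have "M * (3 * M * e' * h) \<le> (4 * M * M * e') * h" using that M1 e' by (simp add: mult_ac)
        also have "4 * M * M * e' = e" using M1 by (simp add: e'_def)
        finally show ?thesis .
      qed
      consider "r = s" | "s < r" | "r < s" by linarith
      then show "N (f r - f s) \<le> e * \<bar>r - s\<bar>"
      proof cases
        case 1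
        then show ?thesis by (simp add: N_zero)
      next
        case 2
        define h where "h = r - s"
        have h: "0 < h" "h < d1" "h < d2" "h \<le> a" "r = s + h" "\<bar>r - s\<bar> = h" using 2 rs r s by (auto simp: h_def)
        have i: "S h (W s) \<in> X" using S_in X h by auto
        have "W r - S h (W s) = (W r - W s - h *\<^sub>R y s) - (S h (W s) - W s - h *\<^sub>R y s)" by simp
        then have "N (W r - S h (W s)) \<le> N (W r - W s - h *\<^sub>R y s) + N (S h (W s) - W s - h *\<^sub>R y s)"
          using N_triangle_diff[of "W r - W s - h *\<^sub>R y s" "S h (W s) - W s - h *\<^sub>R y s"] X i by (auto intro: in_intros)
        also have "\<dots> \<le> e' * h + e' * h"
          using d1(2)[OF r] d2(2)[of h] h rs by (intro add_mono) auto
        also have "\<dots> \<le> 3 * M * e' * h"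
          using M1 e' h by (simp add: mult_le_cancel_right)
        finally have "M * N (W r - S h (W s)) \<le> M * (3 * M * e' * h)"
          using M1 by (intro mult_left_mono) auto
        moreover have "N (f r - f s) \<le> M * N (W r - S h (W s))"
          using forward[OF s r] 2 by (simp add: h_def)
        ultimately have "N (f r - f s) \<le> e * h" using bound[of h] h(1) by linarith
        then show ?thesis by (simp only: h(6))
      next
        \<comment> \<open>The generator is a right derivative at W s, so W r is first replaced by
          its linearisation z = W s - h y s. Then S h z is S h (W s) - h S h (y s) up to null
          vectors, and S h (W s) is W s + h y s up to o(h). What remains is h (S h (y s) - y s),
          which is small by strong continuity at 0.\<close>
        case 3
        define h where "h = s - r"
        have h: "0 < h" "h < d1" "h < d2" "h < d3" "h \<le> a" "r = s - h" "\<bar>r - s\<bar> = h" "r - s = - h"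
          using 3 rs r s by (auto simp: h_def)
        define z where "z = W s - h *\<^sub>R y s"
        have zX: "z \<in> X" unfolding z_def using X by (intro in_intros)
        have hX: "h *\<^sub>R y s \<in> X" using X by (intro in_intros)
        have i: "S h (W s) \<in> X" "S h (W r) \<in> X" "S h z \<in> X" "S h (y s) \<in> X" "S h (h *\<^sub>R y s) \<in> X"
          using S_in[OF less_imp_le[OF h(1)]] X zX hX by auto
        have lin: "linear_mod (S h)" and Mh: "bounded_on (S h) M" using S_linear M h by auto
        have a1: "N (S h z - S h (W r)) \<le> M * (e' * h)"
        proof -
          have "N (S h z - S h (W r)) \<le> M * N (z - W r)"
            by (rule linear_mod_diff_bound[OF lin Mh zX X(3)])
          also have "N (z - W r) = N (W r - W s - (r - s) *\<^sub>R y s)"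
          proof -
            have "W r - W s - (r - s) *\<^sub>R y s = W r - z" unfolding h(8) z_def by simp
            then show ?thesis using N_minus_commute[OF zX X(3)] by (simp only:)
          qed
          also have "M * \<dots> \<le> M * (e' * h)"
          proof (rule mult_left_mono)
            show "N (W r - W s - (r - s) *\<^sub>R y s) \<le> e' * h"
              using d1(2)[OF r] h(2) unfolding h(7) by blast
          qed (use M1 in simp)
          finally show ?thesis .
        qed
        have a2: "N (S h z - (S h (W s) - S h (h *\<^sub>R y s))) = 0"
          unfolding z_def by (rule linear_mod_diff[OF lin X(1) hX])
        have a3: "N (S h (W s) - W s - h *\<^sub>R y s) \<le> e' * h"
          using d2(2) h by auto
        have a4: "N (S h (h *\<^sub>R y s) - h *\<^sub>R S h (y s)) = 0"
          using lin X(2) unfolding linear_mod_def by blast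
        have a5: "N (h *\<^sub>R (S h (y s) - y s)) \<le> e' * h"
          using N_scale[OF diff_in[OF i(4) X(2)], of h] d3(2)[of h] h by (simp add: mult.commute)
        have eq: "W s - S h (W r) = (S h z - S h (W r)) - (S h z - (S h (W s) - S h (h *\<^sub>R y s)))
           - (S h (W s) - W s - h *\<^sub>R y s) + (S h (h *\<^sub>R y s) - h *\<^sub>R S h (y s)) + h *\<^sub>R (S h (y s) - y s)"
          by (simp add: algebra_simps)
        have "N (W s - S h (W r)) \<le> N (S h z - S h (W r)) + N (S h z - (S h (W s) - S h (h *\<^sub>R y s)))
           + N (S h (W s) - W s - h *\<^sub>R y s) + N (S h (h *\<^sub>R y s) - h *\<^sub>R S h (y s)) + N (h *\<^sub>R (S h (y s) - y s))"
          unfolding eq using i zX X hX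
          by (intro order_trans[OF N_triangle] order_trans[OF N_triangle_diff] add_mono in_intros order_refl)
        also have "\<dots> \<le> M * (e' * h) + 0 + e' * h + 0 + e' * h"
          using a1 a2 a3 a4 a5 by linarith
        also have "\<dots> \<le> 3 * M * e' * h"
        proof -
          have "e' * h \<le> M * (e' * h)" using M1 e' h mult_right_mono[of 1 M "e' * h"] by simp
          then show ?thesis by (simp add: mult_ac)
        qed
        finally have "M * N (W s - S h (W r)) \<le> M * (3 * M * e' * h)"
          using M1 by (intro mult_left_mono) auto
        moreover have "N (f s - f r) \<le> M * N (W s - S h (W r))"
          using forward[OF r s] 3 by (simp add: h_def)
        ultimately have "N (f s - f r) \<le> e * h" using bound[of h] h by linarith
        then show ?thesis unfolding h(7) N_minus_commute[OF fX[OF r] fX[OF s]] .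
      qed
    qed
  qed
  \<comment> \<open>Differentiability of f is available only through the seminorm; the real function
    g has derivative zero in the usual sense and is therefore constant.\<close>
  define g where "g s = N (f s - f 0)" for s
  have g_diff: "\<bar>g r - g s\<bar> \<le> N (f r - f s)" if "s \<in> {0..a}" "r \<in> {0..a}" for s r
    using N_triangle3[OF fX[OF that(2)] fX[OF that(1)] fX[of 0]] N_triangle3[OF fX[OF that(1)] fX[OF that(2)] fX[of 0]]
      N_minus_commute[OF fX[OF that(1)] fX[OF that(2)]] a by (simp add: g_def abs_le_iff)
  have "(g has_derivative (\<lambda>h. 0)) (at s within {0..a})" if s: "s \<in> {0..a}" for s
    unfolding has_derivative_within_alt
  proof (intro conjI allI impI)
    fix e :: real assume "0 < e"
    then obtain d where d: "d > 0" "\<And>r. r \<in> {0..a} \<Longrightarrow> \<bar>r - s\<bar> < d \<Longrightarrow> N (f r - f s) \<le> e * \<bar>r - s\<bar>"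
      using small[OF s] by blast
    have "norm (g r - g s - 0) \<le> e * norm (r - s)" if "r \<in> {0..a}" "norm (r - s) < d" for r
      using order_trans[OF g_diff[OF s that(1)] d(2)[OF that(1)]] that(2) by simp
    with d(1) show "\<exists>d>0. \<forall>r\<in>{0..a}. norm (r - s) < d \<longrightarrow> norm (g r - g s - 0) \<le> e * norm (r - s)"
      by blast
  qed simp
  then have "g a = g 0"
    using has_derivative_zero_unique[of "{0..a}" g 0 a] a by simp
  then have "N (f a - f 0) = 0"
    by (simp add: g_def N_zero)
  moreover have "N (f a - W a) = 0"
    using S_zero[OF WX(1)[of a]] a by (simp add: f_def)
  moreover have "N (f 0 - W a) \<le> N (f 0 - f a) + N (f a - W a)"
    using fX[of 0] fX[of a] WX(1)[of a] a by (intro N_triangle3) auto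
  moreover have "N (f 0 - f a) = N (f a - f 0)"
    using fX[of 0] fX[of a] a by (intro N_minus_commute) auto
  moreover have "0 \<le> N (f 0 - W a)"
    using fX[of 0] WX(1)[of a] a by (intro N_nonneg in_intros) auto
  ultimately show ?thesis
    by (simp add: f_def)
qed

end

subsection \<open>The energy space\<close>

definition bessel_weight :: "'a::euclidean_space \<Rightarrow> real" where
  "bessel_weight \<xi> = sqrt (1 + (norm \<xi>)\<^sup>2)"

lemma bessel_weight_measurable [measurable]: "bessel_weight \<in> borel_measurable borel"
  unfolding bessel_weight_def[abs_def] by measurable

lemma bessel_weight_ge_1: "1 \<le> bessel_weight \<xi>"
  by (simp add: bessel_weight_def)

text \<open>An isometry from \<open>sobolev 1\<close> into \<open>L2\<close>, through which the
  Sobolev space inherits the triangle inequality and completeness.\<close>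

definition weighted_fourier :: "('a::euclidean_space \<Rightarrow> complex) \<Rightarrow> 'a \<Rightarrow> complex" where
  "weighted_fourier f \<xi> = complex_of_real (bessel_weight \<xi>) * fourier_L2 f \<xi>"

lemma weighted_fourier_measurable:
  assumes "f \<in> L2" shows "weighted_fourier f \<in> borel_measurable borel"
proof -
  have [measurable]: "fourier_L2 f \<in> borel_measurable borel"
    by (intro L2_borel fourier_L2_L2 assms)
  show ?thesis unfolding weighted_fourier_def[abs_def] by measurable
qed

lemma weighted_fourier_sq: "(cmod (weighted_fourier f \<xi>))\<^sup>2 = (1 + (norm \<xi>)\<^sup>2) powr 1 * (cmod (fourier_L2 f \<xi>))\<^sup>2"
  by (simp add: weighted_fourier_def norm_mult power_mult_distrib bessel_weight_def add_nonneg_nonneg)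

lemma sobolev_1_iff: "f \<in> sobolev 1 \<longleftrightarrow> f \<in> L2 \<and> weighted_fourier f \<in> L2"
  unfolding sobolev_def weighted_fourier_sq[symmetric]
  by (auto simp: L2_def intro: weighted_fourier_measurable[unfolded L2_def, simplified])

lemma sobolev_1_norm: "sobolev_norm 1 f = L2_norm (weighted_fourier f)"
  unfolding sobolev_norm_def L2_norm_def weighted_fourier_sq ..

lemma weighted_fourier_add:
  assumes "f \<in> L2" "g \<in> L2"
  shows "AE \<xi> in lborel. weighted_fourier (f + g) \<xi> = (weighted_fourier f + weighted_fourier g) \<xi>"
  using fourier_L2_add[OF assms] by eventually_elim (simp add: weighted_fourier_def distrib_left)

lemma weighted_fourier_diff:
  assumes "f \<in> L2" "g \<in> L2"
  shows "AE \<xi> in lborel. weighted_fourier (f - g) \<xi> = (weighted_fourier f - weighted_fourier g) \<xi>"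
  using fourier_L2_diff[OF assms] by eventually_elim (simp add: weighted_fourier_def right_diff_distrib)

lemma weighted_fourier_scaleR:
  assumes "f \<in> L2"
  shows "AE \<xi> in lborel. weighted_fourier (c *\<^sub>R f) \<xi> = (c *\<^sub>R weighted_fourier f) \<xi>"
  using fourier_L2_scaleR[OF assms, of c]
  by eventually_elim (simp add: weighted_fourier_def scaleR_fun_def scaleR_conv_of_real)

lemma sobolev_1_L2: "f \<in> sobolev 1 \<Longrightarrow> f \<in> L2"
  by (simp add: sobolev_1_iff)

lemma sobolev_1_add:
  assumes "f \<in> sobolev 1" "g \<in> sobolev 1"
  shows "f + g \<in> sobolev 1" "sobolev_norm 1 (f + g) \<le> sobolev_norm 1 f + sobolev_norm 1 g"
proof -
  have L: "f \<in> L2" "g \<in> L2" "weighted_fourier f \<in> L2" "weighted_fourier g \<in> L2"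
    using assms by (auto simp: sobolev_1_iff)
  note s = L2_add[OF L(3,4)]
  have m: "weighted_fourier (f + g) \<in> borel_measurable borel"
    by (intro weighted_fourier_measurable L2_add L)
  have ae: "AE \<xi> in lborel. (weighted_fourier f + weighted_fourier g) \<xi> = weighted_fourier (f + g) \<xi>"
    using weighted_fourier_add[OF L(1,2)] by eventually_elim (rule sym)
  show "f + g \<in> sobolev 1"
    using L2_cong[OF s ae m] L2_add[OF L(1,2)] by (simp add: sobolev_1_iff)
  show "sobolev_norm 1 (f + g) \<le> sobolev_norm 1 f + sobolev_norm 1 g"
    unfolding sobolev_1_norm L2_norm_cong[OF ae L2_borel[OF s] m, symmetric] by (rule L2_triangle[OF L(3,4)])
qed

lemma sobolev_1_scaleR:
  assumes "f \<in> sobolev 1"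
  shows "c *\<^sub>R f \<in> sobolev 1" "sobolev_norm 1 (c *\<^sub>R f) = \<bar>c\<bar> * sobolev_norm 1 f"
proof -
  have L: "f \<in> L2" "weighted_fourier f \<in> L2"
    using assms by (auto simp: sobolev_1_iff)
  note s = L2_scaleR[OF L(2), of c]
  have m: "weighted_fourier (c *\<^sub>R f) \<in> borel_measurable borel"
    by (intro weighted_fourier_measurable L2_scaleR L)
  have ae: "AE \<xi> in lborel. (c *\<^sub>R weighted_fourier f) \<xi> = weighted_fourier (c *\<^sub>R f) \<xi>"
    using weighted_fourier_scaleR[OF L(1), of c] by eventually_elim (rule sym)
  show "c *\<^sub>R f \<in> sobolev 1"
    using L2_cong[OF s ae m] L2_scaleR[OF L(1)] by (simp add: sobolev_1_iff)
  show "sobolev_norm 1 (c *\<^sub>R f) = \<bar>c\<bar> * sobolev_norm 1 f"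
    unfolding sobolev_1_norm L2_norm_cong[OF ae L2_borel[OF s] m, symmetric] by (rule L2_norm_scaleR)
qed

lemma sobolev_1_diff:
  assumes "f \<in> sobolev 1" "g \<in> sobolev 1"
  shows "f - g \<in> sobolev 1" "sobolev_norm 1 (f - g) = L2_norm (weighted_fourier f - weighted_fourier g)"
proof -
  have L: "f \<in> L2" "g \<in> L2" "weighted_fourier f \<in> L2" "weighted_fourier g \<in> L2"
    using assms by (auto simp: sobolev_1_iff)
  note s = L2_diff[OF L(3,4)]
  have m: "weighted_fourier (f - g) \<in> borel_measurable borel"
    by (intro weighted_fourier_measurable L2_diff L)
  have ae: "AE \<xi> in lborel. (weighted_fourier f - weighted_fourier g) \<xi> = weighted_fourier (f - g) \<xi>"
    using weighted_fourier_diff[OF L(1,2)] by eventually_elim (rule sym)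
  show "f - g \<in> sobolev 1"
    using L2_cong[OF s ae m] L2_diff[OF L(1,2)] by (simp add: sobolev_1_iff)
  show "sobolev_norm 1 (f - g) = L2_norm (weighted_fourier f - weighted_fourier g)"
    unfolding sobolev_1_norm by (rule L2_norm_cong[OF ae L2_borel[OF s] m, symmetric])
qed

text \<open>\<open>fourier_L2 0\<close> is a chosen representative and is known to vanish only
  almost everywhere; this follows from homogeneity with the factor 0.\<close>

lemma zero_sobolev_1: "0 \<in> sobolev 1"
proof -
  have "AE \<xi> in lborel. (0 :: 'a \<Rightarrow> complex) \<xi> = weighted_fourier (0 :: 'a \<Rightarrow> complex) \<xi>"
    using fourier_L2_scaleR[OF L2_zero, of 0]
    by eventually_elim (simp add: weighted_fourier_def)
  from L2_cong[OF L2_zero this] show ?thesis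
    by (simp add: sobolev_1_iff weighted_fourier_measurable)
qed

text \<open>The weighted transforms converge in L2. Their limit divided by the weight, which is at
  least 1, stays in L2 and is a transform by surjectivity.\<close>

lemma sobolev_1_complete:
  fixes u :: "nat \<Rightarrow> 'a::euclidean_space \<Rightarrow> complex"
  assumes u: "\<And>k. u k \<in> sobolev 1"
    and c: "\<And>e. e > 0 \<Longrightarrow> \<exists>n0. \<forall>m\<ge>n0. \<forall>n\<ge>n0. sobolev_norm 1 (u m - u n) < e"
  obtains l where "l \<in> sobolev 1" "(\<lambda>k. sobolev_norm 1 (u k - l)) \<longlonglongrightarrow> 0"
proof -
  have L: "weighted_fourier (u k) \<in> L2" for k using u by (simp add: sobolev_1_iff)
  obtain G where G: "G \<in> L2" "(\<lambda>k. L2_norm (weighted_fourier (u k) - G)) \<longlonglongrightarrow> 0"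
    using L2_complete[of "\<lambda>k. weighted_fourier (u k)"] L c[unfolded sobolev_1_diff(2)[OF u u]] by blast
  have [measurable]: "G \<in> borel_measurable borel" using L2_borel[OF G(1)] .
  define g where "g \<xi> = complex_of_real (1 / bessel_weight \<xi>) * G \<xi>" for \<xi>
  have g_meas: "g \<in> borel_measurable borel" unfolding g_def[abs_def] by measurable
  have g: "g \<in> L2"
  proof (rule L2_norm_mono(1)[OF G(1) g_meas], rule AE_I2)
    fix \<xi>
    have "cmod (g \<xi>) = 1 / bessel_weight \<xi> * cmod (G \<xi>)"
      using bessel_weight_ge_1[of \<xi>] unfolding g_def norm_mult norm_of_real by simp
    also have "\<dots> \<le> 1 * cmod (G \<xi>)"
      using bessel_weight_ge_1[of \<xi>] by (intro mult_right_mono) auto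
    finally show "cmod (g \<xi>) \<le> cmod (G \<xi>)" by simp
  qed
  define l where "l = inv_fourier_L2 g"
  have lL: "l \<in> L2" unfolding l_def by (rule inv_fourier_L2_L2[OF g])
  have ae: "AE \<xi> in lborel. G \<xi> = weighted_fourier l \<xi>"
    using fourier_inv_fourier_L2[OF g]
  proof eventually_elim
    case (elim \<xi>)
    have "bessel_weight \<xi> \<noteq> 0" using bessel_weight_ge_1[of \<xi>] by simp
    then show ?case by (simp add: weighted_fourier_def l_def elim g_def flip: of_real_mult mult.assoc)
  qed
  note m = weighted_fourier_measurable[OF lL]
  have l: "l \<in> sobolev 1"
    using L2_cong[OF G(1) ae m] lL by (simp add: sobolev_1_iff)
  have eq: "sobolev_norm 1 (u k - l) = L2_norm (weighted_fourier (u k) - G)" for k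
    unfolding sobolev_1_diff(2)[OF u l]
  proof (rule L2_norm_cong)
    show "AE x in lborel. (weighted_fourier (u k) - weighted_fourier l) x = (weighted_fourier (u k) - G) x"
      using ae by eventually_elim simp
    show "weighted_fourier (u k) - weighted_fourier l \<in> borel_measurable borel"
      using L l by (intro L2_borel L2_diff) (auto simp: sobolev_1_iff)
    show "weighted_fourier (u k) - G \<in> borel_measurable borel"
      using L G by (intro L2_borel L2_diff) auto
  qed
  show thesis
    by (rule that[OF l]) (use G(2) eq in simp)
qed

section \<open>The energy norm and its completeness\<close>

lemma energy_norm_Pair: "energy_norm (u, v) = norm (sobolev_norm 1 u, L2_norm v)"
  by (simp add: energy_norm_def norm_Pair)

lemma sobolev_norm_1_nonneg [simp]: "0 \<le> sobolev_norm 1 u"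
  by (simp add: sobolev_1_norm)

lemma energy_norm_ge: "sobolev_norm 1 (fst z) \<le> energy_norm z" "L2_norm (snd z) \<le> energy_norm z"
  by (cases z; simp add: energy_norm_def real_le_rsqrt)+

lemma energy_norm_le: "energy_norm z \<le> sobolev_norm 1 (fst z) + L2_norm (snd z)"
proof (cases z)
  case (Pair u v)
  then show ?thesis
    using norm_Pair_le[of "sobolev_norm 1 u" "L2_norm v"] by (simp add: energy_norm_Pair)
qed

lemma norm_Pair_mono:
  fixes a b :: real
  assumes "0 \<le> a" "a \<le> a'" "0 \<le> b" "b \<le> b'"
  shows "norm (a, b) \<le> norm (a', b')"
  using assms by (simp add: norm_Pair add_mono power_mono)

interpretation energy: banach_subspace energy_space "energy_norm :: 'a::euclidean_space state \<Rightarrow> real"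
proof
  show "(0 :: 'a state) \<in> energy_space"
    by (simp add: energy_space_def zero_prod_def zero_sobolev_1)
  fix x y :: "'a state" and c :: real
  assume x: "x \<in> energy_space"
  obtain u v where xe: "x = (u, v)" and u: "u \<in> sobolev 1" and v: "v \<in> L2"
    using x by (auto simp: energy_space_def)
  show "c *\<^sub>R x \<in> energy_space"
    using u v by (simp add: xe energy_space_def sobolev_1_scaleR L2_scaleR)
  show "energy_norm (c *\<^sub>R x) = \<bar>c\<bar> * energy_norm x"
    using norm_scaleR[of c "(sobolev_norm 1 u, L2_norm v)"]
    by (simp add: xe energy_norm_Pair sobolev_1_scaleR(2)[OF u] L2_norm_scaleR norm_Pair power_mult_distrib)
  assume "y \<in> energy_space"
  then obtain u' v' where ye: "y = (u', v')" and u': "u' \<in> sobolev 1" and v': "v' \<in> L2"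
    by (auto simp: energy_space_def)
  show "x + y \<in> energy_space"
    using u v u' v' by (simp add: xe ye energy_space_def sobolev_1_add L2_add del: plus_fun_apply)
  have "energy_norm (x + y) = norm (sobolev_norm 1 (u + u'), L2_norm (v + v'))"
    by (simp only: xe ye add_Pair energy_norm_Pair)
  also have "\<dots> \<le> norm (sobolev_norm 1 u + sobolev_norm 1 u', L2_norm v + L2_norm v')"
    by (intro norm_Pair_mono sobolev_1_add(2)[OF u u'] L2_triangle[OF v v']) auto
  also have "\<dots> \<le> energy_norm x + energy_norm y"
    unfolding xe ye energy_norm_Pair add_Pair[symmetric] by (rule norm_triangle_ineq)
  finally show "energy_norm (x + y) \<le> energy_norm x + energy_norm y" .
next
  fix x :: "nat \<Rightarrow> 'a state"
  assume xX: "\<And>n. x n \<in> energy_space"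
    and c: "\<And>e. e > 0 \<Longrightarrow> \<exists>n0. \<forall>m\<ge>n0. \<forall>n\<ge>n0. energy_norm (x m - x n) < e"
  have u: "fst (x n) \<in> sobolev 1" and v: "snd (x n) \<in> L2" for n
    using xX[of n] by (auto simp: energy_space_def)
  have "\<exists>n0. \<forall>m\<ge>n0. \<forall>n\<ge>n0. sobolev_norm 1 (fst (x m) - fst (x n)) < e" if "e > 0" for e
    using c[OF that] energy_norm_ge(1) by (metis fst_diff order_le_less_trans)
  then obtain lu where lu: "lu \<in> sobolev 1" "(\<lambda>n. sobolev_norm 1 (fst (x n) - lu)) \<longlonglongrightarrow> 0"
    using sobolev_1_complete[of "\<lambda>n. fst (x n)"] u by blast
  have "\<exists>n0. \<forall>m\<ge>n0. \<forall>n\<ge>n0. L2_norm (snd (x m) - snd (x n)) < e" if "e > 0" for e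
    using c[OF that] energy_norm_ge(2) by (metis snd_diff order_le_less_trans)
  then obtain lv where lv: "lv \<in> L2" "(\<lambda>n. L2_norm (snd (x n) - lv)) \<longlonglongrightarrow> 0"
    using L2_complete[of "\<lambda>n. snd (x n)"] v by blast
  show "\<exists>l\<in>energy_space. (\<lambda>n. energy_norm (x n - l)) \<longlonglongrightarrow> 0"
  proof (intro bexI[of _ "(lu, lv)"])
    show "(lu, lv) \<in> energy_space" using lu lv by (simp add: energy_space_def)
    have "(\<lambda>n. sobolev_norm 1 (fst (x n) - lu) + L2_norm (snd (x n) - lv)) \<longlonglongrightarrow> 0"
      using tendsto_add[OF lu(2) lv(2)] by (simp only: add_0_right)
    then show "(\<lambda>n. energy_norm (x n - (lu, lv))) \<longlonglongrightarrow> 0"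
    proof (rule tendsto_sandwich[OF _ _ tendsto_const, rotated 2])
      show "\<forall>\<^sub>F n in sequentially. 0 \<le> energy_norm (x n - (lu, lv))"
        by (intro always_eventually allI order_trans[OF L2_norm_nonneg energy_norm_ge(2)])
      show "\<forall>\<^sub>F n in sequentially. energy_norm (x n - (lu, lv)) \<le> sobolev_norm 1 (fst (x n) - lu) + L2_norm (snd (x n) - lv)"
      proof (intro always_eventually allI)
        fix n
        show "energy_norm (x n - (lu, lv)) \<le> sobolev_norm 1 (fst (x n) - lu) + L2_norm (snd (x n) - lv)"
          using energy_norm_le[of "x n - (lu, lv)"] by (simp only: fst_diff snd_diff fst_conv snd_conv)
      qed
    qed
  qed
qed

subsection \<open>The equation in Fourier space\<close>

definition damping :: "real \<Rightarrow> real" where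
  "damping r = ln (1 + r\<^sup>2)"

definition frequency :: "real \<Rightarrow> real" where
  "frequency r = sqrt (r\<^sup>2 - (damping r)\<^sup>2 / 4)"

text \<open>For r > 0 the solution of y'' + damping y' + r^2 y = 0 with y(0) = 0 and y'(0) = 1;
  \<open>propagator'\<close> is its time derivative. At r = 0 the quotient defaults to 0 where the
  solution would be t, but the origin is a null set of frequencies.\<close>

definition propagator :: "real \<Rightarrow> real \<Rightarrow> real" where
  "propagator r t = exp (- damping r * t / 2) * (sin (frequency r * t) / frequency r)"

definition propagator' :: "real \<Rightarrow> real \<Rightarrow> real" where
  "propagator' r t = exp (- damping r * t / 2) *
     (cos (frequency r * t) - damping r / 2 * (sin (frequency r * t) / frequency r))"

lemma damping_nonneg: "0 \<le> damping r"
  by (simp add: damping_def)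

lemma damping_le_sq: "damping r \<le> r\<^sup>2"
  unfolding damping_def by (rule ln_add_one_self_le_self) simp

text \<open>This makes every frequency real. The quadratic Taylor polynomial of exp at r falls below
  1 + r^2 for r > 2, but its value at r/2, squared, stays above.\<close>

lemma damping_le: assumes "0 \<le> r" shows "damping r \<le> r"
proof -
  have "0 \<le> (r / 2 - 1)\<^sup>2 * r" using assms by simp
  also have "\<dots> = r ^ 3 / 4 - r\<^sup>2 + r"
    by (simp add: power2_eq_square power3_eq_cube field_simps)
  finally have "0 \<le> r ^ 3 / 4 - r\<^sup>2 + r" .
  moreover have "(1 + r / 2 + (r / 2)\<^sup>2 / 2)\<^sup>2 = 1 + r + r\<^sup>2 / 2 + r ^ 3 / 8 + r ^ 4 / 64"
    by (simp add: power2_eq_square power3_eq_cube power4_eq_xxxx field_simps)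
  moreover have "0 \<le> r ^ 4" by simp
  ultimately have "1 + r\<^sup>2 \<le> (1 + r / 2 + (r / 2)\<^sup>2 / 2)\<^sup>2"
    using assms by linarith
  also have "\<dots> \<le> (exp (r / 2))\<^sup>2"
    using exp_lower_Taylor_quadratic[of "r / 2"] assms by (intro power_mono) auto
  also have "\<dots> = exp r" by (simp flip: exp_double)
  finally have "ln (1 + r\<^sup>2) \<le> ln (exp r)"
    by (subst ln_le_cancel_iff) (auto simp: add_pos_nonneg)
  then show ?thesis by (simp add: damping_def)
qed

lemma frequency_sq:
  assumes "0 \<le> r"
  shows "(frequency r)\<^sup>2 = r\<^sup>2 - (damping r)\<^sup>2 / 4"
proof -
  have "(damping r)\<^sup>2 \<le> r\<^sup>2" using damping_le[OF assms] damping_nonneg by (intro power_mono)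
  then have "0 \<le> r\<^sup>2 - (damping r)\<^sup>2 / 4" using zero_le_power2[of r] by linarith
  then show ?thesis by (simp add: frequency_def)
qed

lemma frequency_nonneg: "0 \<le> r \<Longrightarrow> 0 \<le> frequency r"
proof -
  assume "0 \<le> r"
  then have "(damping r)\<^sup>2 \<le> r\<^sup>2" using damping_le[of r] damping_nonneg by (intro power_mono)
  then have "0 \<le> r\<^sup>2 - (damping r)\<^sup>2 / 4" using zero_le_power2[of r] by linarith
  then show ?thesis by (simp add: frequency_def)
qed

lemma frequency_le: assumes "0 \<le> r" shows "frequency r \<le> r"
  by (rule power2_le_imp_le[OF _ assms]) (simp add: frequency_sq[OF assms])

text \<open>As the damping is at most r, the squared frequency is at least 3/4 r^2. Division by the
  frequency therefore costs no more than 2/r.\<close>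

lemma frequency_ge: assumes "0 \<le> r" shows "r / 2 \<le> frequency r"
proof (rule power2_le_imp_le)
  have "(damping r)\<^sup>2 \<le> r\<^sup>2" using damping_le[OF assms] damping_nonneg by (intro power_mono)
  moreover have "(r / 2)\<^sup>2 = r\<^sup>2 / 4" by (simp add: power_divide)
  ultimately show "(r / 2)\<^sup>2 \<le> (frequency r)\<^sup>2"
    using zero_le_power2[of r] unfolding frequency_sq[OF assms] by linarith
qed (rule frequency_nonneg[OF assms])

lemma frequency_pos: "0 < r \<Longrightarrow> 0 < frequency r"
  using frequency_ge[of r] by simp

section \<open>Bounds and Taylor expansion of the propagator\<close>

lemma sinc_bound: fixes w :: real assumes "0 \<le> t" shows "\<bar>sin (w * t) / w\<bar> \<le> t"
proof (cases "w = 0")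
  case False
  have "\<bar>sin (w * t)\<bar> \<le> \<bar>w * t\<bar>" by (rule abs_sin_x_le_abs_x)
  then show ?thesis using False assms by (simp add: abs_mult pos_divide_le_eq mult.commute)
qed (use assms in simp)

lemma propagator_DERIV:
  assumes "0 < r"
  shows "(propagator r has_real_derivative propagator' r t) (at t)"
  unfolding propagator_def[abs_def] propagator'_def
  using frequency_pos[OF assms]
  by (auto intro!: derivative_eq_intros simp: field_simps)

lemma propagator'_DERIV:
  assumes "0 < r"
  shows "(propagator' r has_real_derivative - damping r * propagator' r t - r\<^sup>2 * propagator r t) (at t)"
proof -
  define w where "w = frequency r"
  define L where "L = damping r"
  have w: "w > 0" "r\<^sup>2 = w * w + L * L / 4"
    using frequency_pos[OF assms] frequency_sq[of r] assms by (auto simp: w_def L_def power2_eq_square)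
  have d: "((\<lambda>t. exp (- L * t / 2) * (cos (w * t) - L / 2 * (sin (w * t) / w))) has_real_derivative
     (- L / 2) * exp (- L * t / 2) * (cos (w * t) - L / 2 * (sin (w * t) / w))
     + exp (- L * t / 2) * (- w * sin (w * t) - L / 2 * cos (w * t))) (at t)"
    using w(1) by (auto intro!: derivative_eq_intros simp: field_simps)
  \<comment> \<open>With the exponential, cosine and sine as parameters the equation is an algebraic
    consequence of r^2 = w^2 + L^2/4.\<close>
  have e: "(- L / 2) * E * (c - L / 2 * (s / w)) + E * (- w * s - L / 2 * c)
     = - L * (E * (c - L / 2 * (s / w))) - r\<^sup>2 * (E * (s / w))" for E c s :: real
    unfolding w(2) using w(1) by (simp add: field_simps)
  show ?thesis
    using d unfolding e unfolding propagator_def propagator'_def[abs_def] w_def L_def .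
qed

lemma exp_damping_le_1: "0 \<le> t \<Longrightarrow> exp (- damping r * t / 2) \<le> 1"
  using damping_nonneg[of r] by simp

lemma propagator_bound: assumes "0 \<le> t" shows "\<bar>propagator r t\<bar> \<le> t"
proof -
  have "\<bar>propagator r t\<bar> = exp (- damping r * t / 2) * \<bar>sin (frequency r * t) / frequency r\<bar>"
    by (simp add: propagator_def abs_mult)
  also have "\<dots> \<le> 1 * t"
    using exp_damping_le_1[OF assms] sinc_bound[OF assms] by (intro mult_mono) auto
  finally show ?thesis by simp
qed

lemma propagator'_bound: assumes "0 \<le> t" "0 \<le> r" shows "\<bar>propagator' r t\<bar> \<le> 1 + r * t"
proof -
  let ?s = "sin (frequency r * t) / frequency r"
  have "\<bar>cos (frequency r * t) - damping r / 2 * ?s\<bar> \<le> \<bar>cos (frequency r * t)\<bar> + \<bar>damping r / 2 * ?s\<bar>"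
    by (rule abs_triangle_ineq4)
  also have "\<bar>damping r / 2 * ?s\<bar> = damping r / 2 * \<bar>?s\<bar>"
    using damping_nonneg[of r] by (simp add: abs_mult)
  also have "\<dots> \<le> r * t"
    using damping_le[OF assms(2)] damping_nonneg[of r] sinc_bound[OF assms(1)] assms
    by (intro mult_mono) auto
  finally have "\<bar>cos (frequency r * t) - damping r / 2 * ?s\<bar> \<le> 1 + r * t"
    using abs_cos_le_one[of "frequency r * t"] by linarith
  then have "exp (- damping r * t / 2) * \<bar>cos (frequency r * t) - damping r / 2 * ?s\<bar> \<le> 1 * (1 + r * t)"
    using exp_damping_le_1[OF assms(1), of r] by (intro mult_mono) auto
  then show ?thesis by (simp add: propagator'_def abs_mult)
qed

text \<open>Two applications of the mean value theorem, for either order of the end points; they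
  give the constant C rather than C/2.\<close>

lemma taylor_quadratic_bound:
  fixes f f' f'' :: "real \<Rightarrow> real"
  assumes f: "\<And>x. (f has_real_derivative f' x) (at x)" "\<And>x. (f' has_real_derivative f'' x) (at x)"
    and C: "\<And>z. z \<in> closed_segment x y \<Longrightarrow> \<bar>f'' z\<bar> \<le> C"
  shows "\<bar>f y - f x - (y - x) * f' x\<bar> \<le> C * (y - x)\<^sup>2"
proof -
  have mvt: "\<exists>z\<in>closed_segment x y. g y - g x = (y - x) * g' z"
    if der: "\<And>x. (g has_real_derivative g' x) (at x)" for g g' :: "real \<Rightarrow> real" and x y
  proof (cases x y rule: linorder_cases)
    case less
    obtain z where z: "x < z" "z < y" "g y - g x = (y - x) * g' z"
      using MVT2[OF less der] by blast
    have "closed_segment x y = {x..y}" using less by (simp add: closed_segment_eq_real_ivl)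
    then show ?thesis using z by (intro bexI[of _ z]) simp_all
  next
    case greater
    obtain z where z: "y < z" "z < x" "g x - g y = (x - y) * g' z"
      using MVT2[OF greater der] by blast
    have "closed_segment x y = {y..x}" using greater by (simp add: closed_segment_eq_real_ivl)
    moreover have "g y - g x = (y - x) * g' z" using z(3) by (simp add: algebra_simps)
    ultimately show ?thesis using z by (intro bexI[of _ z]) simp_all
  qed auto
  obtain z where z: "z \<in> closed_segment x y" "f y - f x = (y - x) * f' z" using mvt[OF f(1)] by blast
  obtain w where w: "w \<in> closed_segment x z" "f' z - f' x = (z - x) * f'' w" using mvt[OF f(2)] by blast
  have "w \<in> closed_segment x y"
    using w(1) z(1) by (simp add: closed_segment_eq_real_ivl split: if_splits)
  then have Cw: "\<bar>f'' w\<bar> \<le> C" by (rule C)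
  have zx: "\<bar>z - x\<bar> \<le> \<bar>y - x\<bar>"
    using z(1) by (simp add: closed_segment_eq_real_ivl split: if_splits)
  have "f y - f x - (y - x) * f' x = (y - x) * ((z - x) * f'' w)"
    unfolding w(2)[symmetric] z(2) by (simp add: algebra_simps)
  then have "\<bar>f y - f x - (y - x) * f' x\<bar> = \<bar>y - x\<bar> * (\<bar>z - x\<bar> * \<bar>f'' w\<bar>)"
    by (simp add: abs_mult)
  also have "\<dots> \<le> \<bar>y - x\<bar> * (\<bar>y - x\<bar> * C)"
    using zx Cw by (intro mult_left_mono mult_mono) auto
  also have "\<dots> = C * \<bar>y - x\<bar>\<^sup>2"
    by (simp only: power2_eq_square mult_ac)
  finally show ?thesis by (simp only: power2_abs)
qed

text \<open>The constant is uniform over 0 < r <= R. This is what turns differentiability of each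
  single mode into differentiability in the energy norm for band-limited data.\<close>

lemma propagator_taylor:
  assumes "0 \<le> R" "0 \<le> T"
  obtains C where "0 \<le> C"
    "\<And>r t s. 0 < r \<Longrightarrow> r \<le> R \<Longrightarrow> t \<in> {0..T} \<Longrightarrow> s \<in> {0..T} \<Longrightarrow>
       \<bar>propagator r t - propagator r s - (t - s) * propagator' r s\<bar> \<le> C * (t - s)\<^sup>2"
    "\<And>r t s. 0 < r \<Longrightarrow> r \<le> R \<Longrightarrow> t \<in> {0..T} \<Longrightarrow> s \<in> {0..T} \<Longrightarrow>
       \<bar>propagator' r t - propagator' r s - (t - s) * (- damping r * propagator' r s - r\<^sup>2 * propagator r s)\<bar> \<le> C * (t - s)\<^sup>2"
proof -
  \<comment> \<open>Bounds for the first, second and third time derivatives of the propagator. By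
    the equation each higher derivative is a combination of the two preceding ones with coefficients
    at most R and R^2.\<close>
  define A1 where "A1 = 1 + R * T"
  define A2 where "A2 = R * A1 + R\<^sup>2 * T"
  define A3 where "A3 = R * A2 + R\<^sup>2 * A1"
  have A: "0 \<le> A1" "0 \<le> A2" "0 \<le> A3" using assms by (auto simp: A1_def A2_def A3_def)
  define p2 where "p2 r t = - damping r * propagator' r t - r\<^sup>2 * propagator r t" for r t
  define p3 where "p3 r t = - damping r * p2 r t - r\<^sup>2 * propagator' r t" for r t
  have D1: "(propagator' r has_real_derivative p2 r t) (at t)" if "0 < r" for r t
    unfolding p2_def by (rule propagator'_DERIV[OF that])
  have D2: "(p2 r has_real_derivative p3 r t) (at t)" if "0 < r" for r t
    unfolding p2_def[abs_def] p3_def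
    by (rule derivative_eq_intros propagator_DERIV D1 that refl | simp add: p2_def)+
  have comb: "\<bar>- damping r * x - r\<^sup>2 * y\<bar> \<le> R * X + R\<^sup>2 * Y"
    if "0 < r" "r \<le> R" "\<bar>x\<bar> \<le> X" "\<bar>y\<bar> \<le> Y" for r x y X Y
  proof -
    have "\<bar>- damping r * x - r\<^sup>2 * y\<bar> \<le> \<bar>damping r * x\<bar> + \<bar>r\<^sup>2 * y\<bar>" by linarith
    also have "\<dots> = damping r * \<bar>x\<bar> + r\<^sup>2 * \<bar>y\<bar>" using damping_nonneg[of r] by (simp add: abs_mult)
    also have "\<dots> \<le> R * X + R\<^sup>2 * Y"
      using that damping_nonneg[of r] damping_le[of r] by (intro add_mono mult_mono power_mono) auto
    finally show ?thesis .
  qed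
  have b1: "\<bar>propagator' r t\<bar> \<le> A1" if "0 < r" "r \<le> R" "t \<in> {0..T}" for r t
  proof -
    have "\<bar>propagator' r t\<bar> \<le> 1 + r * t" using that by (intro propagator'_bound) auto
    also have "\<dots> \<le> A1" unfolding A1_def using that by (intro add_mono mult_mono) auto
    finally show ?thesis .
  qed
  have b2: "\<bar>p2 r t\<bar> \<le> A2" if "0 < r" "r \<le> R" "t \<in> {0..T}" for r t
    unfolding p2_def A2_def using that propagator_bound[of t r] by (intro comb b1) auto
  have b3: "\<bar>p3 r t\<bar> \<le> A3" if "0 < r" "r \<le> R" "t \<in> {0..T}" for r t
    unfolding p3_def A3_def using that by (intro comb b1 b2) auto
  have seg: "z \<in> {0..T}" if "t \<in> {0..T}" "s \<in> {0..T}" "z \<in> closed_segment s t" for z s t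
    using that by (auto simp: closed_segment_eq_real_ivl split: if_splits)
  show thesis
  proof (rule that[of "A2 + A3"])
    show "0 \<le> A2 + A3" using A by simp
    fix r t s assume h: "0 < r" "r \<le> R" "t \<in> {0..T}" "s \<in> {0..T}"
    show "\<bar>propagator r t - propagator r s - (t - s) * propagator' r s\<bar> \<le> (A2 + A3) * (t - s)\<^sup>2"
    proof (rule taylor_quadratic_bound[where f''="p2 r"])
      fix z assume "z \<in> closed_segment s t"
      from b2[OF h(1,2) seg[OF h(3,4) this]] A show "\<bar>p2 r z\<bar> \<le> A2 + A3" by simp
    qed (use h in \<open>auto intro: propagator_DERIV D1\<close>)
    show "\<bar>propagator' r t - propagator' r s - (t - s) * (- damping r * propagator' r s - r\<^sup>2 * propagator r s)\<bar> \<le> (A2 + A3) * (t - s)\<^sup>2"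
      unfolding p2_def[symmetric]
    proof (rule taylor_quadratic_bound[where f''="p3 r"])
      fix z assume "z \<in> closed_segment s t"
      from b3[OF h(1,2) seg[OF h(3,4) this]] A show "\<bar>p3 r z\<bar> \<le> A2 + A3" by simp
    qed (use h in \<open>auto intro: D2 D1\<close>)
  qed
qed

section \<open>The explicit solution of the equation in Fourier space\<close>

definition wave_mode :: "real \<Rightarrow> ('a::euclidean_space \<Rightarrow> complex) \<Rightarrow> ('a \<Rightarrow> complex) \<Rightarrow> 'a \<Rightarrow> complex" where
  "wave_mode t a b \<xi> = complex_of_real (propagator' (norm \<xi>) t + damping (norm \<xi>) * propagator (norm \<xi>) t) * a \<xi>
     + complex_of_real (propagator (norm \<xi>) t) * b \<xi>"

text \<open>With p the propagator, the solution with data a, b is (p' + damping p) a + p b. The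
  equation gives p'' + damping p' = - r^2 p, which is the first coefficient here.\<close>

definition wave_mode' :: "real \<Rightarrow> ('a::euclidean_space \<Rightarrow> complex) \<Rightarrow> ('a \<Rightarrow> complex) \<Rightarrow> 'a \<Rightarrow> complex" where
  "wave_mode' t a b \<xi> = complex_of_real (- (norm \<xi>)\<^sup>2 * propagator (norm \<xi>) t) * a \<xi>
     + complex_of_real (propagator' (norm \<xi>) t) * b \<xi>"

text \<open>The second time derivative, expressed through the equation itself, which is the form
  that \<open>wave_operator\<close> produces.\<close>

definition wave_mode'' :: "real \<Rightarrow> ('a::euclidean_space \<Rightarrow> complex) \<Rightarrow> ('a \<Rightarrow> complex) \<Rightarrow> 'a \<Rightarrow> complex" where
  "wave_mode'' t a b \<xi> = - complex_of_real ((norm \<xi>)\<^sup>2) * wave_mode t a b \<xi>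
     - complex_of_real (damping (norm \<xi>)) * wave_mode' t a b \<xi>"

lemma damping_measurable [measurable]: "damping \<in> borel_measurable borel"
  unfolding damping_def[abs_def] by measurable

lemma frequency_measurable [measurable]: "frequency \<in> borel_measurable borel"
  unfolding frequency_def[abs_def] by measurable

lemma propagator_measurable [measurable]:
  "(\<lambda>r. propagator r t) \<in> borel_measurable borel" "(\<lambda>r. propagator' r t) \<in> borel_measurable borel"
  unfolding propagator_def propagator'_def by measurable

lemma wave_mode_measurable [measurable (raw)]:
  assumes [measurable]: "a \<in> borel_measurable borel" "b \<in> borel_measurable borel"
  shows "wave_mode t a b \<in> borel_measurable borel" "wave_mode' t a b \<in> borel_measurable borel"
    "wave_mode'' t a b \<in> borel_measurable borel"
proof -
  show [measurable]: "wave_mode t a b \<in> borel_measurable borel" "wave_mode' t a b \<in> borel_measurable borel"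
    unfolding wave_mode_def[abs_def] wave_mode'_def[abs_def] by measurable
  show "wave_mode'' t a b \<in> borel_measurable borel"
    unfolding wave_mode''_def[abs_def] by measurable
qed

lemma norm_lin_comb_le:
  assumes "\<bar>x\<bar> \<le> C" "\<bar>y\<bar> \<le> C"
  shows "cmod (complex_of_real x * a + complex_of_real y * b) \<le> C * (cmod a + cmod b)"
proof -
  have "cmod (complex_of_real x * a + complex_of_real y * b) \<le> \<bar>x\<bar> * cmod a + \<bar>y\<bar> * cmod b"
    by (rule order_trans[OF norm_triangle_ineq]) (simp add: norm_mult)
  also have "\<dots> \<le> C * cmod a + C * cmod b"
    using assms by (intro add_mono mult_right_mono) auto
  finally show ?thesis by (simp add: distrib_left)
qed

lemma wave_mode_bound:
  assumes "0 \<le> R" "0 \<le> t"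
  obtains C where "0 \<le> C"
    "\<And>a b (\<xi> :: 'a::euclidean_space). norm \<xi> \<le> R \<Longrightarrow> cmod (wave_mode t a b \<xi>) \<le> C * (cmod (a \<xi>) + cmod (b \<xi>))"
    "\<And>a b (\<xi> :: 'a::euclidean_space). norm \<xi> \<le> R \<Longrightarrow> cmod (wave_mode' t a b \<xi>) \<le> C * (cmod (a \<xi>) + cmod (b \<xi>))"
    "\<And>a b (\<xi> :: 'a::euclidean_space). norm \<xi> \<le> R \<Longrightarrow> cmod (wave_mode'' t a b \<xi>) \<le> C * (cmod (a \<xi>) + cmod (b \<xi>))"
proof -
  define K where "K = 1 + R * t + R * t + t + R\<^sup>2 * t"
  have K: "0 \<le> K" "0 \<le> R * t" "0 \<le> R\<^sup>2 * t" using assms by (auto simp: K_def)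
  have p: "\<bar>propagator (norm \<xi>) t\<bar> \<le> t" for \<xi> :: 'a by (rule propagator_bound[OF assms(2)])
  have p': "\<bar>propagator' (norm \<xi>) t\<bar> \<le> 1 + R * t" if "norm \<xi> \<le> R" for \<xi> :: 'a
    using propagator'_bound[OF assms(2), of "norm \<xi>"] mult_right_mono[OF that assms(2)] by simp
  have dp: "\<bar>damping (norm \<xi>) * propagator (norm \<xi>) t\<bar> \<le> R * t" if "norm \<xi> \<le> R" for \<xi> :: 'a
    unfolding abs_mult using p[of \<xi>] damping_nonneg[of "norm \<xi>"] damping_le[of "norm \<xi>"] that assms
    by (intro mult_mono) auto
  have rp: "\<bar>- (norm \<xi>)\<^sup>2 * propagator (norm \<xi>) t\<bar> \<le> R\<^sup>2 * t" if "norm \<xi> \<le> R" for \<xi> :: 'a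
    unfolding abs_mult using p[of \<xi>] that assms by (intro mult_mono) (auto intro: power_mono)
  have m: "cmod (wave_mode t a b \<xi>) \<le> K * (cmod (a \<xi>) + cmod (b \<xi>))" if "norm \<xi> \<le> R" for a b and \<xi> :: 'a
    unfolding wave_mode_def K_def using p[of \<xi>] p'[OF that] dp[OF that] K(2,3) assms
    by (intro norm_lin_comb_le) linarith+
  have m': "cmod (wave_mode' t a b \<xi>) \<le> K * (cmod (a \<xi>) + cmod (b \<xi>))" if "norm \<xi> \<le> R" for a b and \<xi> :: 'a
    unfolding wave_mode'_def K_def using rp[OF that] p'[OF that] K(2,3) assms
    by (intro norm_lin_comb_le) linarith+
  have m'': "cmod (wave_mode'' t a b \<xi>) \<le> (R\<^sup>2 * K + R * K) * (cmod (a \<xi>) + cmod (b \<xi>))" if "norm \<xi> \<le> R" for a b and \<xi> :: 'a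
  proof -
    have "cmod (wave_mode'' t a b \<xi>) \<le> (norm \<xi>)\<^sup>2 * cmod (wave_mode t a b \<xi>) + damping (norm \<xi>) * cmod (wave_mode' t a b \<xi>)"
      unfolding wave_mode''_def using damping_nonneg[of "norm \<xi>"]
      by (intro order_trans[OF norm_triangle_ineq4]) (simp add: norm_mult norm_power)
    also have "\<dots> \<le> R\<^sup>2 * (K * (cmod (a \<xi>) + cmod (b \<xi>))) + R * (K * (cmod (a \<xi>) + cmod (b \<xi>)))"
      using that m[OF that] m'[OF that] damping_nonneg[of "norm \<xi>"] damping_le[of "norm \<xi>"] assms
      by (intro add_mono mult_mono) (auto intro: power_mono)
    finally show ?thesis by (simp add: algebra_simps)
  qed
  show thesis
  proof (rule that[of "K + (R\<^sup>2 * K + R * K)"])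
    show "0 \<le> K + (R\<^sup>2 * K + R * K)" using K assms by simp
    have *: "x \<le> c * (cmod u + cmod v) \<Longrightarrow> c \<le> d \<Longrightarrow> x \<le> d * (cmod u + cmod v)" for x c d u v
      by (erule order_trans) (intro mult_right_mono, auto)
    have nn: "0 \<le> R\<^sup>2 * K" "0 \<le> R * K" using K assms by auto
    fix a b and \<xi> :: 'a assume h: "norm \<xi> \<le> R"
    show "cmod (wave_mode t a b \<xi>) \<le> (K + (R\<^sup>2 * K + R * K)) * (cmod (a \<xi>) + cmod (b \<xi>))"
      by (rule *[OF m[OF h]]) (use nn in linarith)
    show "cmod (wave_mode' t a b \<xi>) \<le> (K + (R\<^sup>2 * K + R * K)) * (cmod (a \<xi>) + cmod (b \<xi>))"
      by (rule *[OF m'[OF h]]) (use nn in linarith)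
    show "cmod (wave_mode'' t a b \<xi>) \<le> (K + (R\<^sup>2 * K + R * K)) * (cmod (a \<xi>) + cmod (b \<xi>))"
      by (rule *[OF m''[OF h]]) (use K in linarith)
  qed
qed

lemma wave_mode_taylor:
  assumes "0 \<le> R" "0 \<le> T"
  obtains C where "0 \<le> C"
    "\<And>a b (\<xi> :: 'a::euclidean_space) t s. 0 < norm \<xi> \<Longrightarrow> norm \<xi> \<le> R \<Longrightarrow> t \<in> {0..T} \<Longrightarrow> s \<in> {0..T} \<Longrightarrow>
       cmod (wave_mode t a b \<xi> - wave_mode s a b \<xi> - complex_of_real (t - s) * wave_mode' s a b \<xi>)
         \<le> C * (t - s)\<^sup>2 * (cmod (a \<xi>) + cmod (b \<xi>))"
    "\<And>a b (\<xi> :: 'a::euclidean_space) t s. 0 < norm \<xi> \<Longrightarrow> norm \<xi> \<le> R \<Longrightarrow> t \<in> {0..T} \<Longrightarrow> s \<in> {0..T} \<Longrightarrow>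
       cmod (wave_mode' t a b \<xi> - wave_mode' s a b \<xi> - complex_of_real (t - s) * wave_mode'' s a b \<xi>)
         \<le> C * (t - s)\<^sup>2 * (cmod (a \<xi>) + cmod (b \<xi>))"
proof -
  obtain C where C: "0 \<le> C"
    "\<And>r t s. 0 < r \<Longrightarrow> r \<le> R \<Longrightarrow> t \<in> {0..T} \<Longrightarrow> s \<in> {0..T} \<Longrightarrow>
       \<bar>propagator r t - propagator r s - (t - s) * propagator' r s\<bar> \<le> C * (t - s)\<^sup>2"
    "\<And>r t s. 0 < r \<Longrightarrow> r \<le> R \<Longrightarrow> t \<in> {0..T} \<Longrightarrow> s \<in> {0..T} \<Longrightarrow>
       \<bar>propagator' r t - propagator' r s - (t - s) * (- damping r * propagator' r s - r\<^sup>2 * propagator r s)\<bar> \<le> C * (t - s)\<^sup>2"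
    using propagator_taylor[OF assms] by blast
  define D where "D = (1 + R + R\<^sup>2) * C"
  show thesis
  proof (rule that[of D])
    show "0 \<le> D" using C(1) assms by (simp add: D_def)
    fix a b t s and \<xi> :: 'a
    assume h: "0 < norm \<xi>" "norm \<xi> \<le> R" "t \<in> {0..T}" "s \<in> {0..T}"
    define r where "r = norm \<xi>"
    define T1 where "T1 = propagator r t - propagator r s - (t - s) * propagator' r s"
    define T2 where "T2 = propagator' r t - propagator' r s - (t - s) * (- damping r * propagator' r s - r\<^sup>2 * propagator r s)"
    define Q where "Q = C * (t - s)\<^sup>2"
    have Q: "0 \<le> Q" "\<bar>T1\<bar> \<le> Q" "\<bar>T2\<bar> \<le> Q"
      using C h by (auto simp: Q_def T1_def T2_def r_def)
    have r: "0 \<le> r" "r \<le> R" using h by (auto simp: r_def)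
    have DQ: "D * (t - s)\<^sup>2 = Q + R * Q + R\<^sup>2 * Q" by (simp add: D_def Q_def algebra_simps)
    have RQ: "0 \<le> R * Q" "0 \<le> R\<^sup>2 * Q" using Q assms by auto
    have LT: "\<bar>damping r * T1\<bar> \<le> R * Q"
      unfolding abs_mult using damping_nonneg[of r] damping_le[of r] Q r by (intro mult_mono) auto
    have rT: "\<bar>- r\<^sup>2 * T1\<bar> \<le> R\<^sup>2 * Q"
      unfolding abs_mult using Q r by (intro mult_mono) (auto intro: power_mono)
    \<comment> \<open>\<open>damping r\<close> does not depend on time, so the error is the same
      combination of the Taylor errors T1 of p and T2 of p' as the mode is of p and p'.\<close>
    have e1: "wave_mode t a b \<xi> - wave_mode s a b \<xi> - complex_of_real (t - s) * wave_mode' s a b \<xi>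
        = complex_of_real (T2 + damping r * T1) * a \<xi> + complex_of_real T1 * b \<xi>"
      unfolding wave_mode_def wave_mode'_def r_def[symmetric] T1_def T2_def
      by (simp add: algebra_simps)
    show "cmod (wave_mode t a b \<xi> - wave_mode s a b \<xi> - complex_of_real (t - s) * wave_mode' s a b \<xi>)
         \<le> D * (t - s)\<^sup>2 * (cmod (a \<xi>) + cmod (b \<xi>))"
      unfolding e1 DQ using Q LT RQ by (intro norm_lin_comb_le) linarith+
    have e2: "wave_mode' t a b \<xi> - wave_mode' s a b \<xi> - complex_of_real (t - s) * wave_mode'' s a b \<xi>
        = complex_of_real (- r\<^sup>2 * T1) * a \<xi> + complex_of_real T2 * b \<xi>"
      unfolding wave_mode_def wave_mode'_def wave_mode''_def r_def[symmetric] T1_def T2_def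
      by (simp add: algebra_simps)
    show "cmod (wave_mode' t a b \<xi> - wave_mode' s a b \<xi> - complex_of_real (t - s) * wave_mode'' s a b \<xi>)
         \<le> D * (t - s)\<^sup>2 * (cmod (a \<xi>) + cmod (b \<xi>))"
      unfolding e2 DQ using Q rT RQ by (intro norm_lin_comb_le) linarith+
  qed
qed

subsection \<open>The semigroup in Fourier space\<close>

text \<open>The origin is cut out together with |xi| > R, because at r = 0 the propagator has its
  default value and \<open>propagator'\<close> is not its derivative.\<close>

definition band :: "real \<Rightarrow> ('a::euclidean_space \<Rightarrow> complex) \<Rightarrow> 'a \<Rightarrow> complex" where
  "band R f \<xi> = (if 0 < norm \<xi> \<and> norm \<xi> \<le> R then f \<xi> else 0)"

lemma band_measurable [measurable (raw)]:
  assumes [measurable]: "f \<in> borel_measurable borel"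
  shows "band R f \<in> borel_measurable borel"
  unfolding band_def[abs_def] by measurable

lemma band_L2:
  assumes a: "a \<in> L2" and b: "b \<in> L2" and g: "g \<in> borel_measurable borel" and C: "0 \<le> C"
    and bd: "\<And>\<xi>. 0 < norm \<xi> \<Longrightarrow> norm \<xi> \<le> R \<Longrightarrow> cmod (g \<xi>) \<le> C * (cmod (a \<xi>) + cmod (b \<xi>))"
  shows "band R g \<in> L2" "L2_norm (band R g) \<le> C * (L2_norm a + L2_norm b)"
proof -
  define A where "A = (\<lambda>\<xi>. complex_of_real (cmod (a \<xi>)))"
  define B where "B = (\<lambda>\<xi>. complex_of_real (cmod (b \<xi>)))"
  have AB: "A \<in> L2" "B \<in> L2" "L2_norm A = L2_norm a" "L2_norm B = L2_norm b"
    using a b by (auto simp: A_def B_def L2_def L2_norm_def)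
  define G where "G = (\<lambda>\<xi>. complex_of_real C * (A + B) \<xi>)"
  have G: "G \<in> L2" unfolding G_def by (intro L2_cmult L2_add AB)
  have le: "AE \<xi> in lborel. cmod (band R g \<xi>) \<le> cmod (G \<xi>)"
  proof (rule AE_I2)
    fix \<xi>
    have "cmod (G \<xi>) = C * (cmod (a \<xi>) + cmod (b \<xi>))"
      using C unfolding G_def A_def B_def by (simp add: norm_mult flip: of_real_add)
    then show "cmod (band R g \<xi>) \<le> cmod (G \<xi>)"
      using bd[of \<xi>] C by (simp add: band_def)
  qed
  note m = band_measurable[OF g, of R]
  show "band R g \<in> L2" by (rule L2_norm_mono(1)[OF G m le])
  have "L2_norm (band R g) \<le> L2_norm G" by (rule L2_norm_mono(2)[OF G m le])
  also have "L2_norm G = C * L2_norm (A + B)"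
    using C unfolding G_def L2_norm_cmult[of "complex_of_real C" "A + B"] by simp
  also have "\<dots> \<le> C * (L2_norm A + L2_norm B)" by (intro mult_left_mono L2_triangle AB C)
  finally show "L2_norm (band R g) \<le> C * (L2_norm a + L2_norm b)" using AB by simp
qed

lemma band_limited_sobolev:
  fixes f :: "'a::euclidean_space \<Rightarrow> complex"
  assumes f: "f \<in> L2" and ae: "AE \<xi> in lborel. fourier_L2 f \<xi> = band R g \<xi>" and s: "0 \<le> s"
  shows "f \<in> sobolev s"
proof -
  have [measurable]: "fourier_L2 f \<in> borel_measurable borel" by (intro L2_borel fourier_L2_L2 f)
  have "integrable lborel (\<lambda>\<xi>::'a. (1 + (norm \<xi>)\<^sup>2) powr s * (cmod (fourier_L2 f \<xi>))\<^sup>2)"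
  proof (rule Bochner_Integration.integrable_bound)
    show "integrable lborel (\<lambda>\<xi>. (1 + R\<^sup>2) powr s * (cmod (fourier_L2 f \<xi>))\<^sup>2)"
      by (intro integrable_mult_right L2_integrable fourier_L2_L2 f)
    show "AE \<xi> in lborel. norm ((1 + (norm \<xi>)\<^sup>2) powr s * (cmod (fourier_L2 f \<xi>))\<^sup>2)
        \<le> norm ((1 + R\<^sup>2) powr s * (cmod (fourier_L2 f \<xi>))\<^sup>2)"
      using ae
    proof eventually_elim
      case (elim \<xi>)
      show ?case
      proof (cases "norm \<xi> \<le> R")
        case True
        then have "(norm \<xi>)\<^sup>2 \<le> R\<^sup>2" by (intro power_mono) auto
        then have "(1 + (norm \<xi>)\<^sup>2) powr s \<le> (1 + R\<^sup>2) powr s"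
          using s by (intro powr_mono2) (auto intro: add_nonneg_nonneg)
        then show ?thesis
          unfolding norm_mult by (intro mult_right_mono) auto
      qed (simp add: elim band_def)
    qed
  qed measurable
  then show ?thesis using f by (simp add: sobolev_def)
qed

text \<open>The Plancherel factor (2 pi)^(n/2) is at least 1.\<close>

lemma L2_norm_le_fourier:
  fixes f :: "'a::euclidean_space \<Rightarrow> complex"
  assumes "f \<in> L2" shows "L2_norm f \<le> L2_norm (fourier_L2 f)"
proof -
  have "1 \<le> (2 * pi) ^ DIM('a)" using pi_ge_two by (intro one_le_power) auto
  then have "1 \<le> sqrt ((2 * pi) ^ DIM('a))" by (rule real_le_rsqrt[of 1, unfolded power_one])
  from mult_right_mono[OF this L2_norm_nonneg[of f]] show ?thesis
    unfolding Plancherel[OF assms] by (simp only: mult_1)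
qed

text \<open>On the band the Bessel weight is at most 1 + R, which settles the first component; the
  second accounts for the further 1 in 2 + R.\<close>

lemma energy_norm_band:
  fixes z1 z2 :: "'a::euclidean_space \<Rightarrow> complex"
  assumes z: "z1 \<in> L2" "z2 \<in> L2" and a: "a \<in> L2" and b: "b \<in> L2"
    and g: "g1 \<in> borel_measurable borel" "g2 \<in> borel_measurable borel" and C: "0 \<le> C" and R: "0 \<le> R"
    and F: "AE \<xi> in lborel. fourier_L2 z1 \<xi> = band R g1 \<xi>" "AE \<xi> in lborel. fourier_L2 z2 \<xi> = band R g2 \<xi>"
    and bd: "\<And>\<xi>. 0 < norm \<xi> \<Longrightarrow> norm \<xi> \<le> R \<Longrightarrow> cmod (g1 \<xi>) \<le> C * (cmod (a \<xi>) + cmod (b \<xi>))"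
      "\<And>\<xi>. 0 < norm \<xi> \<Longrightarrow> norm \<xi> \<le> R \<Longrightarrow> cmod (g2 \<xi>) \<le> C * (cmod (a \<xi>) + cmod (b \<xi>))"
  shows "energy_norm (z1, z2) \<le> (2 + R) * C * (L2_norm a + L2_norm b)"
proof -
  note [measurable] = g
  define h where "h = (\<lambda>\<xi>. complex_of_real (bessel_weight \<xi>) * g1 \<xi>)"
  have h: "h \<in> borel_measurable borel" unfolding h_def by measurable
  have hb: "cmod (h \<xi>) \<le> (1 + R) * C * (cmod (a \<xi>) + cmod (b \<xi>))" if "0 < norm \<xi>" "norm \<xi> \<le> R" for \<xi>
  proof -
    have "bessel_weight \<xi> \<le> 1 + R"
      unfolding bessel_weight_def
    proof (rule real_le_lsqrt)
      have "(norm \<xi>)\<^sup>2 \<le> R\<^sup>2" using that by (intro power_mono) auto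
      then show "1 + (norm \<xi>)\<^sup>2 \<le> (1 + R)\<^sup>2" using R by (simp add: power2_eq_square algebra_simps)
    qed (use R in auto)
    then have "bessel_weight \<xi> * cmod (g1 \<xi>) \<le> (1 + R) * (C * (cmod (a \<xi>) + cmod (b \<xi>)))"
      using bd(1)[OF that] R bessel_weight_ge_1[of \<xi>] by (intro mult_mono) auto
    then show ?thesis using bessel_weight_ge_1[of \<xi>] by (simp add: h_def norm_mult mult.assoc)
  qed
  have "sobolev_norm 1 z1 = L2_norm (band R h)"
    unfolding sobolev_1_norm
  proof (rule L2_norm_cong)
    show "AE x in lborel. weighted_fourier z1 x = band R h x"
      using F(1) by eventually_elim (simp add: weighted_fourier_def band_def h_def)
  qed (intro weighted_fourier_measurable z band_measurable h)+
  also have "\<dots> \<le> (1 + R) * C * (L2_norm a + L2_norm b)"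
    using R C by (intro band_L2(2)[OF a b h] hb) auto
  finally have 1: "sobolev_norm 1 z1 \<le> (1 + R) * C * (L2_norm a + L2_norm b)" .
  have "L2_norm z2 \<le> L2_norm (fourier_L2 z2)" by (rule L2_norm_le_fourier[OF z(2)])
  also have "\<dots> = L2_norm (band R g2)"
    by (intro L2_norm_cong F(2) L2_borel fourier_L2_L2 z band_measurable g)
  also have "\<dots> \<le> C * (L2_norm a + L2_norm b)"
    by (rule band_L2(2)[OF a b g(2) C bd(2)])
  finally have "L2_norm z2 \<le> C * (L2_norm a + L2_norm b)" .
  with 1 have "energy_norm (z1, z2) \<le> (1 + R) * C * (L2_norm a + L2_norm b) + C * (L2_norm a + L2_norm b)"
    using energy_norm_le[of "(z1, z2)"] by simp
  then show ?thesis by (simp add: algebra_simps)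
qed

text \<open>\<open>fourier_multiplier\<close> rests on a choice that is meaningful only if the
  symbol times the transform is in \<open>L2\<close>; the assumption on the band ensures
  this.\<close>

lemma fourier_multiplier_band:
  fixes u :: "'a::euclidean_space \<Rightarrow> complex"
  assumes m: "m \<in> borel_measurable borel" and u: "u \<in> L2" and g: "g \<in> borel_measurable borel"
    and F: "AE \<xi> in lborel. fourier_L2 u \<xi> = band R g \<xi>"
    and L: "band R (\<lambda>\<xi>. complex_of_real (m \<xi>) * g \<xi>) \<in> L2"
  shows "fourier_multiplier m u \<in> L2"
    "AE \<xi> in lborel. fourier_L2 (fourier_multiplier m u) \<xi> = band R (\<lambda>\<xi>. complex_of_real (m \<xi>) * g \<xi>) \<xi>"
proof -
  note [measurable] = m g L2_borel[OF fourier_L2_L2[OF u]]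
  have ae: "AE \<xi> in lborel. band R (\<lambda>\<xi>. complex_of_real (m \<xi>) * g \<xi>) \<xi> = complex_of_real (m \<xi>) * fourier_L2 u \<xi>"
    using F by eventually_elim (simp add: band_def)
  have *: "(\<lambda>\<xi>. complex_of_real (m \<xi>) * fourier_L2 u \<xi>) \<in> L2"
    by (rule L2_cong[OF L ae]) measurable
  show "fourier_multiplier m u \<in> L2"
    unfolding fourier_multiplier_def by (rule inv_fourier_L2_L2[OF *])
  show "AE \<xi> in lborel. fourier_L2 (fourier_multiplier m u) \<xi> = band R (\<lambda>\<xi>. complex_of_real (m \<xi>) * g \<xi>) \<xi>"
    unfolding fourier_multiplier_def using fourier_inv_fourier_L2[OF *] ae by eventually_elim simp
qed

section \<open>Band-limited classical solutions\<close>

definition band_state ::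
    "real \<Rightarrow> ('a::euclidean_space \<Rightarrow> complex) \<Rightarrow> ('a \<Rightarrow> complex) \<Rightarrow> real \<Rightarrow> 'a state" where
  "band_state R a b t = (inv_fourier_L2 (band R (wave_mode t a b)), inv_fourier_L2 (band R (wave_mode' t a b)))"

text \<open>The time derivative of \<open>band_state\<close>. Its second entry comes from the
  equation, so up to null functions it is also \<open>wave_operator\<close> applied to
  \<open>band_state\<close>.\<close>

definition band_state' ::
    "real \<Rightarrow> ('a::euclidean_space \<Rightarrow> complex) \<Rightarrow> ('a \<Rightarrow> complex) \<Rightarrow> real \<Rightarrow> 'a state" where
  "band_state' R a b t = (inv_fourier_L2 (band R (wave_mode' t a b)), inv_fourier_L2 (band R (wave_mode'' t a b)))"

context
  fixes a b :: "'a::euclidean_space \<Rightarrow> complex" and R :: real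
  assumes a: "a \<in> L2" and b: "b \<in> L2" and R: "0 \<le> R"
begin

lemma band_mode_L2:
  assumes "0 \<le> t"
  shows "band R (wave_mode t a b) \<in> L2" "band R (wave_mode' t a b) \<in> L2" "band R (wave_mode'' t a b) \<in> L2"
proof -
  note m = wave_mode_measurable[OF L2_borel[OF a] L2_borel[OF b]]
  obtain C where C: "0 \<le> C"
    "\<And>a b (\<xi> :: 'a). norm \<xi> \<le> R \<Longrightarrow> cmod (wave_mode t a b \<xi>) \<le> C * (cmod (a \<xi>) + cmod (b \<xi>))"
    "\<And>a b (\<xi> :: 'a). norm \<xi> \<le> R \<Longrightarrow> cmod (wave_mode' t a b \<xi>) \<le> C * (cmod (a \<xi>) + cmod (b \<xi>))"
    "\<And>a b (\<xi> :: 'a). norm \<xi> \<le> R \<Longrightarrow> cmod (wave_mode'' t a b \<xi>) \<le> C * (cmod (a \<xi>) + cmod (b \<xi>))"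
    using wave_mode_bound[OF R assms, where 'a='a] by blast
  show "band R (wave_mode t a b) \<in> L2" by (rule band_L2(1)[OF a b m(1) C(1) C(2)])
  show "band R (wave_mode' t a b) \<in> L2" by (rule band_L2(1)[OF a b m(2) C(1) C(3)])
  show "band R (wave_mode'' t a b) \<in> L2" by (rule band_L2(1)[OF a b m(3) C(1) C(4)])
qed

lemmas band_inv_L2 = band_mode_L2[THEN inv_fourier_L2_L2]
lemmas band_fourier_inv = band_mode_L2[THEN fourier_inv_fourier_L2]

text \<open>Band-limited states lie in the domain, and there the operator acts by multiplication in
  Fourier space. Since \<open>generates\<close> is an equality of graphs, the pair belongs to the
  generator of every admissible \<open>S\<close>.\<close>

lemma band_state_generator:
  assumes t: "0 \<le> t" and S: "generates energy_space energy_norm wave_domain wave_operator S"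
  shows "(band_state R a b t, band_state' R a b t) \<in> infinitesimal_generator energy_space energy_norm S"
proof -
  note m = wave_mode_measurable[OF L2_borel[OF a] L2_borel[OF b]]
  let ?u = "inv_fourier_L2 (band R (wave_mode t a b))"
  let ?v = "inv_fourier_L2 (band R (wave_mode' t a b))"
  let ?w = "inv_fourier_L2 (band R (wave_mode'' t a b))"
  note L = band_inv_L2[OF t] note F = band_fourier_inv[OF t]
  have u: "?u \<in> sobolev 2" and v: "?v \<in> sobolev 1"
    using band_limited_sobolev[OF L(1) F(1)] band_limited_sobolev[OF L(2) F(2)] by auto
  \<comment> \<open>The first of the two dominating functions in \<open>band_L2\<close> is taken to
    be 0: on the band the symbol is at most R^2, and the mode alone dominates.\<close>
  have bd2: "band R (\<lambda>\<xi>. complex_of_real (- (norm \<xi>)\<^sup>2) * wave_mode t a b \<xi>) \<in> L2"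
  proof (rule band_L2(1)[of "wave_mode_zero" "band R (wave_mode t a b)" for wave_mode_zero, OF L2_zero band_mode_L2(1)[OF t]])
    show "(\<lambda>\<xi>. complex_of_real (- (norm \<xi>)\<^sup>2) * wave_mode t a b \<xi>) \<in> borel_measurable borel"
      using m(1)[of t] by measurable
    fix \<xi> :: 'a assume "0 < norm \<xi>" "norm \<xi> \<le> R"
    then show "cmod (complex_of_real (- (norm \<xi>)\<^sup>2) * wave_mode t a b \<xi>) \<le> R\<^sup>2 * (cmod (0 \<xi>) + cmod (band R (wave_mode t a b) \<xi>))"
      by (auto simp: norm_mult band_def norm_power intro!: mult_right_mono power_mono)
  qed simp
  have bd1: "band R (\<lambda>\<xi>. complex_of_real (ln (1 + (norm \<xi>)\<^sup>2)) * wave_mode' t a b \<xi>) \<in> L2"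
  proof (rule band_L2(1)[of "wave_mode_zero" "band R (wave_mode' t a b)" for wave_mode_zero, OF L2_zero band_mode_L2(2)[OF t]])
    show "(\<lambda>\<xi>. complex_of_real (ln (1 + (norm \<xi>)\<^sup>2)) * wave_mode' t a b \<xi>) \<in> borel_measurable borel"
      using m(2)[of t] by measurable
    fix \<xi> :: 'a assume h: "0 < norm \<xi>" "norm \<xi> \<le> R"
    have "\<bar>ln (1 + (norm \<xi>)\<^sup>2)\<bar> \<le> R"
      using damping_nonneg[of "norm \<xi>"] damping_le[of "norm \<xi>"] h by (simp add: damping_def)
    then show "cmod (complex_of_real (ln (1 + (norm \<xi>)\<^sup>2)) * wave_mode' t a b \<xi>) \<le> R * (cmod (0 \<xi>) + cmod (band R (wave_mode' t a b) \<xi>))"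
      using h by (simp add: norm_mult band_def mult_right_mono)
  qed (rule R)
  have lap: "laplacian ?u \<in> L2"
    "AE \<xi> in lborel. fourier_L2 (laplacian ?u) \<xi> = band R (\<lambda>\<xi>. complex_of_real (- (norm \<xi>)\<^sup>2) * wave_mode t a b \<xi>) \<xi>"
    unfolding laplacian_def by (rule fourier_multiplier_band[OF _ L(1) m(1) F(1) bd2], measurable)+
  have logop: "log_operator ?v \<in> L2"
    "AE \<xi> in lborel. fourier_L2 (log_operator ?v) \<xi> = band R (\<lambda>\<xi>. complex_of_real (ln (1 + (norm \<xi>)\<^sup>2)) * wave_mode' t a b \<xi>) \<xi>"
    unfolding log_operator_def by (rule fourier_multiplier_band[OF _ L(2) m(2) F(2) bd1], measurable)+
  have "AE \<xi> in lborel. fourier_L2 ?w \<xi> = fourier_L2 (laplacian ?u - log_operator ?v) \<xi>"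
    using F(3) lap(2) logop(2) fourier_L2_diff[OF lap(1) logop(1)]
    by eventually_elim (simp add: band_def wave_mode''_def damping_def)
  then have "AE x in lborel. ?w x = (laplacian ?u - log_operator ?v) x"
    using fourier_L2_eq_iff[OF L(3) L2_diff[OF lap(1) logop(1)]] by simp
  then have w0: "L2_norm (?w - (laplacian ?u - log_operator ?v)) = 0"
    using L2_norm_diff_eq_0_iff[OF L(3) L2_diff[OF lap(1) logop(1)]] by simp
  have z0: "sobolev_norm 1 (?v - ?v) = 0"
    using sobolev_1_diff(2)[OF v v] by simp
  have eqN: "band_state' R a b t - wave_operator (band_state R a b t) = (?v - ?v, ?w - (laplacian ?u - log_operator ?v))"
    by (simp only: band_state_def band_state'_def wave_operator_def case_prod_conv diff_Pair)
  have N0: "energy_norm (band_state' R a b t - wave_operator (band_state R a b t)) = 0"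
    unfolding eqN energy_norm_def case_prod_conv w0 z0 by simp
  have "(band_state R a b t, band_state' R a b t) \<in> {(x, y). x \<in> wave_domain \<and> y \<in> energy_space \<and> energy_norm (y - wave_operator x) = 0}"
    using N0 u v L(3) by (simp add: wave_domain_def energy_space_def band_state_def band_state'_def)
  then show ?thesis using S unfolding generates_def by simp
qed

text \<open>The Taylor remainder is at most K (r - s)^2 in the energy norm, so d = e / K works; the
  summand 1 in K makes it positive.\<close>

lemma band_state_deriv:
  assumes T: "0 \<le> T" and s: "s \<in> {0..T}" and e: "0 < e"
  shows "\<exists>d>0. \<forall>r\<in>{0..T}. \<bar>r - s\<bar> < d \<longrightarrow>
     energy_norm (band_state R a b r - band_state R a b s - (r - s) *\<^sub>R band_state' R a b s) \<le> e * \<bar>r - s\<bar>"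
proof -
  note m = wave_mode_measurable[OF L2_borel[OF a] L2_borel[OF b]]
  obtain C where C: "0 \<le> C"
    "\<And>a b (\<xi> :: 'a) t s. 0 < norm \<xi> \<Longrightarrow> norm \<xi> \<le> R \<Longrightarrow> t \<in> {0..T} \<Longrightarrow> s \<in> {0..T} \<Longrightarrow>
       cmod (wave_mode t a b \<xi> - wave_mode s a b \<xi> - complex_of_real (t - s) * wave_mode' s a b \<xi>)
         \<le> C * (t - s)\<^sup>2 * (cmod (a \<xi>) + cmod (b \<xi>))"
    "\<And>a b (\<xi> :: 'a) t s. 0 < norm \<xi> \<Longrightarrow> norm \<xi> \<le> R \<Longrightarrow> t \<in> {0..T} \<Longrightarrow> s \<in> {0..T} \<Longrightarrow>
       cmod (wave_mode' t a b \<xi> - wave_mode' s a b \<xi> - complex_of_real (t - s) * wave_mode'' s a b \<xi>)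
         \<le> C * (t - s)\<^sup>2 * (cmod (a \<xi>) + cmod (b \<xi>))"
    using wave_mode_taylor[OF R T, where 'a='a] by blast
  define K where "K = (2 + R) * C * (L2_norm a + L2_norm b) + 1"
  have "0 \<le> (2 + R) * C * (L2_norm a + L2_norm b)" using R C by simp
  then have K: "K > 0" by (simp add: K_def)
  have bound: "energy_norm (band_state R a b r - band_state R a b s - (r - s) *\<^sub>R band_state' R a b s) \<le> K * (r - s)\<^sup>2"
    if r: "r \<in> {0..T}" for r
  proof -
    have r0: "0 \<le> r" and s0: "0 \<le> s" using r s by auto
    note Lr = band_inv_L2[OF r0] note Ls = band_inv_L2[OF s0]
    note Fr = band_fourier_inv[OF r0] note Fs = band_fourier_inv[OF s0]
    define g1 where "g1 \<xi> = wave_mode r a b \<xi> - wave_mode s a b \<xi> - complex_of_real (r - s) * wave_mode' s a b \<xi>" for \<xi>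
    define g2 where "g2 \<xi> = wave_mode' r a b \<xi> - wave_mode' s a b \<xi> - complex_of_real (r - s) * wave_mode'' s a b \<xi>" for \<xi>
    have gm: "g1 \<in> borel_measurable borel" "g2 \<in> borel_measurable borel"
      unfolding g1_def[abs_def] g2_def[abs_def]
      by (intro borel_measurable_diff borel_measurable_times borel_measurable_const m)+
    let ?z1 = "inv_fourier_L2 (band R (wave_mode r a b)) - inv_fourier_L2 (band R (wave_mode s a b))
       - (r - s) *\<^sub>R inv_fourier_L2 (band R (wave_mode' s a b))"
    let ?z2 = "inv_fourier_L2 (band R (wave_mode' r a b)) - inv_fourier_L2 (band R (wave_mode' s a b))
       - (r - s) *\<^sub>R inv_fourier_L2 (band R (wave_mode'' s a b))"
    have z: "?z1 \<in> L2" "?z2 \<in> L2"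
      by (intro L2_diff L2_scaleR Lr Ls)+
    have F1: "AE \<xi> in lborel. fourier_L2 ?z1 \<xi> = band R g1 \<xi>"
      using fourier_L2_diff[OF L2_diff[OF Lr(1) Ls(1)] L2_scaleR[OF Ls(2), of "r - s"]] fourier_L2_diff[OF Lr(1) Ls(1)]
        fourier_L2_scaleR[OF Ls(2), of "r - s"] Fr(1) Fs(1) Fs(2)
      by eventually_elim (simp add: band_def g1_def)
    have F2: "AE \<xi> in lborel. fourier_L2 ?z2 \<xi> = band R g2 \<xi>"
      using fourier_L2_diff[OF L2_diff[OF Lr(2) Ls(2)] L2_scaleR[OF Ls(3), of "r - s"]] fourier_L2_diff[OF Lr(2) Ls(2)]
        fourier_L2_scaleR[OF Ls(3), of "r - s"] Fr(2) Fs(2) Fs(3)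
      by eventually_elim (simp add: band_def g2_def)
    have bd: "cmod (g1 \<xi>) \<le> C * (r - s)\<^sup>2 * (cmod (a \<xi>) + cmod (b \<xi>))"
      "cmod (g2 \<xi>) \<le> C * (r - s)\<^sup>2 * (cmod (a \<xi>) + cmod (b \<xi>))"
      if "0 < norm \<xi>" "norm \<xi> \<le> R" for \<xi>
      unfolding g1_def g2_def by (rule C(2)[OF that r s], rule C(3)[OF that r s])
    have "energy_norm (?z1, ?z2) \<le> (2 + R) * (C * (r - s)\<^sup>2) * (L2_norm a + L2_norm b)"
      by (rule energy_norm_band[OF z a b gm _ R F1 F2 bd]) (use C(1) in simp_all)
    also have "\<dots> \<le> K * (r - s)\<^sup>2"
      unfolding K_def by (simp add: algebra_simps)
    finally show ?thesis
      by (simp only: band_state_def band_state'_def diff_Pair scaleR_Pair)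
  qed
  show ?thesis
  proof (intro exI[of _ "e / K"] conjI ballI impI)
    show "0 < e / K" using e K by simp
    fix r assume r: "r \<in> {0..T}" and d: "\<bar>r - s\<bar> < e / K"
    have "K * (r - s)\<^sup>2 = (K * \<bar>r - s\<bar>) * \<bar>r - s\<bar>"
      by (simp add: power2_eq_square mult.assoc)
    also have "\<dots> \<le> e * \<bar>r - s\<bar>"
      using d K by (intro mult_right_mono) (auto simp: pos_less_divide_eq mult.commute)
    finally show "energy_norm (band_state R a b r - band_state R a b s - (r - s) *\<^sub>R band_state' R a b s) \<le> e * \<bar>r - s\<bar>"
      using bound[OF r] by linarith
  qed
qed

end

text \<open>By Fatou the norm of g - h is at most any bound for a tail of the sequence. That h is
  only assumed measurable matters: \<open>wave_mode t a b\<close> is not known to lie in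
  \<open>L2\<close> when this is applied.\<close>

lemma L2_limit_pointwise:
  fixes u :: "nat \<Rightarrow> 'a::euclidean_space \<Rightarrow> complex"
  assumes u: "\<And>k. u k \<in> L2" and g: "g \<in> L2" and h: "h \<in> borel_measurable borel"
    and lim: "(\<lambda>k. L2_norm (g - u k)) \<longlonglongrightarrow> 0" and pw: "AE x in lborel. (\<lambda>k. u k x) \<longlonglongrightarrow> h x"
  shows "AE x in lborel. g x = h x"
proof -
  have [measurable]: "g \<in> borel_measurable borel" by (rule L2_borel[OF g])
  have m: "g - h \<in> borel_measurable borel" using h by (simp add: fun_diff_def)
  have le: "g - h \<in> L2 \<and> L2_norm (g - h) \<le> e" if e: "0 < e" for e
  proof -
    obtain n0 where n0: "\<And>n. n \<ge> n0 \<Longrightarrow> L2_norm (g - u n) < e"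
      by (rule LIMSEQ_lessD[OF lim e]) blast
    have pw': "AE x in lborel. (\<lambda>k. (g - u (k + n0)) x) \<longlonglongrightarrow> (g - h) x"
      using pw
    proof eventually_elim
      case (elim x)
      show ?case unfolding minus_apply
        by (intro tendsto_diff tendsto_const LIMSEQ_ignore_initial_segment[OF elim])
    qed
    have ub: "L2_norm (g - u (k + n0)) \<le> e" for k using n0[of "k + n0"] by simp
    show ?thesis
      using L2_norm_Fatou[of "\<lambda>k. g - u (k + n0)" e "g - h", OF L2_diff[OF g u] ub m pw'] by blast
  qed
  have "L2_norm (g - h) \<le> 0"
  proof (rule field_le_epsilon)
    fix e :: real assume "0 < e"
    from le[OF this] show "L2_norm (g - h) \<le> 0 + e" by simp
  qed
  then have "L2_norm (g - h) = 0"
    using L2_norm_nonneg[of "g - h"] by linarith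
  then show ?thesis
    using L2_norm_eq_0_iff[of "g - h"] le[of 1] by simp
qed

section \<open>Passage from band-limited to general data\<close>

lemma propagator_0 [simp]: "propagator r 0 = 0" "propagator' r 0 = 1"
  by (simp_all add: propagator_def propagator'_def)

lemma wave_mode_0 [simp]: "wave_mode 0 a b = a" "wave_mode' 0 a b = b"
  by (auto simp: wave_mode_def wave_mode'_def fun_eq_iff)

lemma band_tendsto:
  assumes "f \<in> L2"
  shows "(\<lambda>k. L2_norm (f - band (real k) f)) \<longlonglongrightarrow> 0"
proof -
  note [measurable] = L2_borel[OF assms]
  have "(\<lambda>k. L2_norm (band (real k) f - f)) \<longlonglongrightarrow> 0"
  proof (rule L2_dominated_convergence(2)[OF _ _ assms])
    show "AE x in lborel. (\<lambda>k. band (real k) f x) \<longlonglongrightarrow> f x"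
      using AE_lborel_singleton[of 0]
    proof eventually_elim
      case (elim x)
      obtain n where "norm x \<le> real n" using real_arch_simple by blast
      then have "\<forall>\<^sub>F k in sequentially. band (real k) f x = f x"
        using elim unfolding eventually_sequentially band_def by (intro exI[of _ n]) auto
      then show ?case by (rule tendsto_eventually)
    qed
  qed (auto simp: band_def)
  then show ?thesis by (subst L2_norm_minus_commute)
qed

lemma band_0_L2: assumes "f \<in> L2" shows "band R f \<in> L2"
  using assms L2_borel[OF assms] by (intro L2_norm_mono(1)[OF assms]) (auto simp: band_def)

text \<open>S t is bounded, so convergence of the band states to the data at time 0 carries over to
  time t. The Sobolev norm dominates the L2 norm of the transform; hence the transforms converge in
  L2, while at each nonzero frequency they are eventually equal to \<open>wave_mode\<close>.\<close>

theorem fourier_semigroup_fst: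
  fixes u0 u1 :: "'a::euclidean_space \<Rightarrow> complex"
  assumes u0: "u0 \<in> sobolev 1" and u1: "u1 \<in> L2" and t: "0 \<le> t"
    and S: "generates energy_space energy_norm wave_domain wave_operator S"
  shows "AE \<xi> in lborel. fourier_L2 (fst (S t (u0, u1))) \<xi> = wave_mode t (fourier_L2 u0) (fourier_L2 u1) \<xi>"
proof -
  interpret C0_semigroup_on energy_space energy_norm S
    by unfold_locales (use S in \<open>simp add: generates_def\<close>)
  define a where "a = fourier_L2 u0"
  define b where "b = fourier_L2 u1"
  have u0L: "u0 \<in> L2" and Wu0: "weighted_fourier u0 \<in> L2" using u0 by (auto simp: sobolev_1_iff)
  have a: "a \<in> L2" and b: "b \<in> L2" using u0L u1 by (auto simp: a_def b_def fourier_L2_L2)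
  define W where "W k = band_state (real k) a b" for k :: nat
  have x: "(u0, u1) \<in> energy_space" using u0 u1 by (simp add: energy_space_def)
  have uniq: "energy_norm (S t (W k 0) - W k t) = 0" for k
    unfolding W_def
    by (rule classical_solution_unique[OF t, where y="band_state' (real k) a b"])
      (use t S a b in \<open>auto intro: band_state_generator band_state_deriv\<close>)
  have WX: "W k s \<in> energy_space" if "0 \<le> s" for k s
    using band_state_generator[OF a b _ that S, of "real k"] by (simp add: infinitesimal_generator_def W_def)
  have W0: "(\<lambda>k. energy_norm ((u0, u1) - W k 0)) \<longlonglongrightarrow> 0"
  proof (rule tendsto_sandwich[OF _ _ tendsto_const])
    show "(\<lambda>k. L2_norm (weighted_fourier u0 - band (real k) (weighted_fourier u0)) + L2_norm (b - band (real k) b)) \<longlonglongrightarrow> 0"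
      using tendsto_add[OF band_tendsto[OF Wu0] band_tendsto[OF b]] by (simp only: add_0_right)
    show "\<forall>\<^sub>F k in sequentially. 0 \<le> energy_norm ((u0, u1) - W k 0)"
      by (intro always_eventually allI order_trans[OF L2_norm_nonneg energy_norm_ge(2)])
    show "\<forall>\<^sub>F k in sequentially. energy_norm ((u0, u1) - W k 0)
        \<le> L2_norm (weighted_fourier u0 - band (real k) (weighted_fourier u0)) + L2_norm (b - band (real k) b)"
    proof (intro always_eventually allI)
      fix k :: nat
      have W1: "fst (W k 0) \<in> sobolev 1" and W2: "snd (W k 0) \<in> L2"
        using WX[of 0 k] by (auto simp: energy_space_def)
      have F: "AE \<xi> in lborel. fourier_L2 (fst (W k 0)) \<xi> = band (real k) a \<xi>"
        "AE \<xi> in lborel. fourier_L2 (snd (W k 0)) \<xi> = band (real k) b \<xi>"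
        using fourier_inv_fourier_L2[OF band_0_L2[OF a]] fourier_inv_fourier_L2[OF band_0_L2[OF b]]
        by (simp_all add: W_def band_state_def)
      \<comment> \<open>Restriction to a band commutes with the Bessel weight, so approximation in
        the Sobolev norm is approximation of the weighted transform in L2.\<close>
      have "sobolev_norm 1 (u0 - fst (W k 0)) = L2_norm (weighted_fourier u0 - band (real k) (weighted_fourier u0))"
        unfolding sobolev_1_diff(2)[OF u0 W1]
      proof (rule L2_norm_cong)
        show "AE \<xi> in lborel. (weighted_fourier u0 - weighted_fourier (fst (W k 0))) \<xi>
            = (weighted_fourier u0 - band (real k) (weighted_fourier u0)) \<xi>"
          using F(1) by eventually_elim (simp add: weighted_fourier_def band_def a_def)
      qed (use Wu0 W1 in \<open>auto intro!: L2_borel[OF L2_diff] band_0_L2 simp: sobolev_1_iff\<close>)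
      moreover have "L2_norm (u1 - snd (W k 0)) \<le> L2_norm (b - band (real k) b)"
      proof -
        have "L2_norm (u1 - snd (W k 0)) \<le> L2_norm (fourier_L2 (u1 - snd (W k 0)))"
          by (intro L2_norm_le_fourier L2_diff u1 W2)
        also have "\<dots> = L2_norm (b - band (real k) b)"
        proof (rule L2_norm_cong)
          show "AE \<xi> in lborel. fourier_L2 (u1 - snd (W k 0)) \<xi> = (b - band (real k) b) \<xi>"
            using F(2) fourier_L2_diff[OF u1 W2] by eventually_elim (simp add: b_def)
        qed (intro L2_borel fourier_L2_L2 L2_diff u1 W2 b band_0_L2)+
        finally show ?thesis .
      qed
      ultimately show "energy_norm ((u0, u1) - W k 0)
        \<le> L2_norm (weighted_fourier u0 - band (real k) (weighted_fourier u0)) + L2_norm (b - band (real k) b)"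
        using energy_norm_le[of "(u0, u1) - W k 0"] unfolding fst_diff snd_diff fst_conv snd_conv by linarith
    qed
  qed
  obtain M where M: "energy.bounded_on (S t) M" using S_bounded[OF t] by blast
  define G where "G = fst (S t (u0, u1))"
  have StX: "S t (u0, u1) \<in> energy_space" by (rule S_in[OF t x])
  have GH: "G \<in> sobolev 1" using StX by (auto simp: G_def energy_space_def)
  have GL: "G \<in> L2" by (rule sobolev_1_L2[OF GH])
  have conv: "(\<lambda>k. L2_norm (fourier_L2 G - band (real k) (wave_mode t a b))) \<longlonglongrightarrow> 0"
  proof (rule tendsto_sandwich[OF _ _ tendsto_const])
    show "(\<lambda>k. M * energy_norm ((u0, u1) - W k 0)) \<longlonglongrightarrow> 0"
      by (rule tendsto_mult_right_zero[OF W0])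
    show "\<forall>\<^sub>F k in sequentially. 0 \<le> L2_norm (fourier_L2 G - band (real k) (wave_mode t a b))"
      by (intro always_eventually allI L2_norm_nonneg)
    show "\<forall>\<^sub>F k in sequentially. L2_norm (fourier_L2 G - band (real k) (wave_mode t a b)) \<le> M * energy_norm ((u0, u1) - W k 0)"
    proof (intro always_eventually allI)
      fix k :: nat
      have Wt: "W k t \<in> energy_space" and W0X: "W k 0 \<in> energy_space" using WX t by auto
      have Wt1: "fst (W k t) \<in> sobolev 1" using Wt by (auto simp: energy_space_def)
      note dL = sobolev_1_diff(1)[OF GH Wt1]
      have bL: "band (real k) (wave_mode t a b) \<in> L2" by (rule band_mode_L2(1)[OF a b _ t]) simp
      have Fk: "AE \<xi> in lborel. fourier_L2 (fst (W k t)) \<xi> = band (real k) (wave_mode t a b) \<xi>"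
        using fourier_inv_fourier_L2[OF bL] by (simp add: W_def band_state_def)
      have "L2_norm (fourier_L2 G - band (real k) (wave_mode t a b)) \<le> L2_norm (weighted_fourier (G - fst (W k t)))"
      proof (rule L2_norm_mono(2))
        show "weighted_fourier (G - fst (W k t)) \<in> L2" using dL by (simp add: sobolev_1_iff)
        show "fourier_L2 G - band (real k) (wave_mode t a b) \<in> borel_measurable borel"
          by (intro L2_borel L2_diff fourier_L2_L2 GL bL)
        show "AE \<xi> in lborel. cmod ((fourier_L2 G - band (real k) (wave_mode t a b)) \<xi>) \<le> cmod (weighted_fourier (G - fst (W k t)) \<xi>)"
          using Fk fourier_L2_diff[OF GL sobolev_1_L2[OF Wt1]]
        proof eventually_elim
          case (elim \<xi>)
          have "1 * cmod (fourier_L2 G \<xi> - band (real k) (wave_mode t a b) \<xi>) \<le> bessel_weight \<xi> * cmod (fourier_L2 G \<xi> - band (real k) (wave_mode t a b) \<xi>)"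
            by (intro mult_right_mono bessel_weight_ge_1) simp
          then show ?case
            using elim bessel_weight_ge_1[of \<xi>] by (simp add: weighted_fourier_def norm_mult)
        qed
      qed
      also have "\<dots> = sobolev_norm 1 (fst (S t (u0, u1) - W k t))"
        by (simp only: sobolev_1_norm G_def fst_diff)
      also have "\<dots> \<le> energy_norm (S t (u0, u1) - W k t)" by (rule energy_norm_ge(1))
      also have "\<dots> \<le> energy_norm (S t (u0, u1) - S t (W k 0)) + energy_norm (S t (W k 0) - W k t)"
        by (intro energy.N_triangle3 StX Wt S_in[OF t] W0X)
      also have "\<dots> = energy_norm (S t (u0, u1) - S t (W k 0))" by (simp add: uniq)
      also have "\<dots> \<le> M * energy_norm ((u0, u1) - W k 0)"
        by (intro energy.linear_mod_diff_bound S_linear[OF t] M x W0X)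
      finally show "L2_norm (fourier_L2 G - band (real k) (wave_mode t a b)) \<le> M * energy_norm ((u0, u1) - W k 0)" .
    qed
  qed
  have "AE \<xi> in lborel. fourier_L2 G \<xi> = wave_mode t a b \<xi>"
  proof (rule L2_limit_pointwise[OF _ fourier_L2_L2[OF GL] _ conv])
    show "band (real k) (wave_mode t a b) \<in> L2" for k by (rule band_mode_L2(1)[OF a b _ t]) simp
    show "wave_mode t a b \<in> borel_measurable borel" by (intro wave_mode_measurable L2_borel a b)
    show "AE \<xi> in lborel. (\<lambda>k. band (real k) (wave_mode t a b) \<xi>) \<longlonglongrightarrow> wave_mode t a b \<xi>"
      using AE_lborel_singleton[of 0]
    proof eventually_elim
      case (elim x)
      obtain n where "norm x \<le> real n" using real_arch_simple by blast
      then have "\<forall>\<^sub>F k in sequentially. band (real k) (wave_mode t a b) x = wave_mode t a b x"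
        using elim unfolding eventually_sequentially band_def by (intro exI[of _ n]) auto
      then show ?case by (rule tendsto_eventually)
    qed
  qed
  then show ?thesis by (simp add: G_def a_def b_def)
qed

subsection \<open>Radial integrals\<close>

text \<open>The image of Lebesgue measure under the norm is identified on the half-lines up to a,
  where it is the volume of the ball of radius a; the density is the derivative of that
  volume.\<close>

lemma nn_integral_radial:
  fixes g :: "real \<Rightarrow> ennreal"
  assumes [measurable]: "g \<in> borel_measurable borel"
  shows "(\<integral>\<^sup>+\<xi>. g (norm (\<xi> :: 'a::euclidean_space)) \<partial>lborel) =
    ennreal (DIM('a) * unit_ball_vol DIM('a)) * (\<integral>\<^sup>+r. indicator {0<..} r * ennreal (r ^ (DIM('a) - 1)) * g r \<partial>lborel)"
proof -
  define n where "n = DIM('a)"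
  have n: "n \<ge> 1" by (simp add: n_def Suc_le_eq)
  define V where "V = unit_ball_vol n"
  have V: "0 \<le> V" by (simp add: V_def)
  define w where "w r = indicator {0<..} r * ennreal (n * V * r ^ (n - 1))" for r :: real
  have [measurable]: "w \<in> borel_measurable borel" unfolding w_def by measurable
  have "distr (lborel :: 'a measure) borel norm = density lborel w"
  proof (rule measure_eqI_generator_eq[where E="range (\<lambda>a::real. {..a})" and \<Omega>=UNIV and A="\<lambda>i. {..real i}"])
    show "Int_stable (range (\<lambda>a::real. {..a}))"
      by (auto simp: Int_stable_def)
    show "sets (distr (lborel :: 'a measure) borel norm) = sigma_sets UNIV (range (\<lambda>a::real. {..a}))"
      "sets (density lborel w) = sigma_sets UNIV (range (\<lambda>a::real. {..a}))"
      by (simp_all add: borel_eq_atMost)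
    show "(\<Union>i. {..real i}) = (UNIV :: real set)"
      using real_arch_simple by auto
    have cb: "norm -` {..a} = cball (0::'a) a" for a by auto
    show "emeasure (distr (lborel :: 'a measure) borel norm) {..real i} \<noteq> \<infinity>" for i
      using emeasure_lborel_cball_finite[of "0::'a" "real i"] by (simp add: emeasure_distr cb)
    fix X :: "real set" assume "X \<in> range (\<lambda>a::real. {..a})"
    then obtain a where X: "X = {..a}" by auto
    show "emeasure (distr (lborel :: 'a measure) borel norm) X = emeasure (density lborel w) X"
    proof (cases "0 \<le> a")
      case True
      have "emeasure (density lborel w) X = (\<integral>\<^sup>+r. w r * indicator {..a} r \<partial>lborel)"
        by (simp add: X emeasure_density)
      \<comment> \<open>The two domains of integration differ only in the point 0.\<close>
      also have "\<dots> = (\<integral>\<^sup>+r. ennreal (n * V * r ^ (n - 1)) * indicator {0..a} r \<partial>lborel)"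
        using AE_lborel_singleton[of 0]
        by (intro nn_integral_cong_AE) (auto elim!: eventually_mono simp: w_def indicator_def)
      also have "\<dots> = ennreal (V * a ^ n - V * 0 ^ n)"
      proof (rule nn_integral_FTC_Icc)
        fix x :: real assume "x \<in> {0..a}"
        then show "0 \<le> n * V * x ^ (n - 1)" using V by simp
        show "DERIV (\<lambda>x. V * x ^ n) x :> n * V * x ^ (n - 1)"
          by (auto intro!: derivative_eq_intros)
      qed (use True in auto)
      also have "\<dots> = emeasure lborel (cball (0::'a) a)"
        using True n by (subst emeasure_cball) (simp_all add: V_def n_def)
      finally show ?thesis by (simp add: X emeasure_distr cb)
    next
      case False
      then have "cball (0::'a) a = {}" by simp
      moreover have "(\<integral>\<^sup>+r. w r * indicator {..a} r \<partial>lborel) = (\<integral>\<^sup>+(r::real). 0 \<partial>lborel)"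
        using False by (intro nn_integral_cong) (auto simp: w_def indicator_def)
      ultimately show ?thesis by (simp add: X emeasure_distr emeasure_density cb)
    qed
  qed auto
  then have "(\<integral>\<^sup>+r. g r \<partial>distr (lborel :: 'a measure) borel norm) = (\<integral>\<^sup>+r. g r \<partial>density lborel w)"
    by simp
  then have "(\<integral>\<^sup>+\<xi>. g (norm (\<xi> :: 'a)) \<partial>lborel) = (\<integral>\<^sup>+r. w r * g r \<partial>lborel)"
    by (simp add: nn_integral_distr nn_integral_density)
  also have "\<dots> = (\<integral>\<^sup>+r. ennreal (n * V) * (indicator {0<..} r * ennreal (r ^ (n - 1)) * g r) \<partial>lborel)"
    using V by (intro nn_integral_cong) (auto simp: w_def indicator_def ennreal_mult mult.assoc)
  also have "\<dots> = ennreal (n * V) * (\<integral>\<^sup>+r. indicator {0<..} r * ennreal (r ^ (n - 1)) * g r \<partial>lborel)"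
    by (rule nn_integral_cmult) measurable
  finally show ?thesis by (simp add: n_def V_def)
qed

section \<open>The damping factor and its moments\<close>

lemma Bernoulli_powr:
  fixes p x :: real
  assumes "1 \<le> p" "0 \<le> x" shows "1 + p * x \<le> (1 + x) powr p"
proof -
  have "(1 + 0) powr p - p * 0 \<le> (1 + x) powr p - p * x"
  proof (rule DERIV_nonneg_imp_nondecreasing[OF assms(2)])
    fix y :: real assume y: "0 \<le> y" "y \<le> x"
    have "((\<lambda>y. (1 + y) powr p - p * y) has_real_derivative (p * (1 + y) powr (p - 1) - p)) (at y)"
      using y by (auto intro!: derivative_eq_intros)
    moreover have "1 \<le> (1 + y) powr (p - 1)"
      using y assms by (intro ge_one_powr_ge_zero) auto
    then have "0 \<le> p * (1 + y) powr (p - 1) - p" using assms by simp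
    ultimately show "\<exists>d. ((\<lambda>y. (1 + y) powr p - p * y) has_real_derivative d) (at y) \<and> 0 \<le> d" by blast
  qed
  then show ?thesis by simp
qed

text \<open>Bernoulli's inequality for (1 + r^2)^t. The growth in t r^2 is what later absorbs
  polynomial factors.\<close>

lemma exp_damping_ge:
  assumes "1 \<le> t" shows "1 + t * r\<^sup>2 \<le> exp (damping r * t)"
proof -
  have p: "0 < 1 + r\<^sup>2" by (simp add: add_pos_nonneg)
  have "(1 + r\<^sup>2) powr t = exp (damping r * t)"
    using p by (simp add: powr_def damping_def mult.commute)
  then show ?thesis using Bernoulli_powr[OF assms, of "r\<^sup>2"] by simp
qed

text \<open>This is (1 + r^2)^(-t), the square of the damping factor in
  \<open>propagator\<close>.\<close>

definition decay :: "real \<Rightarrow> real \<Rightarrow> real" where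
  "decay t r = exp (- (damping r * t))"

lemma decay_measurable [measurable]: "decay t \<in> borel_measurable borel"
  unfolding decay_def[abs_def] by measurable

lemma decay_pos: "0 < decay t r"
  by (simp add: decay_def)

lemma decay_le_1: "0 \<le> t \<Longrightarrow> decay t r \<le> 1"
  using damping_nonneg[of r] by (simp add: decay_def)

lemma decay_ge: "0 \<le> t \<Longrightarrow> exp (- (r\<^sup>2 * t)) \<le> decay t r"
  using damping_le_sq[of r] by (simp add: decay_def mult_right_mono)

text \<open>Bernoulli gives a single inverse power of t r^2. Splitting the time into k pieces of
  length t/k >= 1 and multiplying gives k of them, enough for integrability at infinity.\<close>

lemma decay_le_power:
  assumes k: "1 \<le> k" "real k \<le> t" and r: "0 < r"
  shows "decay t r \<le> (real k / t) ^ k * (1 / r) ^ (2 * k)"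
proof -
  have t: "0 < t" "0 < real k" using k by auto
  have "(t / real k * r\<^sup>2) ^ k \<le> (1 + t / real k * r\<^sup>2) ^ k"
    using t by (intro power_mono) auto
  also have "\<dots> \<le> (exp (damping r * (t / real k))) ^ k"
    using exp_damping_ge[of "t / real k" r] k t by (intro power_mono) auto
  also have "\<dots> = exp (damping r * t)"
    using t by (simp flip: exp_of_nat_mult)
  finally have le: "(t / real k * r\<^sup>2) ^ k \<le> exp (damping r * t)" .
  have p: "0 < (t / real k * r\<^sup>2) ^ k" using t r by simp
  have "decay t r = 1 / exp (damping r * t)"
    by (simp add: decay_def exp_minus inverse_eq_divide)
  also have "\<dots> \<le> 1 / (t / real k * r\<^sup>2) ^ k"
    using le p by (intro divide_left_mono) auto
  also have "\<dots> = (real k / t) ^ k * (1 / r) ^ (2 * k)"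
    using t r by (simp add: power_mult_distrib power_divide power_mult)
  finally show ?thesis .
qed

lemma nn_integral_inverse_power_tail:
  fixes a :: real
  assumes "0 < a"
  shows "(\<integral>\<^sup>+r. ennreal ((1 / r) ^ (m + 2)) * indicator {a..} r \<partial>lborel) = ennreal ((1 / a) ^ (m + 1) / (m + 1))"
proof -
  have "(\<integral>\<^sup>+r. ennreal ((1 / r) ^ (m + 2)) * indicator {a..} r \<partial>lborel) = ennreal (0 - - ((1 / a) ^ (m + 1) / (m + 1)))"
  proof (rule nn_integral_FTC_atLeast)
    fix x :: real assume x: "a \<le> x"
    then have x0: "0 < x" using assms by simp
    show "0 \<le> (1 / x) ^ (m + 2)" using x0 by simp
    have "DERIV (\<lambda>r. 1 / r) x :> - (1 / x\<^sup>2)"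
      using x0 by (auto intro!: derivative_eq_intros simp: power2_eq_square)
    from DERIV_minus[OF DERIV_cdivide[OF DERIV_power_Suc[OF this, of m], of "real (m + 1)"]]
    have "DERIV (\<lambda>r. - ((1 / r) ^ (m + 1) / (m + 1))) x :> - ((1 + real m) * (- (1 / x\<^sup>2) * (1 / x) ^ m) / real (m + 1))"
      by (simp only: Suc_eq_plus1 of_nat_add)
    also have "- ((1 + real m) * (- (1 / x\<^sup>2) * (1 / x) ^ m) / real (m + 1)) = (1 / x) ^ (m + 2)"
    proof -
      have "(1 / x) ^ (m + 2) = 1 / x\<^sup>2 * (1 / x) ^ m"
        by (simp add: power_add power_divide power2_eq_square)
      moreover have "real (m + 1) = 1 + real m" "1 + real m \<noteq> 0" by auto
      moreover have "- (c * (- A * B) / c) = A * B" if "c \<noteq> 0" for A B c :: real using that by simp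
      ultimately show ?thesis by (simp only:)
    qed
    finally show "DERIV (\<lambda>r. - ((1 / r) ^ (m + 1) / (m + 1))) x :> (1 / x) ^ (m + 2)" .
  next
    have "((\<lambda>r::real. 1 / r) \<longlongrightarrow> 0) at_top"
      by (rule tendsto_divide_0[OF tendsto_const filterlim_at_top_imp_at_infinity[OF filterlim_ident]])
    then have "((\<lambda>r. - ((1 / r) ^ (m + 1) / (m + 1))) \<longlongrightarrow> - (0 ^ (m + 1) / (m + 1))) at_top"
      by (intro tendsto_intros) auto
    then show "((\<lambda>r. - ((1 / r) ^ (m + 1) / (m + 1))) \<longlongrightarrow> 0) at_top"
      by simp
  qed measurable
  then show ?thesis by simp
qed

text \<open>The scale is d = t^(-1/2). Below d the decay factor is bounded by 1; above d the choice
  k = p + 2 leaves the integrable power r^(-p-4). Both parts are bounded by multiples of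
  d^(p+1).\<close>

lemma decay_moment:
  fixes p :: nat
  defines "k \<equiv> p + 2"
  assumes t: "real k \<le> t"
  shows "(\<integral>\<^sup>+r. indicator {0<..} r * ennreal (r ^ p * decay t r) \<partial>lborel)
     \<le> ennreal ((1 + real k ^ k) * (1 / sqrt t) ^ (p + 1))"
proof -
  define d where "d = 1 / sqrt t"
  have t0: "0 < t" using t by (simp add: k_def)
  have d: "0 < d" "d\<^sup>2 = 1 / t" using t0 by (simp_all add: d_def power_divide)
  define K where "K = (real k * d\<^sup>2) ^ k"
  have K: "0 \<le> K" by (simp add: K_def)
  have "(\<integral>\<^sup>+r. indicator {0<..} r * ennreal (r ^ p * decay t r) \<partial>lborel)
     \<le> (\<integral>\<^sup>+r. ennreal (r ^ p) * indicator {0..d} r + ennreal (K * (1 / r) ^ (p + 4)) * indicator {d..} r \<partial>lborel)"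
  proof (rule nn_integral_mono)
    fix r :: real
    show "indicator {0<..} r * ennreal (r ^ p * decay t r)
       \<le> ennreal (r ^ p) * indicator {0..d} r + ennreal (K * (1 / r) ^ (p + 4)) * indicator {d..} r"
    proof (cases "0 < r")
      case r: True
      show ?thesis
      proof (cases "r \<le> d")
        case True
        have "ennreal (r ^ p * decay t r) \<le> ennreal (r ^ p)"
          using r decay_le_1[of t r] t0 decay_pos[of t r] by (intro ennreal_leI) (simp add: mult_left_le)
        also have "\<dots> \<le> ennreal (r ^ p) + ennreal (K * (1 / r) ^ (p + 4)) * indicator {d..} r" by simp
        finally show ?thesis using r True by (simp add: indicator_def)
      next
        case False
        have "r ^ p * decay t r \<le> r ^ p * ((real k / t) ^ k * (1 / r) ^ (2 * k))"
          using decay_le_power[of k t r] t r by (intro mult_left_mono) (auto simp: k_def)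
        also have "\<dots> = K * (r ^ p * (1 / r) ^ (2 * k))"
          by (simp add: K_def d)
        also have "r ^ p * (1 / r) ^ (2 * k) = (1 / r) ^ (p + 4)"
        proof -
          have "2 * k = p + (p + 4)" by (simp add: k_def)
          then have "r ^ p * (1 / r) ^ (2 * k) = (r * (1 / r)) ^ p * (1 / r) ^ (p + 4)"
            by (simp only: power_add power_mult_distrib mult.assoc)
          then show ?thesis using r by simp
        qed
        finally show ?thesis using r False by (simp add: indicator_def ennreal_leI)
      qed
    qed (simp add: indicator_def)
  qed
  also have "\<dots> = (\<integral>\<^sup>+r. ennreal (r ^ p) * indicator {0..d} r \<partial>lborel)
      + (\<integral>\<^sup>+r. ennreal (K * (1 / r) ^ (p + 4)) * indicator {d..} r \<partial>lborel)"
    by (rule nn_integral_add) measurable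
  also have "(\<integral>\<^sup>+r. ennreal (r ^ p) * indicator {0..d} r \<partial>lborel) = ennreal (d ^ (p + 1) / (p + 1) - 0 ^ (p + 1) / (p + 1))"
  proof (rule nn_integral_FTC_Icc[where F="\<lambda>r. r ^ (p + 1) / (p + 1)"])
    fix x :: real assume x: "x \<in> {0..d}"
    show "0 \<le> x ^ p" using x by simp
    have "DERIV (\<lambda>r. r ^ Suc p) x :> real (Suc p) * x ^ p"
      using DERIV_pow[of "Suc p" x UNIV] by simp
    from DERIV_cdivide[OF this, of "real (Suc p)"]
    show "DERIV (\<lambda>r. r ^ (p + 1) / (p + 1)) x :> x ^ p" by (simp del: power_Suc of_nat_Suc)
  qed (use d in auto)
  also have "(\<integral>\<^sup>+r. ennreal (K * (1 / r) ^ (p + 4)) * indicator {d..} r \<partial>lborel)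
     = (\<integral>\<^sup>+r. ennreal K * (ennreal ((1 / r) ^ (p + 2 + 2)) * indicator {d..} r) \<partial>lborel)"
  proof -
    have e: "p + 2 + 2 = p + 4" by simp
    show ?thesis unfolding e using K d by (intro nn_integral_cong) (auto simp: indicator_def ennreal_mult)
  qed
  also have "\<dots> = ennreal K * ennreal ((1 / d) ^ (p + 2 + 1) / (p + 2 + 1))"
    unfolding nn_integral_inverse_power_tail[OF d(1), symmetric] by (rule nn_integral_cmult) measurable
  also have "\<dots> = ennreal (K * (1 / d) ^ (p + 3) / (p + 3))"
  proof -
    have e: "p + 2 + 1 = p + 3" by simp
    show ?thesis unfolding e using K d by (simp add: ennreal_mult[symmetric])
  qed
  also have "ennreal (d ^ (p + 1) / (p + 1) - 0 ^ (p + 1) / (p + 1)) + ennreal (K * (1 / d) ^ (p + 3) / (p + 3))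
     = ennreal (d ^ (p + 1) / (p + 1) + K * (1 / d) ^ (p + 3) / (p + 3))"
    using d K by (subst ennreal_plus[symmetric]) auto
  also have "\<dots> \<le> ennreal ((1 + real k ^ k) * d ^ (p + 1))"
  proof (rule ennreal_leI)
    have "K * (1 / d) ^ (p + 3) = real k ^ k * d ^ (p + 1)"
    proof -
      have "2 * k = (p + 1) + (p + 3)" by (simp add: k_def)
      then have "(d\<^sup>2) ^ k = d ^ (p + 1) * d ^ (p + 3)"
        by (simp only: power_mult[symmetric] power_add)
      then have "K * (1 / d) ^ (p + 3) = real k ^ k * d ^ (p + 1) * (d * (1 / d)) ^ (p + 3)"
        unfolding K_def by (simp only: power_mult_distrib mult.assoc)
      then show ?thesis using d by simp
    qed
    moreover have dle: "X / real m \<le> X" if "0 \<le> X" "1 \<le> m" for X m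
      using that by (simp add: divide_le_eq mult_le_cancel_left1)
    have nn: "0 \<le> real k ^ k * d ^ (p + 1)" "0 \<le> d ^ (p + 1)" using d by simp_all
    from dle[OF nn(1), of "p + 3"] calculation
    have "K * (1 / d) ^ (p + 3) / (p + 3) \<le> real k ^ k * d ^ (p + 1)"
      by (simp only:)
    moreover have "d ^ (p + 1) / (p + 1) \<le> d ^ (p + 1)"
      by (rule dle[OF nn(2)]) simp
    ultimately show "d ^ (p + 1) / (p + 1) + K * (1 / d) ^ (p + 3) / (p + 3) \<le> (1 + real k ^ k) * d ^ (p + 1)"
      by (simp add: distrib_right)
  qed
  finally show ?thesis by (simp add: d_def)
qed

section \<open>The radial integral of the squared profile\<close>

definition oscillation :: "nat \<Rightarrow> real \<Rightarrow> real \<Rightarrow> real" where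
  "oscillation n t r = r ^ (n - 1) * (decay t r * (sin (r * t) / r)\<^sup>2)"

lemma oscillation_measurable [measurable]: "oscillation n t \<in> borel_measurable borel"
  unfolding oscillation_def[abs_def] by measurable

text \<open>For n >= 3 the Jacobian r^(n-1) compensates 1/r^2, so bounding sin^2 by 1 leaves the
  moment of order n - 3.\<close>

lemma oscillation_upper_3:
  assumes n: "3 \<le> n" and t: "real (n - 1) \<le> t"
  shows "(\<integral>\<^sup>+r. indicator {0<..} r * ennreal (oscillation n t r) \<partial>lborel)
     \<le> ennreal ((1 + real (n - 1) ^ (n - 1)) * (1 / sqrt t) ^ (n - 2))"
proof -
  have "(\<integral>\<^sup>+r. indicator {0<..} r * ennreal (oscillation n t r) \<partial>lborel)
     \<le> (\<integral>\<^sup>+r. indicator {0<..} r * ennreal (r ^ (n - 3) * decay t r) \<partial>lborel)"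
  proof (rule nn_integral_mono)
    fix r :: real
    show "indicator {0<..} r * ennreal (oscillation n t r) \<le> indicator {0<..} r * ennreal (r ^ (n - 3) * decay t r)"
    proof (cases "0 < r")
      case True
      have e: "n - 1 = (n - 3) + 2" using n by simp
      have "oscillation n t r = r ^ (n - 3) * decay t r * (sin (r * t))\<^sup>2"
        unfolding oscillation_def e power_add using True by (simp add: power_divide)
      also have "\<dots> \<le> r ^ (n - 3) * decay t r"
        using True decay_pos[of t r] abs_square_le_1[of "sin (r * t)"] by (intro mult_left_le) auto
      finally show ?thesis by (intro mult_left_mono ennreal_leI) auto
    qed simp
  qed
  also have "\<dots> \<le> ennreal ((1 + real (n - 3 + 2) ^ (n - 3 + 2)) * (1 / sqrt t) ^ (n - 3 + 1))"
    using t n by (intro decay_moment) (simp add: of_nat_diff)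
  also have "n - 3 + 2 = n - 1" using n by simp
  also have "n - 3 + 1 = n - 2" using n by simp
  finally show ?thesis .
qed

lemma sinc_sq_le: fixes r t :: real shows "0 \<le> t \<Longrightarrow> (sin (r * t) / r)\<^sup>2 \<le> t\<^sup>2"
  using sinc_bound[of t r] by (metis abs_ge_zero power2_abs power_mono)

lemma sinc_sq_le': fixes r t :: real shows "(sin (r * t) / r)\<^sup>2 \<le> (1 / r)\<^sup>2"
  using abs_square_le_1[of "sin (r * t)"] by (simp add: power_divide divide_right_mono)

text \<open>The singularity is cut at r = 1/t. Below, |sin (r t) / r| <= t on an interval of length
  1/t; above, the square is at most 1/r^2. Each part contributes t.\<close>

lemma oscillation_upper_1:
  assumes t: "0 < t"
  shows "(\<integral>\<^sup>+r. indicator {0<..} r * ennreal (oscillation 1 t r) \<partial>lborel) \<le> ennreal (2 * t)"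
proof -
  have "(\<integral>\<^sup>+r. indicator {0<..} r * ennreal (oscillation 1 t r) \<partial>lborel)
     \<le> (\<integral>\<^sup>+r. ennreal (t\<^sup>2) * indicator {0..1 / t} r + ennreal ((1 / r) ^ (0 + 2)) * indicator {1 / t..} r \<partial>lborel)"
  proof (rule nn_integral_mono)
    fix r :: real
    have o: "oscillation 1 t r \<le> (sin (r * t) / r)\<^sup>2"
      using decay_le_1[of t r] t decay_pos[of t r] by (simp add: oscillation_def mult_left_le_one_le)
    consider "r \<le> 0" | "0 < r" "r \<le> 1 / t" | "0 < r" "1 / t < r" by linarith
    then show "indicator {0<..} r * ennreal (oscillation 1 t r)
       \<le> ennreal (t\<^sup>2) * indicator {0..1 / t} r + ennreal ((1 / r) ^ (0 + 2)) * indicator {1 / t..} r"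
    proof cases
      case 2
      have "ennreal (oscillation 1 t r) \<le> ennreal (t\<^sup>2)"
        using o sinc_sq_le[of t r] t by (intro ennreal_leI) simp
      also have "\<dots> \<le> ennreal (t\<^sup>2) + ennreal ((1 / r) ^ (0 + 2)) * indicator {1 / t..} r" by simp
      finally show ?thesis using 2 by (simp add: indicator_def)
    next
      case 3
      have "ennreal (oscillation 1 t r) \<le> ennreal ((1 / r)\<^sup>2)"
        using o sinc_sq_le'[of r t] by (intro ennreal_leI) linarith
      moreover have "(1 / r) ^ (0 + 2) = (1 / r)\<^sup>2" by (simp only: add_0)
      ultimately show ?thesis using 3 by (simp only: indicator_def) simp
    qed (simp add: indicator_def)
  qed
  also have "\<dots> = (\<integral>\<^sup>+r. ennreal (t\<^sup>2) * indicator {0..1 / t} r \<partial>lborel)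
      + (\<integral>\<^sup>+r. ennreal ((1 / r) ^ (0 + 2)) * indicator {1 / t..} r \<partial>lborel)"
    by (rule nn_integral_add) measurable
  also have "(\<integral>\<^sup>+r. ennreal ((1 / r) ^ (0 + 2)) * indicator {1 / t..} r \<partial>lborel) = ennreal t"
    using nn_integral_inverse_power_tail[of "1 / t" 0] t by simp
  also have "(\<integral>\<^sup>+r. ennreal (t\<^sup>2) * indicator {0..1 / t} r \<partial>lborel) = ennreal t"
    using t by (simp add: nn_integral_cmult_indicator ennreal_mult[symmetric] power2_eq_square)
  also have "ennreal t + ennreal t = ennreal (2 * t)"
    using t by (subst ennreal_plus[symmetric]) auto
  finally show ?thesis .
qed

text \<open>The logarithm comes from 1/r on 1/t <= r <= 1; the ranges below and above contribute 1/2
  each. The total 1 + ln t is at most 2 ln t for t >= exp 1.\<close>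

lemma oscillation_upper_2:
  assumes t: "exp 1 \<le> t"
  shows "(\<integral>\<^sup>+r. indicator {0<..} r * ennreal (oscillation 2 t r) \<partial>lborel) \<le> ennreal (2 * ln t)"
proof -
  have t1: "1 < t" using t exp_gt_one[of 1] by linarith
  have lnt: "1 \<le> ln t" using t t1 ln_ge_iff[of t 1] by simp
  have "(\<integral>\<^sup>+r. indicator {0<..} r * ennreal (oscillation 2 t r) \<partial>lborel)
     \<le> (\<integral>\<^sup>+r. (ennreal (t\<^sup>2 * r) * indicator {0..1 / t} r + ennreal (1 / r) * indicator {1 / t..1} r)
          + ennreal ((1 / r) ^ (1 + 2)) * indicator {1..} r \<partial>lborel)"
  proof (rule nn_integral_mono)
    fix r :: real
    have o: "oscillation 2 t r = r * (decay t r * (sin (r * t) / r)\<^sup>2)"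
      by (simp add: oscillation_def)
    have ds: "decay t r * (sin (r * t) / r)\<^sup>2 \<le> (sin (r * t) / r)\<^sup>2"
      using decay_le_1[of t r] t1 decay_pos[of t r] by (simp add: mult_left_le_one_le)
    consider "r \<le> 0" | "0 < r" "r \<le> 1 / t" | "0 < r" "1 / t < r" "r \<le> 1" | "0 < r" "1 < r" by linarith
    then show "indicator {0<..} r * ennreal (oscillation 2 t r)
       \<le> (ennreal (t\<^sup>2 * r) * indicator {0..1 / t} r + ennreal (1 / r) * indicator {1 / t..1} r)
          + ennreal ((1 / r) ^ (1 + 2)) * indicator {1..} r"
    proof cases
      case 2
      have "oscillation 2 t r \<le> r * t\<^sup>2"
        unfolding o using 2 ds sinc_sq_le[of t r] t1 by (intro mult_left_mono) auto
      then have "ennreal (oscillation 2 t r) \<le> ennreal (t\<^sup>2 * r)"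
        by (intro ennreal_leI) (simp add: mult.commute)
      also have "\<dots> \<le> ennreal (t\<^sup>2 * r) + ennreal (1 / r) * indicator {1 / t..1} r
          + ennreal ((1 / r) ^ (1 + 2)) * indicator {1..} r" by (simp add: add.assoc)
      finally show ?thesis using 2 by (simp add: indicator_def)
    next
      case 3
      have "oscillation 2 t r \<le> r * (1 / r)\<^sup>2"
        unfolding o using 3 order_trans[OF ds sinc_sq_le'[of r t]] by (intro mult_left_mono) auto
      also have "\<dots> = 1 / r" using 3 by (simp add: power2_eq_square)
      finally have "ennreal (oscillation 2 t r) \<le> ennreal (1 / r)"
        by (rule ennreal_leI)
      also have "\<dots> \<le> ennreal (1 / r) + ennreal ((1 / r) ^ (1 + 2)) * indicator {1..} r" by simp
      finally show ?thesis using 3 by (simp add: indicator_def)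
    next
      case 4
      \<comment> \<open>Beyond 1 the damping supplies a factor 1/r^2, which brings the integrand
        down to r^(-3).\<close>
      have "decay t r \<le> (1 / r)\<^sup>2"
      proof -
        have "r\<^sup>2 \<le> t * r\<^sup>2" using t1 by (simp add: mult_le_cancel_right1)
        then have "r\<^sup>2 \<le> exp (damping r * t)" using exp_damping_ge[of t r] t1 by linarith
        then have "1 / exp (damping r * t) \<le> 1 / r\<^sup>2" using 4 by (intro divide_left_mono) auto
        then show ?thesis by (simp add: decay_def exp_minus inverse_eq_divide power_divide)
      qed
      moreover have "(sin (r * t) / r)\<^sup>2 \<le> 1"
      proof -
        have "(1 / r)\<^sup>2 \<le> 1" using 4 by (simp add: power_le_one_iff)
        then show ?thesis using sinc_sq_le'[of r t] by linarith
      qed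
      ultimately have "decay t r * (sin (r * t) / r)\<^sup>2 \<le> (1 / r)\<^sup>2 * (1 / r)\<^sup>2"
        using sinc_sq_le'[of r t] decay_pos[of t r] by (intro mult_mono) auto
      then have "oscillation 2 t r \<le> r * ((1 / r)\<^sup>2 * (1 / r)\<^sup>2)"
        unfolding o using 4 by (intro mult_left_mono) auto
      also have "\<dots> = (1 / r) ^ (1 + 2)" using 4 by (simp add: power2_eq_square eval_nat_numeral)
      finally have "ennreal (oscillation 2 t r) \<le> ennreal ((1 / r) ^ (1 + 2))"
        by (rule ennreal_leI)
      moreover have "1 / t < 1" using t1 by simp
      ultimately show ?thesis using 4 by (simp add: indicator_def)
    qed (simp add: indicator_def)
  qed
  also have "\<dots> = (\<integral>\<^sup>+r. ennreal (t\<^sup>2 * r) * indicator {0..1 / t} r + ennreal (1 / r) * indicator {1 / t..1} r \<partial>lborel)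
      + (\<integral>\<^sup>+r. ennreal ((1 / r) ^ (1 + 2)) * indicator {1..} r \<partial>lborel)"
    by (rule nn_integral_add) measurable
  also have "(\<integral>\<^sup>+r. ennreal (t\<^sup>2 * r) * indicator {0..1 / t} r + ennreal (1 / r) * indicator {1 / t..1} r \<partial>lborel)
     = (\<integral>\<^sup>+r. ennreal (t\<^sup>2 * r) * indicator {0..1 / t} r \<partial>lborel) + (\<integral>\<^sup>+r. ennreal (1 / r) * indicator {1 / t..1} r \<partial>lborel)"
    by (rule nn_integral_add) measurable
  also have "(\<integral>\<^sup>+r. ennreal ((1 / r) ^ (1 + 2)) * indicator {1..} r \<partial>lborel) = ennreal (1 / 2)"
    using nn_integral_inverse_power_tail[of 1 1] by simp
  also have "(\<integral>\<^sup>+r. ennreal (t\<^sup>2 * r) * indicator {0..1 / t} r \<partial>lborel) = ennreal (t\<^sup>2 * (1 / t)\<^sup>2 / 2 - t\<^sup>2 * 0\<^sup>2 / 2)"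
    using t1 by (intro nn_integral_FTC_Icc) (auto intro!: derivative_eq_intros)
  also have "(\<integral>\<^sup>+r. ennreal (1 / r) * indicator {1 / t..1} r \<partial>lborel) = ennreal (ln 1 - ln (1 / t))"
  proof (rule nn_integral_FTC_Icc)
    fix x :: real assume "x \<in> {1 / t..1}"
    moreover have "0 < 1 / t" using t1 by simp
    ultimately have "0 < x" by (metis atLeastAtMost_iff less_le_trans)
    then show "DERIV ln x :> 1 / x" "0 \<le> 1 / x" by (auto intro!: derivative_eq_intros)
  qed (use t1 in auto)
  also have "ennreal (t\<^sup>2 * (1 / t)\<^sup>2 / 2 - t\<^sup>2 * 0\<^sup>2 / 2) + ennreal (ln 1 - ln (1 / t)) + ennreal (1 / 2) = ennreal (1 + ln t)"
  proof -
    have e: "t\<^sup>2 * (1 / t)\<^sup>2 / 2 - t\<^sup>2 * 0\<^sup>2 / 2 = 1 / 2" "ln 1 - ln (1 / t) = ln t"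
      using t1 by (simp_all add: power_divide ln_div)
    have "ennreal (1 / 2 + ln t + 1 / 2) = ennreal (1 / 2 + ln t) + ennreal (1 / 2)"
      using lnt by (intro ennreal_plus) auto
    moreover have "ennreal (1 / 2 + ln t) = ennreal (1 / 2) + ennreal (ln t)"
      using lnt by (intro ennreal_plus) auto
    moreover have "1 / 2 + ln t + 1 / 2 = 1 + ln t" by simp
    ultimately show ?thesis unfolding e by (simp only:)
  qed
  also have "\<dots> \<le> ennreal (2 * ln t)" using lnt by (intro ennreal_leI) simp
  finally show ?thesis .
qed

text \<open>A lower bound through a minorant \<open>h\<close> with an explicit antiderivative
  \<open>H\<close>. Such an \<open>h\<close> may become negative, as it can in dimension 2; hence
  the passage through max 0.\<close>

lemma nn_integral_ge_interval:
  fixes f h H :: "real \<Rightarrow> real"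
  assumes ab: "0 < a" "a \<le> b"
    and H: "\<And>x. x \<in> {a..b} \<Longrightarrow> (H has_real_derivative h x) (at x)" "continuous_on {a..b} h"
    and f: "f \<in> borel_measurable borel"
    and le: "\<And>x. x \<in> {a..b} \<Longrightarrow> h x \<le> f x"
    and C: "C \<le> H b - H a"
  shows "ennreal C \<le> (\<integral>\<^sup>+r. indicator {0<..} r * ennreal (f r) \<partial>lborel)"
proof -
  have int: "integrable lborel (\<lambda>x. indicator {a..b} x *\<^sub>R h x)"
    using borel_integrable_atLeastAtMost'[OF H(2)] by (simp add: set_integrable_def)
  have "(\<integral>x. indicator {a..b} x *\<^sub>R h x \<partial>lborel) = H b - H a"
    using ab(2) H
    by (intro integral_FTC_atLeastAtMost)
      (auto simp: has_real_derivative_iff_has_vector_derivative[symmetric] intro: has_field_derivative_at_within)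
  with C have "ennreal C \<le> ennreal (\<integral>x. indicator {a..b} x *\<^sub>R h x \<partial>lborel)"
    by (intro ennreal_leI) simp
  also have "\<dots> \<le> ennreal (\<integral>x. max 0 (indicator {a..b} x *\<^sub>R h x) \<partial>lborel)"
    using int by (intro ennreal_leI integral_mono Bochner_Integration.integrable_max) auto
  also have "\<dots> = (\<integral>\<^sup>+x. ennreal (max 0 (indicator {a..b} x *\<^sub>R h x)) \<partial>lborel)"
    using int by (intro nn_integral_eq_integral[symmetric] Bochner_Integration.integrable_max) auto
  also have "\<dots> = (\<integral>\<^sup>+x. ennreal (indicator {a..b} x *\<^sub>R h x) \<partial>lborel)"
    by (intro nn_integral_cong) (simp add: max_def ennreal_neg)
  also have "\<dots> \<le> (\<integral>\<^sup>+r. indicator {0<..} r * ennreal (f r) \<partial>lborel)"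
  proof (rule nn_integral_mono)
    fix x :: real
    show "ennreal (indicator {a..b} x *\<^sub>R h x) \<le> indicator {0<..} x * ennreal (f x)"
      using le[of x] ab by (auto simp: indicator_def intro: ennreal_leI)
  qed
  finally show ?thesis .
qed

text \<open>On [d, 2 d] with d = t^(-1/2) one has r^2 t <= 4, so the damping factor is at least exp
  (-4), and sin^2 has mean 1/2. The oscillating part contributes at most 1/(2 t), which for t >= 4
  is at most d/4, half of the main term d/2.\<close>

lemma oscillation_lower_3:
  assumes n: "3 \<le> n" and t: "4 \<le> t"
  shows "ennreal (exp (-4) / 4 * (1 / sqrt t) ^ (n - 2)) \<le> (\<integral>\<^sup>+r. indicator {0<..} r * ennreal (oscillation n t r) \<partial>lborel)"
proof -
  define d where "d = 1 / sqrt t"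
  have d: "0 < d" "d\<^sup>2 = 1 / t" "d * sqrt t = 1" using t by (simp_all add: d_def power_divide)
  have td: "1 / t \<le> d / 2"
  proof -
    have "2 \<le> sqrt t" using t by (intro real_le_rsqrt) simp
    then have "1 / sqrt t \<le> 1 / 2" by (intro divide_left_mono) (use t in auto)
    then have "d * d \<le> d * (1 / 2)" unfolding d_def by (intro mult_left_mono) (use t in auto)
    then show ?thesis unfolding d(2)[symmetric] power2_eq_square by simp
  qed
  define c where "c = exp (-4) * d ^ (n - 3)"
  have c: "0 \<le> c" using d by (simp add: c_def)
  have e2: "n - 2 = Suc (n - 3)" and e1: "n - 1 = (n - 3) + 2" using n by auto
  show ?thesis
  proof (rule nn_integral_ge_interval[where a=d and b="2 * d" and h="\<lambda>r. c * (sin (r * t))\<^sup>2"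
        and H="\<lambda>r. c * (r / 2 - sin (2 * (r * t)) / (4 * t))"])
    fix x assume x: "x \<in> {d..2 * d}"
    have sc: "(sin (x * t))\<^sup>2 = (1 - cos (2 * (x * t))) / 2"
      by (simp add: cos_double_sin)
    show "((\<lambda>r. c * (r / 2 - sin (2 * (r * t)) / (4 * t))) has_real_derivative c * (sin (x * t))\<^sup>2) (at x)"
      unfolding sc using t by (auto intro!: derivative_eq_intros simp: field_simps)
    have x0: "0 < x" using x d by auto
    have "x\<^sup>2 \<le> (2 * d)\<^sup>2" using x x0 by (intro power_mono) auto
    then have "x\<^sup>2 * t \<le> (2 * d)\<^sup>2 * t" using t by (intro mult_right_mono) auto
    also have "\<dots> = 4" using d t by (simp add: power_mult_distrib)
    finally have "exp (-4) \<le> exp (- (x\<^sup>2 * t))" by (simp only: exp_le_cancel_iff neg_le_iff_le)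
    also have "\<dots> \<le> decay t x" using t by (intro decay_ge) simp
    finally have "exp (-4) \<le> decay t x" .
    moreover have "d ^ (n - 3) \<le> x ^ (n - 3)" using x d by (intro power_mono) auto
    ultimately have "c \<le> decay t x * x ^ (n - 3)"
      unfolding c_def using d decay_pos[of t x] by (intro mult_mono) auto
    then have "c * (sin (x * t))\<^sup>2 \<le> decay t x * x ^ (n - 3) * (sin (x * t))\<^sup>2"
      by (intro mult_right_mono) auto
    also have "\<dots> = oscillation n t x"
      unfolding oscillation_def e1 power_add using x0 by (simp add: power_divide)
    finally show "c * (sin (x * t))\<^sup>2 \<le> oscillation n t x" .
  next
    have s: "sin (2 * (2 * d * t)) \<le> 1" "-1 \<le> sin (2 * (d * t))" by auto
    have "(2 * d / 2 - sin (2 * (2 * d * t)) / (4 * t)) - (d / 2 - sin (2 * (d * t)) / (4 * t)) \<ge> d / 2 - 1 / (4 * t) - 1 / (4 * t)"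
    proof -
      have "sin (2 * (2 * d * t)) / (4 * t) \<le> 1 / (4 * t)" using s t by (intro divide_right_mono) auto
      moreover have "-1 / (4 * t) \<le> sin (2 * (d * t)) / (4 * t)" using s t by (intro divide_right_mono) auto
      ultimately show ?thesis by simp
    qed
    moreover have "1 / (4 * t) + 1 / (4 * t) = 1 / t / 2" by simp
    ultimately have "d / 4 \<le> (2 * d / 2 - sin (2 * (2 * d * t)) / (4 * t)) - (d / 2 - sin (2 * (d * t)) / (4 * t))"
      using td by linarith
    then have le: "c * (d / 4) \<le> c * ((2 * d / 2 - sin (2 * (2 * d * t)) / (4 * t)) - (d / 2 - sin (2 * (d * t)) / (4 * t)))"
      using c by (intro mult_left_mono)
    have l: "exp (-4) / 4 * d ^ Suc (n - 3) = c * (d / 4)" by (simp add: c_def mult_ac)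
    show "exp (-4) / 4 * (1 / sqrt t) ^ (n - 2) \<le> c * (2 * d / 2 - sin (2 * (2 * d * t)) / (4 * t)) - c * (d / 2 - sin (2 * (d * t)) / (4 * t))"
      unfolding e2 d_def[symmetric] l right_diff_distrib[symmetric] by (rule le)
  qed (use d in \<open>auto intro!: continuous_intros\<close>)
qed

text \<open>The range [1/t, 1/sqrt t] has logarithmic length (ln t)/2, and there r^2 t <= 1. The
  mean 1/2 of sin^2 yields (ln t)/4, and the boundary terms use up at most half of it.\<close>

lemma oscillation_lower_2:
  assumes t: "exp 4 \<le> t"
  shows "ennreal (exp (-1) / 8 * ln t) \<le> (\<integral>\<^sup>+r. indicator {0<..} r * ennreal (oscillation 2 t r) \<partial>lborel)"
proof -
  have t1: "1 < t" using t exp_gt_one[of 4] by linarith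
  have lnt: "4 \<le> ln t" using t t1 ln_ge_iff[of t 4] by simp
  define s where "s = sqrt t"
  have s: "1 < s" "t = s * s" using t1 by (simp_all add: s_def)
  have ts: "1 / t \<le> 1 / s" using s by (simp add: field_simps)
  define c where "c = exp (-1 :: real)"
  have c: "0 \<le> c" by (simp add: c_def)
  define h where "h r = c * (1 / (2 * r) - cos (2 * (r * t)) / (2 * r) + sin (2 * (r * t)) / (4 * r\<^sup>2 * t) - 1 / (4 * r\<^sup>2 * t))" for r
  \<comment> \<open>integration by parts of \<open>sin\<^sup>2 (r t) / r\<close>; \<open>h r\<close> falls short of \<open>c sin\<^sup>2 (r t) / r\<close> by \<open>c (1 - sin (2 r t)) / (4 r\<^sup>2 t)\<close>\<close>
  define H where "H r = c * (ln r / 2 - sin (2 * (r * t)) / (4 * r * t) + 1 / (4 * r * t))" for r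
  show ?thesis
  proof (rule nn_integral_ge_interval[where a="1 / t" and b="1 / s" and h=h and H=H])
    fix x assume x: "x \<in> {1 / t..1 / s}"
    have "0 < 1 / t" using t1 by simp
    then have x0: "0 < x" using x by (metis atLeastAtMost_iff less_le_trans)
    show "(H has_real_derivative h x) (at x)"
      unfolding H_def h_def using x0 t1
      by (auto intro!: derivative_eq_intros simp: field_simps power2_eq_square)
    have "x\<^sup>2 \<le> (1 / s)\<^sup>2" using x x0 by (intro power_mono) auto
    then have "x\<^sup>2 * t \<le> (1 / s)\<^sup>2 * t" using t1 by (intro mult_right_mono) auto
    also have "\<dots> = 1" using s by (simp add: power2_eq_square)
    finally have "c \<le> exp (- (x\<^sup>2 * t))" by (simp only: c_def exp_le_cancel_iff neg_le_iff_le)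
    also have "\<dots> \<le> decay t x" using t1 by (intro decay_ge) simp
    finally have dc: "c \<le> decay t x" .
    have sc: "1 - cos (2 * (x * t)) = 2 * (sin (x * t))\<^sup>2"
      by (simp add: cos_double_sin)
    have "1 / (2 * x) - cos (2 * (x * t)) / (2 * x) + sin (2 * (x * t)) / (4 * x\<^sup>2 * t) - 1 / (4 * x\<^sup>2 * t)
       = (1 - cos (2 * (x * t))) / (2 * x) - (1 - sin (2 * (x * t))) / (4 * x\<^sup>2 * t)"
      by (simp add: diff_divide_distrib)
    also have "\<dots> \<le> (1 - cos (2 * (x * t))) / (2 * x)"
      using x0 t1 by simp
    also have "\<dots> = (sin (x * t))\<^sup>2 / x"
      unfolding sc by simp
    finally have "h x \<le> c * ((sin (x * t))\<^sup>2 / x)"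
      unfolding h_def using c by (intro mult_left_mono) auto
    also have "\<dots> \<le> decay t x * ((sin (x * t))\<^sup>2 / x)"
      using dc x0 by (intro mult_right_mono) auto
    also have "\<dots> = oscillation 2 t x"
      using x0 by (simp add: oscillation_def power_divide power2_eq_square)
    finally show "h x \<le> oscillation 2 t x" .
  next
    \<comment> \<open>The boundary terms of H are nonnegative together at 1/s and at most 1/2 at
      1/t; from ln t >= 4 one gets 1/2 <= ln t / 8.\<close>
    have b1: "sin (2 * (1 / s * t)) / (4 * (1 / s) * t) \<le> 1 / (4 * (1 / s) * t)"
      using s t1 by (intro divide_right_mono) auto
    have b2: "1 / (4 * (1 / t) * t) - sin (2 * (1 / t * t)) / (4 * (1 / t) * t) \<le> 1 / 2"
      using t1 by simp (use sin_ge_minus_one[of "2::real"] in linarith)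
    have lns: "ln (1 / s) / 2 = - ln t / 4"
      using s by (simp add: ln_div ln_mult)
    have lnt': "ln (1 / t) / 2 = - ln t / 2" using t1 by (simp add: ln_div)
    have "ln t / 8 \<le> (ln (1 / s) / 2 - sin (2 * (1 / s * t)) / (4 * (1 / s) * t) + 1 / (4 * (1 / s) * t))
      - (ln (1 / t) / 2 - sin (2 * (1 / t * t)) / (4 * (1 / t) * t) + 1 / (4 * (1 / t) * t))"
      unfolding lns lnt' using b1 b2 lnt by linarith
    from mult_left_mono[OF this c]
    show "exp (-1) / 8 * ln t \<le> H (1 / s) - H (1 / t)"
      unfolding H_def c_def[symmetric] by (simp add: right_diff_distrib)
  next
    have "x \<noteq> 0" if "x \<in> {1 / t..1 / s}" for x
      using that t1 by (auto simp: divide_le_0_iff)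
    then show "continuous_on {1 / t..1 / s} h"
      unfolding h_def using t1 by (intro continuous_intros) auto
  qed (use t1 ts in auto)
qed

lemma sin_ge_half:
  fixes x :: real assumes "0 \<le> x" "x \<le> 1" shows "x / 2 \<le> sin x"
proof -
  have "sin 0 - 0 / 2 \<le> sin x - x / 2"
  proof (rule DERIV_nonneg_imp_nondecreasing[OF assms(1)])
    fix y :: real assume y: "0 \<le> y" "y \<le> x"
    have "\<bar>sin (y / 2)\<bar> \<le> \<bar>y / 2\<bar>" by (rule abs_sin_x_le_abs_x)
    also have "\<dots> \<le> 1 / 2" using y assms by simp
    finally have "(sin (y / 2))\<^sup>2 \<le> (1 / 2)\<^sup>2" using power_mono[of "\<bar>sin (y / 2)\<bar>" "1 / 2" 2] by (simp only: power2_abs abs_ge_zero)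
    moreover have "cos y = 1 - 2 * (sin (y / 2))\<^sup>2" using cos_double_sin[of "y / 2"] by simp
    ultimately have "0 \<le> cos y - 1 / 2" by (simp add: power2_eq_square)
    moreover have "((\<lambda>y. sin y - y / 2) has_real_derivative cos y - 1 / 2) (at y)"
      by (auto intro!: derivative_eq_intros)
    ultimately show "\<exists>d. ((\<lambda>y. sin y - y / 2) has_real_derivative d) (at y) \<and> 0 \<le> d" by blast
  qed
  then show ?thesis by simp
qed

text \<open>On [1/(2 t), 1/t] the quotient sin (r t) / r is at least t/2, and the length 1/(2 t)
  times t^2/4 is t/8.\<close>

lemma oscillation_lower_1:
  assumes t: "2 \<le> t"
  shows "ennreal (exp (-1) / 8 * t) \<le> (\<integral>\<^sup>+r. indicator {0<..} r * ennreal (oscillation 1 t r) \<partial>lborel)"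
proof (rule nn_integral_ge_interval[where a="1 / (2 * t)" and b="1 / t" and h="\<lambda>r. exp (-1) * (t / 2)\<^sup>2" and H="\<lambda>r. exp (-1) * (t / 2)\<^sup>2 * r"])
  fix x assume x: "x \<in> {1 / (2 * t)..1 / t}"
  have "0 < 1 / (2 * t)" using t by simp
  then have x0: "0 < x" using x by (metis atLeastAtMost_iff less_le_trans)
  have xt: "x * t \<le> 1" using x t by (simp add: pos_le_divide_eq)
  have "x\<^sup>2 * t = (x * t) * x" by (simp add: power2_eq_square)
  also have "\<dots> \<le> 1 * 1" using xt x0 x t by (intro mult_mono) (auto intro: order_trans[of _ "1 / t"])
  finally have "exp (-1) \<le> exp (- (x\<^sup>2 * t))" by (simp only: exp_le_cancel_iff neg_le_iff_le mult_1)
  also have "\<dots> \<le> decay t x" using t by (intro decay_ge) simp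
  finally have "exp (-1) \<le> decay t x" .
  moreover have "t / 2 \<le> sin (x * t) / x"
    using sin_ge_half[of "x * t"] xt x0 t by (simp add: pos_le_divide_eq mult.commute)
  ultimately have "exp (-1) * (t / 2)\<^sup>2 \<le> decay t x * (sin (x * t) / x)\<^sup>2"
    using t by (intro mult_mono power_mono) (auto intro: less_imp_le decay_pos)
  then show "exp (-1) * (t / 2)\<^sup>2 \<le> oscillation 1 t x"
    by (simp add: oscillation_def)
  show "((\<lambda>r. exp (-1) * (t / 2)\<^sup>2 * r) has_real_derivative exp (-1) * (t / 2)\<^sup>2) (at x)"
    by (auto intro!: derivative_eq_intros)
qed (use t in \<open>auto simp: field_simps power2_eq_square\<close>)

subsection \<open>Growth of the solution\<close>

definition growth_rate :: "nat \<Rightarrow> real \<Rightarrow> real" where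
  "growth_rate n t = (if n = 1 then sqrt t else if n = 2 then sqrt (ln t) else t powr (- (real n - 2) / 4))"

lemma growth_rate_nonneg: "1 \<le> t \<Longrightarrow> 0 \<le> growth_rate n t"
  by (simp add: growth_rate_def)

lemma growth_rate_sq:
  assumes "1 \<le> t"
  shows "(growth_rate 1 t)\<^sup>2 = t" "(growth_rate 2 t)\<^sup>2 = ln t"
    "3 \<le> n \<Longrightarrow> (growth_rate n t)\<^sup>2 = (1 / sqrt t) ^ (n - 2)"
proof -
  show "(growth_rate 1 t)\<^sup>2 = t" "(growth_rate 2 t)\<^sup>2 = ln t"
    using assms by (simp_all add: growth_rate_def)
  assume n: "3 \<le> n"
  have "(growth_rate n t)\<^sup>2 = (t powr (- (real n - 2) / 4)) powr 2"
    using n assms by (simp add: growth_rate_def)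
  also have "\<dots> = t powr (- (real n - 2) / 2)"
  proof -
    have e: "- (real n - 2) / 4 * 2 = - (real n - 2) / 2" by simp
    show ?thesis by (simp only: powr_powr e)
  qed
  also have "\<dots> = (t powr (- 1 / 2)) powr real (n - 2)"
  proof -
    have "real (n - 2) = real n - 2" using n by (simp add: of_nat_diff)
    then have e: "- 1 / 2 * real (n - 2) = - (real n - 2) / 2" by (simp only:)
    show ?thesis by (simp only: powr_powr e)
  qed
  also have "\<dots> = (t powr (- 1 / 2)) ^ (n - 2)"
    using assms by (intro powr_realpow) simp
  also have "t powr (- 1 / 2) = 1 / sqrt t"
    using assms by (simp add: powr_minus powr_half_sqrt inverse_eq_divide)
  finally show "(growth_rate n t)\<^sup>2 = (1 / sqrt t) ^ (n - 2)" .
qed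

text \<open>The left side is the order of the squared norm of \<open>remainder\<close>, so this is
  its gain of 1/t over the squared growth rate. In dimension 2 the step uses ln t >= 1.\<close>

lemma inverse_sqrt_power_le_growth_rate:
  assumes n: "1 \<le> n" and t: "exp 1 \<le> t"
  shows "(1 / sqrt t) ^ n \<le> (1 / sqrt t)\<^sup>2 * (growth_rate n t)\<^sup>2"
proof -
  have t1: "1 < t" using t exp_gt_one[of 1] by linarith
  have lnt: "1 \<le> ln t" using t t1 ln_ge_iff[of t 1] by simp
  have d: "(1 / sqrt t)\<^sup>2 = 1 / t" using t1 by (simp add: power_divide)
  consider "n = 1" | "n = 2" | "3 \<le> n" using n by linarith
  then show ?thesis
  proof cases
    case 1
    have "1 \<le> sqrt t" using t1 by simp
    then show ?thesis using t1 unfolding 1 growth_rate_sq(1)[OF less_imp_le[OF t1]] d by simp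
  next
    case 2
    show ?thesis using t1 lnt unfolding 2 growth_rate_sq(2)[OF less_imp_le[OF t1]] d by (simp add: divide_right_mono)
  next
    case 3
    then have "n = 2 + (n - 2)" by simp
    then have "(1 / sqrt t) ^ n = (1 / sqrt t)\<^sup>2 * (1 / sqrt t) ^ (n - 2)" by (metis power_add)
    then show ?thesis using growth_rate_sq(3)[OF less_imp_le[OF t1] 3] by simp
  qed
qed

lemma oscillation_two_sided:
  assumes n: "1 \<le> n"
  obtains c C T where "0 < c" "0 < C" "exp 1 \<le> T"
    "\<And>t. T \<le> t \<Longrightarrow> ennreal (c * (growth_rate n t)\<^sup>2) \<le> (\<integral>\<^sup>+r. indicator {0<..} r * ennreal (oscillation n t r) \<partial>lborel)"
    "\<And>t. T \<le> t \<Longrightarrow> (\<integral>\<^sup>+r. indicator {0<..} r * ennreal (oscillation n t r) \<partial>lborel) \<le> ennreal (C * (growth_rate n t)\<^sup>2)"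
proof -
  have e1: "(2::real) \<le> exp 1" using exp_ge_add_one_self[of 1] by simp
  have e4: "exp 1 \<le> exp (4::real)" "(4::real) \<le> exp 4" using exp_ge_add_one_self[of 4] by simp_all
  consider "n = 1" | "n = 2" | "3 \<le> n" using n by linarith
  then show thesis
  proof cases
    case 1
    show thesis
    proof (rule that[of "exp (-1) / 8" 2 "exp 1"])
      fix t :: real assume t: "exp 1 \<le> t"
      then have t1: "2 \<le> t" "1 \<le> t" "0 < t" using e1 by linarith+
      show "ennreal (exp (-1) / 8 * (growth_rate n t)\<^sup>2) \<le> (\<integral>\<^sup>+r. indicator {0<..} r * ennreal (oscillation n t r) \<partial>lborel)"
        unfolding 1 growth_rate_sq(1)[OF t1(2)] by (rule oscillation_lower_1[OF t1(1)])
      show "(\<integral>\<^sup>+r. indicator {0<..} r * ennreal (oscillation n t r) \<partial>lborel) \<le> ennreal (2 * (growth_rate n t)\<^sup>2)"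
        unfolding 1 growth_rate_sq(1)[OF t1(2)] by (rule oscillation_upper_1[OF t1(3)])
    qed auto
  next
    case 2
    show thesis
    proof (rule that[of "exp (-1) / 8" 2 "exp 4"])
      fix t :: real assume t: "exp 4 \<le> t"
      then have t1: "exp 1 \<le> t" "1 \<le> t" using e1 e4 by linarith+
      show "ennreal (exp (-1) / 8 * (growth_rate n t)\<^sup>2) \<le> (\<integral>\<^sup>+r. indicator {0<..} r * ennreal (oscillation n t r) \<partial>lborel)"
        unfolding 2 growth_rate_sq(2)[OF t1(2)] by (rule oscillation_lower_2[OF t])
      show "(\<integral>\<^sup>+r. indicator {0<..} r * ennreal (oscillation n t r) \<partial>lborel) \<le> ennreal (2 * (growth_rate n t)\<^sup>2)"
        unfolding 2 growth_rate_sq(2)[OF t1(2)] by (rule oscillation_upper_2[OF t1(1)])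
    qed (use e4 in auto)
  next
    case 3
    show thesis
    proof (rule that[of "exp (-4) / 4" "1 + real (n - 1) ^ (n - 1)" "exp 4 + real n"])
      show "0 < 1 + real (n - 1) ^ (n - 1)" by (simp add: add_pos_nonneg)
      show "exp 1 \<le> exp 4 + real n" by (rule order_trans[OF e4(1)]) simp
      fix t :: real assume t: "exp 4 + real n \<le> t"
      then have t1: "4 \<le> t" "1 \<le> t" "real (n - 1) \<le> t" using e4 by auto
      show "ennreal (exp (-4) / 4 * (growth_rate n t)\<^sup>2) \<le> (\<integral>\<^sup>+r. indicator {0<..} r * ennreal (oscillation n t r) \<partial>lborel)"
        unfolding growth_rate_sq(3)[OF t1(2) 3] by (rule oscillation_lower_3[OF 3 t1(1)])
      show "(\<integral>\<^sup>+r. indicator {0<..} r * ennreal (oscillation n t r) \<partial>lborel)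
          \<le> ennreal ((1 + real (n - 1) ^ (n - 1)) * (growth_rate n t)\<^sup>2)"
        unfolding growth_rate_sq(3)[OF t1(2) 3] by (rule oscillation_upper_3[OF 3 t1(3)])
    qed (use e4 in \<open>auto intro: add_pos_nonneg\<close>)
  qed
qed

section \<open>Norms of the profile and of the remainder\<close>

definition wave_profile :: "real \<Rightarrow> 'a::euclidean_space \<Rightarrow> complex" where
  "wave_profile t \<xi> = complex_of_real (exp (- damping (norm \<xi>) * t / 2) * (sin (norm \<xi> * t) / norm \<xi>))"

text \<open>It carries half of the damping of \<open>wave_profile\<close>; the other half is spent
  on the frequency error.\<close>

definition remainder :: "real \<Rightarrow> 'a::euclidean_space \<Rightarrow> complex" where
  "remainder t \<xi> = complex_of_real (exp (- damping (norm \<xi>) * t / 4))"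

lemma wave_profile_measurable: "wave_profile t \<in> borel_measurable borel"
  unfolding wave_profile_def[abs_def] by measurable

lemma remainder_measurable: "remainder t \<in> borel_measurable borel"
  unfolding remainder_def[abs_def] by measurable

lemma wave_profile_norm:
  obtains c C T where "0 < c" "0 < C" "exp 1 \<le> T"
    "\<And>t. T \<le> t \<Longrightarrow> (wave_profile t :: 'a::euclidean_space \<Rightarrow> complex) \<in> L2"
    "\<And>t. T \<le> t \<Longrightarrow> c * growth_rate DIM('a) t \<le> L2_norm (wave_profile t :: 'a \<Rightarrow> complex)"
    "\<And>t. T \<le> t \<Longrightarrow> L2_norm (wave_profile t :: 'a \<Rightarrow> complex) \<le> C * growth_rate DIM('a) t"
proof -
  define n where "n = DIM('a)"
  have n: "1 \<le> n" by (simp add: n_def Suc_le_eq)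
  define V where "V = real n * unit_ball_vol n"
  have V: "0 < V" using n by (simp add: V_def)
  obtain c C T where cC: "0 < c" "0 < C" "exp 1 \<le> T"
    and lo: "\<And>t. T \<le> t \<Longrightarrow> ennreal (c * (growth_rate n t)\<^sup>2) \<le> (\<integral>\<^sup>+r. indicator {0<..} r * ennreal (oscillation n t r) \<partial>lborel)"
    and up: "\<And>t. T \<le> t \<Longrightarrow> (\<integral>\<^sup>+r. indicator {0<..} r * ennreal (oscillation n t r) \<partial>lborel) \<le> ennreal (C * (growth_rate n t)\<^sup>2)"
    using oscillation_two_sided[OF n] by blast
  have I: "(\<integral>\<^sup>+\<xi>. ennreal ((cmod (wave_profile t (\<xi> :: 'a)))\<^sup>2) \<partial>lborel)
      = ennreal V * (\<integral>\<^sup>+r. indicator {0<..} r * ennreal (oscillation n t r) \<partial>lborel)" for t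
  proof -
    have e: "(exp (- damping r * t / 2))\<^sup>2 = decay t r" for r
      by (simp add: decay_def flip: exp_double)
    have "(\<integral>\<^sup>+\<xi>. ennreal ((cmod (wave_profile t (\<xi> :: 'a)))\<^sup>2) \<partial>lborel)
       = (\<integral>\<^sup>+\<xi>. ennreal (decay t (norm (\<xi> :: 'a)) * (sin (norm \<xi> * t) / norm \<xi>)\<^sup>2) \<partial>lborel)"
      by (simp only: wave_profile_def norm_of_real power2_abs power_mult_distrib e)
    also have "\<dots> = ennreal V * (\<integral>\<^sup>+r. indicator {0<..} r * ennreal (r ^ (n - 1)) * ennreal (decay t r * (sin (r * t) / r)\<^sup>2) \<partial>lborel)"
      unfolding V_def n_def
      by (rule nn_integral_radial[where g="\<lambda>r. ennreal (decay t r * (sin (r * t) / r)\<^sup>2)"]) measurable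
    also have "(\<integral>\<^sup>+r. indicator {0<..} r * ennreal (r ^ (n - 1)) * ennreal (decay t r * (sin (r * t) / r)\<^sup>2) \<partial>lborel)
       = (\<integral>\<^sup>+r. indicator {0<..} r * ennreal (oscillation n t r) \<partial>lborel)"
      using decay_pos by (intro nn_integral_cong) (auto simp: indicator_def oscillation_def ennreal_mult less_imp_le)
    finally show ?thesis .
  qed
  have key: "wave_profile t \<in> (L2 :: ('a \<Rightarrow> complex) set) \<and> sqrt (V * c) * growth_rate n t \<le> L2_norm (wave_profile t :: 'a \<Rightarrow> complex)
     \<and> L2_norm (wave_profile t :: 'a \<Rightarrow> complex) \<le> sqrt (V * C) * growth_rate n t" if t: "T \<le> t" for t
  proof -
    have "1 < exp (1 :: real)" by simp
    then have t1: "1 \<le> t" using t cC(3) by linarith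
    note g = growth_rate_nonneg[OF t1, of n]
    have "(\<integral>\<^sup>+\<xi>. ennreal ((cmod (wave_profile t (\<xi> :: 'a)))\<^sup>2) \<partial>lborel) \<le> ennreal V * ennreal (C * (growth_rate n t)\<^sup>2)"
      unfolding I by (intro mult_left_mono up t) simp
    also have "\<dots> = ennreal ((sqrt (V * C) * growth_rate n t)\<^sup>2)"
      using V cC by (simp add: ennreal_mult[symmetric] power_mult_distrib mult.assoc)
    finally have u: "(\<integral>\<^sup>+\<xi>. ennreal ((cmod (wave_profile t (\<xi> :: 'a)))\<^sup>2) \<partial>lborel) \<le> ennreal ((sqrt (V * C) * growth_rate n t)\<^sup>2)" .
    have nn: "0 \<le> sqrt (V * C) * growth_rate n t" using g V cC by simp
    note up' = L2_norm_le_nn[OF wave_profile_measurable u nn]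
    have "ennreal ((sqrt (V * c) * growth_rate n t)\<^sup>2) = ennreal V * ennreal (c * (growth_rate n t)\<^sup>2)"
      using V cC by (simp add: ennreal_mult[symmetric] power_mult_distrib mult.assoc)
    also have "\<dots> \<le> ennreal ((L2_norm (wave_profile t :: 'a \<Rightarrow> complex))\<^sup>2)"
      unfolding nn_integral_L2[OF up'(1), symmetric] I by (intro mult_left_mono lo t) simp
    finally have "(sqrt (V * c) * growth_rate n t)\<^sup>2 \<le> (L2_norm (wave_profile t :: 'a \<Rightarrow> complex))\<^sup>2"
      by (subst (asm) ennreal_le_iff) simp_all
    then have "sqrt (V * c) * growth_rate n t \<le> L2_norm (wave_profile t :: 'a \<Rightarrow> complex)"
      by (rule power2_le_imp_le) simp
    with up' show ?thesis by blast
  qed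
  show thesis
    by (rule that[of "sqrt (V * c)" "sqrt (V * C)" T]) (use key V cC in \<open>auto simp: n_def\<close>)
qed

lemma remainder_norm:
  obtains C T where "0 < C" "exp 1 \<le> T"
    "\<And>t. T \<le> t \<Longrightarrow> (remainder t :: 'a::euclidean_space \<Rightarrow> complex) \<in> L2"
    "\<And>t. T \<le> t \<Longrightarrow> L2_norm (remainder t :: 'a \<Rightarrow> complex) \<le> C * (growth_rate DIM('a) t / sqrt t)"
proof -
  define n where "n = DIM('a)"
  have n: "1 \<le> n" by (simp add: n_def Suc_le_eq)
  define V where "V = real n * unit_ball_vol n"
  have V: "0 < V" using n by (simp add: V_def)
  define K where "K = 1 + real (n - 1 + 2) ^ (n - 1 + 2)"
  have K: "0 < K" by (simp add: K_def add_pos_nonneg)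
  define C where "C = sqrt (V * (K * 2 ^ n))"
  have C: "0 < C" using V K by (simp add: C_def)
  \<comment> \<open>The squared remainder is the decay factor at time t/2, whose moment of order n -
    1 requires n + 1 <= t/2.\<close>
  define T where "T = exp 1 + 2 * (real n + 1)"
  have key: "(remainder t :: 'a \<Rightarrow> complex) \<in> L2 \<and> L2_norm (remainder t :: 'a \<Rightarrow> complex) \<le> C * (growth_rate n t / sqrt t)"
    if t: "T \<le> t" for t
  proof -
    define e where "e = exp (1::real)"
    have "2 \<le> e" using exp_ge_add_one_self[of 1] by (simp add: e_def)
    then have "1 \<le> t" "e \<le> t" "real n + 1 \<le> t / 2" "0 < t"
      using t[unfolded T_def, folded e_def] n by (auto simp: field_simps)
    note this[unfolded e_def]
    moreover have "real (n - 1 + 2) = real n + 1" using n by simp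
    ultimately have t1: "1 \<le> t" "exp 1 \<le> t" "real (n - 1 + 2) \<le> t / 2" "0 < t"
      by (simp_all only:)
    have e: "(exp (- damping r * t / 4))\<^sup>2 = decay (t / 2) r" for r
      by (simp add: decay_def flip: exp_double)
    have "(\<integral>\<^sup>+\<xi>. ennreal ((cmod (remainder t (\<xi> :: 'a)))\<^sup>2) \<partial>lborel)
       = (\<integral>\<^sup>+\<xi>. ennreal (decay (t / 2) (norm (\<xi> :: 'a))) \<partial>lborel)"
      by (simp only: remainder_def norm_of_real power2_abs e)
    also have "\<dots> = ennreal V * (\<integral>\<^sup>+r. indicator {0<..} r * ennreal (r ^ (n - 1)) * ennreal (decay (t / 2) r) \<partial>lborel)"
      unfolding V_def n_def by (rule nn_integral_radial[where g="\<lambda>r. ennreal (decay (t / 2) r)"]) measurable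
    also have "(\<integral>\<^sup>+r. indicator {0<..} r * ennreal (r ^ (n - 1)) * ennreal (decay (t / 2) r) \<partial>lborel)
       = (\<integral>\<^sup>+r. indicator {0<..} r * ennreal (r ^ (n - 1) * decay (t / 2) r) \<partial>lborel)"
      using decay_pos by (intro nn_integral_cong) (auto simp: indicator_def ennreal_mult less_imp_le)
    also have "ennreal V * \<dots> \<le> ennreal V * ennreal (K * (1 / sqrt (t / 2)) ^ (n - 1 + 1))"
      unfolding K_def by (intro mult_left_mono decay_moment t1) simp
    also have "\<dots> \<le> ennreal V * ennreal (K * (2 ^ n * ((1 / sqrt t)\<^sup>2 * (growth_rate n t)\<^sup>2)))"
    proof (intro mult_left_mono ennreal_leI)
      \<comment> \<open>Returning from t/2 to t costs at most a factor 2 in the scale, hence 2^n in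
        C.\<close>
      have "sqrt t / 2 \<le> sqrt (t / 2)"
        using t1 by (intro real_le_rsqrt) (simp add: power_divide)
      then have "1 / sqrt (t / 2) \<le> 1 / (sqrt t / 2)"
        using t1 by (intro divide_left_mono) auto
      then have "(1 / sqrt (t / 2)) ^ n \<le> (2 * (1 / sqrt t)) ^ n"
        using t1 by (intro power_mono) auto
      also have "\<dots> = 2 ^ n * (1 / sqrt t) ^ n" by (rule power_mult_distrib)
      also have "\<dots> \<le> 2 ^ n * ((1 / sqrt t)\<^sup>2 * (growth_rate n t)\<^sup>2)"
        by (intro mult_left_mono inverse_sqrt_power_le_growth_rate n t1) simp
      finally show "(1 / sqrt (t / 2)) ^ (n - 1 + 1) \<le> 2 ^ n * ((1 / sqrt t)\<^sup>2 * (growth_rate n t)\<^sup>2)"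
        using n by simp
    qed (use K in auto)
    also have "\<dots> = ennreal ((C * (growth_rate n t / sqrt t))\<^sup>2)"
    proof -
      have "(C * (growth_rate n t / sqrt t))\<^sup>2 = V * (K * (2 ^ n * ((1 / sqrt t)\<^sup>2 * (growth_rate n t)\<^sup>2)))"
        using V K unfolding C_def by (simp add: power_mult_distrib power_divide mult_ac)
      then show ?thesis using V K by (simp only: ennreal_mult[symmetric] less_imp_le) (simp add: ennreal_mult[symmetric])
    qed
    finally have u: "(\<integral>\<^sup>+\<xi>. ennreal ((cmod (remainder t (\<xi> :: 'a)))\<^sup>2) \<partial>lborel) \<le> ennreal ((C * (growth_rate n t / sqrt t))\<^sup>2)" .
    have nn: "0 \<le> C * (growth_rate n t / sqrt t)" using growth_rate_nonneg[OF t1(1), of n] C t1 by simp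
    show ?thesis using L2_norm_le_nn[OF remainder_measurable u nn] by blast
  qed
  show thesis
    by (rule that[of C T]) (use key C in \<open>auto simp: n_def T_def\<close>)
qed

section \<open>Pointwise comparison of a mode with the profile\<close>

lemma sinc_difference:
  assumes r: "0 < r" and t: "0 \<le> t"
  shows "\<bar>sin (frequency r * t) / frequency r - sin (r * t) / r\<bar> \<le> t * r\<^sup>2"
proof -
  define w where "w = frequency r"
  have w: "0 < w" "w \<le> r" "r / 2 \<le> w"
    using frequency_pos[OF r] frequency_le[of r] frequency_ge[of r] r by (auto simp: w_def)
  \<comment> \<open>This follows from (r - w)(r + w) = damping^2 / 4 with damping <= r^2 and r + w
    >= r.\<close>
  have diff: "r - w \<le> r ^ 3 / 4"
  proof -
    have "(r - w) * r \<le> (r - w) * (r + w)" using w by (intro mult_left_mono) auto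
    also have "\<dots> = r\<^sup>2 - w\<^sup>2" by (simp add: power2_eq_square algebra_simps)
    also have "\<dots> = (damping r)\<^sup>2 / 4" using frequency_sq[of r] r by (simp add: w_def)
    also have "\<dots> \<le> (r\<^sup>2)\<^sup>2 / 4" using damping_le_sq[of r] damping_nonneg[of r] by (intro divide_right_mono power_mono) auto
    also have "\<dots> = (r ^ 3 / 4) * r" by (simp add: power2_eq_square power3_eq_cube)
    finally show ?thesis using r by (simp only: mult_le_cancel_right_pos)
  qed
  \<comment> \<open>Changing the frequency in the numerator and in the denominator are separated.
    Each change costs at most t (r - w)/w, and this ratio is at most r^2/2.\<close>
  have split: "sin (w * t) / w - sin (r * t) / r = (sin (w * t) - sin (r * t)) / w + sin (r * t) / r * ((r - w) / w)"
    using w r by (simp add: field_simps)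
  have s1: "\<bar>(sin (w * t) - sin (r * t)) / w\<bar> \<le> t * ((r - w) / w)"
  proof -
    have "sin (w * t) - sin (r * t) = 2 * sin ((w * t - r * t) / 2) * cos ((w * t + r * t) / 2)"
      by (rule sin_diff_sin)
    then have "\<bar>sin (w * t) - sin (r * t)\<bar> = 2 * \<bar>sin ((w * t - r * t) / 2)\<bar> * \<bar>cos ((w * t + r * t) / 2)\<bar>"
      by (simp add: abs_mult)
    also have "\<dots> \<le> 2 * \<bar>(w * t - r * t) / 2\<bar> * 1"
      by (intro mult_mono abs_sin_x_le_abs_x) auto
    also have "\<dots> = t * (r - w)"
    proof -
      have e: "(w * t - r * t) / 2 = - (t * (r - w) / 2)" by (simp add: algebra_simps diff_divide_distrib)
      have "0 \<le> t * (r - w)" using w t by simp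
      then show ?thesis unfolding e abs_minus_cancel by simp
    qed
    finally show ?thesis using w by (simp add: divide_right_mono)
  qed
  have s2: "\<bar>sin (r * t) / r * ((r - w) / w)\<bar> \<le> t * ((r - w) / w)"
    unfolding abs_mult using sinc_bound[OF t, of r] w t by (intro mult_mono) auto
  have rw: "(r - w) / w \<le> r\<^sup>2 / 2"
  proof -
    have "(r - w) / w \<le> (r ^ 3 / 4) / (r / 2)"
      using diff w r by (intro frac_le) auto
    then show ?thesis using r by (simp add: power2_eq_square power3_eq_cube)
  qed
  have "\<bar>sin (w * t) / w - sin (r * t) / r\<bar> \<le> t * ((r - w) / w) + t * ((r - w) / w)"
    unfolding split using s1 s2 abs_triangle_ineq by (rule order_trans[OF _ add_mono, rotated])
  also have "\<dots> \<le> t * (r\<^sup>2 / 2) + t * (r\<^sup>2 / 2)"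
    using rw t by (intro add_mono mult_left_mono) auto
  finally show ?thesis by (simp add: w_def)
qed

text \<open>From |exp (-i x.xi) - 1| <= |x| |xi|. The factor |xi| cancels the singularity of the
  propagator at low frequencies.\<close>

lemma fourier_minus_mean:
  fixes f :: "'a::euclidean_space \<Rightarrow> complex"
  assumes f: "f \<in> L11"
  shows "cmod (fourier f \<xi> - (\<integral>x. f x \<partial>lborel)) \<le> norm \<xi> * L1_norm (\<lambda>x. complex_of_real (1 + norm x) * f x)"
proof -
  have f1: "f \<in> L1" "integrable lborel f" and fw: "integrable lborel (\<lambda>x. (1 + norm x) * cmod (f x))"
    using f by (auto simp: L11_def L1_def)
  note i = fourier_integrable[OF f1(1), of \<xi>]
  have "fourier f \<xi> - (\<integral>x. f x \<partial>lborel) = (\<integral>x. exp (- \<i> * complex_of_real (x \<bullet> \<xi>)) * f x - f x \<partial>lborel)"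
    unfolding fourier_def using i f1 by simp
  also have "cmod \<dots> \<le> (\<integral>x. norm \<xi> * ((1 + norm x) * cmod (f x)) \<partial>lborel)"
  proof (rule order_trans[OF integral_norm_bound], rule integral_mono)
    show "integrable lborel (\<lambda>x. cmod (exp (- \<i> * complex_of_real (x \<bullet> \<xi>)) * f x - f x))"
      using i f1 by auto
    show "integrable lborel (\<lambda>x. norm \<xi> * ((1 + norm x) * cmod (f x)))"
      using fw by simp
    fix x
    have "cmod (exp (- \<i> * complex_of_real (x \<bullet> \<xi>)) - 1) \<le> \<bar>- (x \<bullet> \<xi>)\<bar>"
      using iexp_approx1[of "- (x \<bullet> \<xi>)" 0] by simp
    also have "\<dots> \<le> norm x * norm \<xi>" using Cauchy_Schwarz_ineq2[of x \<xi>] by simp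
    also have "\<dots> \<le> norm \<xi> * (1 + norm x)" by (simp add: algebra_simps)
    finally have "cmod (exp (- \<i> * complex_of_real (x \<bullet> \<xi>)) - 1) * cmod (f x) \<le> norm \<xi> * (1 + norm x) * cmod (f x)"
      by (intro mult_right_mono) auto
    then show "cmod (exp (- \<i> * complex_of_real (x \<bullet> \<xi>)) * f x - f x) \<le> norm \<xi> * ((1 + norm x) * cmod (f x))"
      by (simp add: norm_mult[symmetric] left_diff_distrib mult.assoc del: norm_mult)
  qed
  also have "\<dots> = norm \<xi> * L1_norm (\<lambda>x. complex_of_real (1 + norm x) * f x)"
  proof -
    have "cmod (complex_of_real (1 + norm x) * f x) = (1 + norm x) * cmod (f x)" for x
      unfolding norm_mult norm_of_real by simp
    then show ?thesis unfolding L1_norm_def by (simp only: integral_mult_right_zero)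
  qed
  finally show ?thesis .
qed

lemma mean_le_L1_norm:
  assumes "f \<in> L11"
  shows "cmod (\<integral>x. f x \<partial>lborel) \<le> L1_norm (\<lambda>x. complex_of_real (1 + norm x) * f x)"
proof -
  have i: "integrable lborel f" "integrable lborel (\<lambda>x. (1 + norm x) * cmod (f x))"
    using assms by (auto simp: L11_def L1_def)
  have e: "cmod (complex_of_real (1 + norm x) * f x) = (1 + norm x) * cmod (f x)" for x
    unfolding norm_mult norm_of_real by simp
  have "cmod (\<integral>x. f x \<partial>lborel) \<le> (\<integral>x. cmod (f x) \<partial>lborel)" by (rule integral_norm_bound)
  also have "\<dots> \<le> (\<integral>x. (1 + norm x) * cmod (f x) \<partial>lborel)"
    using i by (intro integral_mono) (auto simp: mult_le_cancel_right1)
  finally show ?thesis unfolding L1_norm_def e .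
qed

text \<open>There are three errors: the part of u0 has a bounded coefficient, the deviation of the
  transform of u1 from its mean is of order r and meets a coefficient at most 2/r, and the frequency
  error is t r^2. The condition t >= 4 permits Bernoulli's inequality with exponent t/4, which
  absorbs the last one.\<close>

lemma wave_mode_asymptotics:
  fixes u0 u1 :: "'a::euclidean_space \<Rightarrow> complex"
  assumes u0: "u0 \<in> L1" and u1: "u1 \<in> L11" and \<xi>: "\<xi> \<noteq> 0" and t: "4 \<le> t"
  shows "cmod (wave_mode t (fourier u0) (fourier u1) \<xi> - (\<integral>x. u1 x \<partial>lborel) * wave_profile t \<xi>)
    \<le> 4 * (L1_norm u0 + L1_norm (\<lambda>x. complex_of_real (1 + norm x) * u1 x)) * cmod (remainder t \<xi>)"
proof -
  define P where "P = (\<integral>x. u1 x \<partial>lborel)"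
  define A where "A = L1_norm u0"
  define B where "B = L1_norm (\<lambda>x. complex_of_real (1 + norm x) * u1 x)"
  define r where "r = norm \<xi>"
  have r: "0 < r" using \<xi> by (simp add: r_def)
  have A: "cmod (fourier u0 \<xi>) \<le> A" "0 \<le> A"
    using fourier_bound[OF u0, of \<xi>] by (auto simp: A_def L1_norm_def)
  have B: "cmod (fourier u1 \<xi> - P) \<le> r * B" unfolding P_def r_def B_def by (rule fourier_minus_mean[OF u1])
  have PB: "cmod P \<le> B" unfolding P_def B_def by (rule mean_le_L1_norm[OF u1])
  have B0: "0 \<le> B" using PB norm_ge_zero[of P] by linarith
  define E where "E = exp (- damping r * t / 2)"
  define s where "s = sin (frequency r * t) / frequency r"
  define s0 where "s0 = sin (r * t) / r"
  have E: "0 < E" by (simp add: E_def)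
  have sb: "\<bar>s\<bar> \<le> 2 / r"
  proof -
    have "\<bar>s\<bar> \<le> 1 / frequency r"
      unfolding s_def using frequency_pos[OF r] by (simp add: divide_right_mono)
    also have "\<dots> \<le> 1 / (r / 2)"
      using frequency_ge[of r] frequency_pos[OF r] r by (intro divide_left_mono) auto
    finally show ?thesis by simp
  qed
  have c1: "\<bar>cos (frequency r * t) + damping r / 2 * s\<bar> \<le> 2"
  proof -
    have "\<bar>damping r / 2 * s\<bar> \<le> r / 2 * (2 / r)"
      unfolding abs_mult using sb damping_le[of r] damping_nonneg[of r] r by (intro mult_mono) auto
    moreover have "r / 2 * (2 / r) = 1" using r by simp
    ultimately show ?thesis
      using abs_cos_le_one[of "frequency r * t"] abs_triangle_ineq[of "cos (frequency r * t)" "damping r / 2 * s"]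
      by linarith
  qed
  \<comment> \<open>In the coefficient p' + damping p of the transform of u0 the two damping terms
    combine to + damping/2 s.\<close>
  have split: "wave_mode t (fourier u0) (fourier u1) \<xi> - P * wave_profile t \<xi>
     = complex_of_real E * (complex_of_real (cos (frequency r * t) + damping r / 2 * s) * fourier u0 \<xi>
        + complex_of_real s * (fourier u1 \<xi> - P) + complex_of_real (s - s0) * P)"
    unfolding wave_mode_def wave_profile_def propagator_def propagator'_def r_def[symmetric]
      E_def[symmetric] s_def[symmetric] s0_def[symmetric]
    by (simp add: algebra_simps)
  have t1: "cmod (complex_of_real (cos (frequency r * t) + damping r / 2 * s) * fourier u0 \<xi>) \<le> 2 * A"
    unfolding norm_mult norm_of_real using c1 A by (intro mult_mono) auto
  have t2: "cmod (complex_of_real s * (fourier u1 \<xi> - P)) \<le> 2 * B"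
  proof -
    have "cmod (complex_of_real s * (fourier u1 \<xi> - P)) \<le> 2 / r * (r * B)"
      unfolding norm_mult norm_of_real using sb B r by (intro mult_mono) auto
    then show ?thesis using r by simp
  qed
  have t3: "cmod (complex_of_real (s - s0) * P) \<le> t * r\<^sup>2 * B"
    unfolding norm_mult norm_of_real s_def s0_def using sinc_difference[OF r, of t] PB t by (intro mult_mono) auto
  have tri: "cmod (x + y + z) \<le> a + b + c" if "cmod x \<le> a" "cmod y \<le> b" "cmod z \<le> c" for x y z a b c
    using that norm_triangle_ineq[of "x + y" z] norm_triangle_ineq[of x y] by linarith
  \<comment> \<open>Y is the inverse of half of the damping in E, so that E Y is the remainder and 4
    Y dominates t r^2.\<close>
  define Y where "Y = exp (damping r * (t / 4))"
  have Y: "1 + t / 4 * r\<^sup>2 \<le> Y" unfolding Y_def using t by (intro exp_damping_ge) simp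
  have EY: "E * Y = cmod (remainder t \<xi>)"
    by (simp add: E_def Y_def remainder_def r_def algebra_simps flip: exp_add)
  have "cmod (wave_mode t (fourier u0) (fourier u1) \<xi> - P * wave_profile t \<xi>) \<le> E * (2 * A + 2 * B + t * r\<^sup>2 * B)"
    unfolding split norm_mult[of "complex_of_real E"] norm_of_real using E
    by (intro mult_mono tri t1 t2 t3) auto
  also have "\<dots> \<le> E * (4 * (A + B) * Y)"
  proof (rule mult_left_mono)
    have "2 * A + 2 * B + t * r\<^sup>2 * B \<le> (A + B) * (4 * (1 + t / 4 * r\<^sup>2))"
      using A B0 t by (simp add: algebra_simps)
    also have "\<dots> \<le> (A + B) * (4 * Y)"
      using Y A B0 by (intro mult_left_mono) auto
    finally show "2 * A + 2 * B + t * r\<^sup>2 * B \<le> 4 * (A + B) * Y" by (simp add: mult_ac)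
  qed (use E in simp)
  also have "\<dots> = 4 * (A + B) * (E * Y)" by (simp add: mult_ac)
  finally show ?thesis unfolding EY P_def A_def B_def .
qed

section \<open>The two-sided estimate for mild solutions\<close>

lemma semigroup_fst_L2:
  assumes "generates energy_space energy_norm wave_domain wave_operator S"
    and "0 \<le> t" "u0 \<in> sobolev 1" "u1 \<in> L2"
  shows "fst (S t (u0, u1)) \<in> L2"
proof -
  interpret C0_semigroup_on energy_space energy_norm S
    by unfold_locales (use assms(1) in \<open>simp add: generates_def\<close>)
  have "S t (u0, u1) \<in> energy_space"
    using assms by (intro S_in) (simp_all add: energy_space_def)
  then show ?thesis using sobolev_1_L2 by (auto simp: energy_space_def)
qed

text \<open>The reverse triangle inequality turns the pointwise comparison into one of norms. That
  comparison concerns Fourier integrals, which agree almost everywhere with the Plancherel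
  transforms because the data lie in both L1 and L2.\<close>

lemma fourier_solution_asymptotics:
  fixes u0 u1 :: "'a::euclidean_space \<Rightarrow> complex"
  assumes u0: "u0 \<in> sobolev 1" "u0 \<in> L1" and u1: "u1 \<in> L2" "u1 \<in> L11" and t: "4 \<le> t"
    and S: "generates energy_space energy_norm wave_domain wave_operator S"
    and H: "(wave_profile t :: 'a \<Rightarrow> complex) \<in> L2" and E: "(remainder t :: 'a \<Rightarrow> complex) \<in> L2"
  defines "P \<equiv> \<integral>x. u1 x \<partial>lborel"
  shows "\<bar>L2_norm (fourier_L2 (fst (S t (u0, u1)))) - cmod P * L2_norm (wave_profile t :: 'a \<Rightarrow> complex)\<bar>
    \<le> 4 * data_size u0 u1 * L2_norm (remainder t :: 'a \<Rightarrow> complex)"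
proof -
  define D where "D = L1_norm u0 + L1_norm (\<lambda>x. complex_of_real (1 + norm x) * u1 x)"
  have D: "0 \<le> D" "D \<le> data_size u0 u1"
    by (auto simp: D_def data_size_def L1_norm_def)
  have t0: "0 \<le> t" using t by simp
  have GL: "fst (S t (u0, u1)) \<in> L2"
    by (rule semigroup_fst_L2[OF S t0 u0(1) u1(1)])
  have FL: "fourier_L2 (fst (S t (u0, u1))) \<in> L2" by (rule fourier_L2_L2[OF GL])
  have u0L: "u0 \<in> L2" by (rule sobolev_1_L2[OF u0(1)])
  have u11: "u1 \<in> L1" using u1(2) by (simp add: L11_def)
  let ?H = "\<lambda>\<xi>::'a. P * wave_profile t \<xi>"
  have HL: "?H \<in> L2" by (rule L2_cmult[OF H])
  let ?E = "\<lambda>\<xi>::'a. complex_of_real (4 * D) * remainder t \<xi>"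
  have "\<bar>L2_norm (fourier_L2 (fst (S t (u0, u1)))) - L2_norm ?H\<bar> \<le> L2_norm (fourier_L2 (fst (S t (u0, u1))) - ?H)"
    by (rule L2_norm_triangle_rev[OF FL HL])
  also have "\<dots> \<le> L2_norm ?E"
  proof (rule L2_norm_mono(2)[OF L2_cmult[OF E]])
    show "fourier_L2 (fst (S t (u0, u1))) - ?H \<in> borel_measurable borel"
      by (rule L2_borel[OF L2_diff[OF FL HL]])
    show "AE \<xi> in lborel. cmod ((fourier_L2 (fst (S t (u0, u1))) - ?H) \<xi>) \<le> cmod (?E \<xi>)"
      using fourier_semigroup_fst[OF u0(1) u1(1) t0 S] fourier_L2_eq_fourier[OF u0(2) u0L]
        fourier_L2_eq_fourier[OF u11 u1(1)] AE_lborel_singleton[of 0]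
    proof eventually_elim
      case (elim \<xi>)
      have "wave_mode t (fourier_L2 u0) (fourier_L2 u1) \<xi> = wave_mode t (fourier u0) (fourier u1) \<xi>"
        by (simp add: wave_mode_def elim)
      moreover have "cmod (complex_of_real (4 * D)) = 4 * D" using D by simp
      moreover note wave_mode_asymptotics[OF u0(2) u1(2) elim(4) t, folded D_def P_def]
      ultimately show ?case
        unfolding minus_apply elim(1) norm_mult[of "complex_of_real (4 * D)"] by (simp only:)
    qed
  qed
  also have "\<dots> = 4 * D * L2_norm (remainder t :: 'a \<Rightarrow> complex)"
    unfolding L2_norm_cmult using D by simp
  also have "\<dots> \<le> 4 * data_size u0 u1 * L2_norm (remainder t :: 'a \<Rightarrow> complex)"
    using D by (intro mult_right_mono) auto
  finally show ?thesis unfolding L2_norm_cmult .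
qed

theorem mild_solution_growth:
  "\<exists>C>0. \<forall>(u0 :: 'a::euclidean_space \<Rightarrow> complex) u1 u.
    u0 \<in> sobolev 1 \<inter> L1 \<and> u1 \<in> L2 \<inter> L11 \<and> mild_solution u0 u1 u \<longrightarrow>
    (\<exists>t0>1. \<forall>t\<ge>t0. C * cmod (\<integral>x. u1 x \<partial>lborel) * growth_rate DIM('a) t \<le> L2_norm (u t) \<and>
       L2_norm (u t) \<le> inverse C * data_size u0 u1 * growth_rate DIM('a) t)"
proof -
  define \<kappa> where "\<kappa> = sqrt ((2 * pi) ^ DIM('a))"
  have \<kappa>: "0 < \<kappa>" by (simp add: \<kappa>_def)
  obtain c C T1 where H: "0 < c" "0 < C" "exp 1 \<le> T1"
    "\<And>t. T1 \<le> t \<Longrightarrow> (wave_profile t :: 'a \<Rightarrow> complex) \<in> L2"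
    "\<And>t. T1 \<le> t \<Longrightarrow> c * growth_rate DIM('a) t \<le> L2_norm (wave_profile t :: 'a \<Rightarrow> complex)"
    "\<And>t. T1 \<le> t \<Longrightarrow> L2_norm (wave_profile t :: 'a \<Rightarrow> complex) \<le> C * growth_rate DIM('a) t"
    using wave_profile_norm[where 'a='a] by blast
  obtain K T2 where E: "0 < K" "exp 1 \<le> T2"
    "\<And>t. T2 \<le> t \<Longrightarrow> (remainder t :: 'a \<Rightarrow> complex) \<in> L2"
    "\<And>t. T2 \<le> t \<Longrightarrow> L2_norm (remainder t :: 'a \<Rightarrow> complex) \<le> K * (growth_rate DIM('a) t / sqrt t)"
    using remainder_norm[where 'a='a] by blast
  \<comment> \<open>The first entry keeps half of the lower profile constant c, divided by the
    Plancherel factor; the second makes \<open>inverse M\<close> at least the upper constant (C + 4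
    K) / \<kappa>.\<close>
  define M where "M = min (c / (2 * \<kappa>)) (\<kappa> / (C + 4 * K))"
  have CK: "0 < C + 4 * K" using H E by simp
  have M: "0 < M" "M \<le> c / (2 * \<kappa>)" "(C + 4 * K) / \<kappa> \<le> inverse M"
  proof -
    show M0: "0 < M" using H \<kappa> CK by (simp add: M_def)
    show "M \<le> c / (2 * \<kappa>)" by (simp add: M_def)
    have "M \<le> \<kappa> / (C + 4 * K)" by (simp add: M_def)
    then have "inverse (\<kappa> / (C + 4 * K)) \<le> inverse M" using M0 by (intro le_imp_inverse_le)
    then show "(C + 4 * K) / \<kappa> \<le> inverse M" by simp
  qed
  show ?thesis
  proof (rule exI[of _ M], intro conjI allI impI M(1))
    fix u0 u1 :: "'a \<Rightarrow> complex" and u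
    assume "u0 \<in> sobolev 1 \<inter> L1 \<and> u1 \<in> L2 \<inter> L11 \<and> mild_solution u0 u1 u"
    then have u0: "u0 \<in> sobolev 1" "u0 \<in> L1" and u1: "u1 \<in> L2" "u1 \<in> L11" and mild: "mild_solution u0 u1 u" by auto
    obtain S where S: "generates energy_space energy_norm wave_domain wave_operator S"
      and uS: "\<And>t. 0 \<le> t \<Longrightarrow> AE x in lborel. u t x = fst (S t (u0, u1)) x"
      using mild unfolding mild_solution_def by blast
    have uL: "u t \<in> L2" if "0 \<le> t" for t
      using mild that unfolding mild_solution_def C1_into_def by blast
    define P where "P = (\<integral>x. u1 x \<partial>lborel)"
    define I where "I = data_size u0 u1"
    \<comment> \<open>In the upper bound the profile enters with the factor |P|; this estimate
      allows it to be expressed by the size of the data.\<close>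
    have PI: "cmod P \<le> I" 
      using mean_le_L1_norm[OF u1(2)] unfolding P_def I_def data_size_def
      by (rule order_trans) (simp add: L1_norm_def)
    have I0: "0 \<le> I" using PI norm_ge_zero[of P] by linarith
    \<comment> \<open>For nonzero P this is the time from which 4 I K / sqrt t <= c |P| / 2, so that
      the error takes at most half of the profile. For P = 0 the quotient is 0 by convention and the
      lower bound is trivial.\<close>
    define T3 where "T3 = (8 * I * K / (c * cmod P))\<^sup>2"
    \<comment> \<open>A sum of nonnegative thresholds dominates each of them; the 4 serves the
      pointwise comparison and gives t0 > 1.\<close>
    define t0 where "t0 = T1 + T2 + T3 + 4"
    have T: "0 < T1" "0 < T2" "0 \<le> T3"
      using less_le_trans[OF exp_gt_zero H(3)] less_le_trans[OF exp_gt_zero E(2)] by (auto simp: T3_def)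
    show "\<exists>t0>1. \<forall>t\<ge>t0. M * cmod (\<integral>x. u1 x \<partial>lborel) * growth_rate DIM('a) t \<le> L2_norm (u t) \<and>
       L2_norm (u t) \<le> inverse M * data_size u0 u1 * growth_rate DIM('a) t"
      unfolding P_def[symmetric] I_def[symmetric]
    proof (intro exI[of _ t0] conjI allI impI)
      show "1 < t0" using T by (simp add: t0_def)
      fix t assume "t0 \<le> t"
      then have t: "T1 \<le> t" "T2 \<le> t" "T3 \<le> t" "4 \<le> t" "0 \<le> t" "1 \<le> t" using T by (auto simp: t0_def)
      define g where "g = growth_rate DIM('a) t"
      have g: "0 \<le> g" unfolding g_def by (rule growth_rate_nonneg[OF t(6)])
      have fL: "fst (S t (u0, u1)) \<in> L2"
        by (rule semigroup_fst_L2[OF S t(5) u0(1) u1(1)])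
      define F where "F = L2_norm (fourier_L2 (fst (S t (u0, u1))))"
      have "L2_norm (u t) = L2_norm (fst (S t (u0, u1)))"
        by (intro L2_norm_cong uS t L2_borel uL fL)
      then have norm_u: "L2_norm (u t) = F / \<kappa>"
        unfolding F_def Plancherel[OF fL] \<kappa>_def[symmetric] using \<kappa> by simp
      have "\<bar>F - cmod P * L2_norm (wave_profile t :: 'a \<Rightarrow> complex)\<bar> \<le> 4 * I * L2_norm (remainder t :: 'a \<Rightarrow> complex)"
        unfolding F_def P_def I_def
        by (rule fourier_solution_asymptotics[OF u0 u1 t(4) S H(4)[OF t(1)] E(3)[OF t(2)]])
      also have "\<dots> \<le> 4 * I * (K * (g / sqrt t))"
        using E(4)[OF t(2)] I0 by (intro mult_left_mono) (auto simp: g_def)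
      finally have est: "\<bar>F - cmod P * L2_norm (wave_profile t :: 'a \<Rightarrow> complex)\<bar> \<le> 4 * I * (K * (g / sqrt t))" .
      have gt: "g / sqrt t \<le> g"
      proof -
        have "1 \<le> sqrt t" using t by simp
        then have "g / sqrt t \<le> g / 1" using g by (intro divide_left_mono) auto
        then show ?thesis by simp
      qed
      have "F \<le> cmod P * L2_norm (wave_profile t :: 'a \<Rightarrow> complex) + 4 * I * (K * (g / sqrt t))"
        using est by linarith
      also have "\<dots> \<le> I * (C * g) + 4 * I * (K * g)"
        using PI H(6)[OF t(1)] gt I0 E(1) g H(2) by (intro add_mono mult_mono mult_left_mono) (auto simp: g_def)
      also have "\<dots> = (C + 4 * K) * (I * g)" by (simp add: algebra_simps)
      finally have "F / \<kappa> \<le> (C + 4 * K) / \<kappa> * (I * g)" using \<kappa> by (simp add: divide_right_mono)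
      also have "\<dots> \<le> inverse M * (I * g)"
        using M(3) I0 g by (intro mult_right_mono) auto
      finally show "L2_norm (u t) \<le> inverse M * I * growth_rate DIM('a) t"
        unfolding norm_u g_def by (simp add: mult.assoc)
      show "M * cmod P * growth_rate DIM('a) t \<le> L2_norm (u t)"
      proof (cases "P = 0")
        case True
        then show ?thesis by simp
      next
        case False
        then have cP: "0 < c * cmod P" using H by simp
        have "8 * I * K / (c * cmod P) \<le> sqrt t"
          using t(3) by (intro real_le_rsqrt) (simp add: T3_def)
        then have "8 * I * K \<le> sqrt t * (c * cmod P)"
          using cP by (simp add: pos_divide_le_eq)
        then have "4 * I * K / sqrt t \<le> c * cmod P / 2"
          using t by (simp add: pos_divide_le_eq mult_ac)
        from mult_right_mono[OF this g] have small: "4 * I * (K * (g / sqrt t)) \<le> c * cmod P / 2 * g"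
          by (simp add: mult_ac)
        have "cmod P * (c * g) \<le> cmod P * L2_norm (wave_profile t :: 'a \<Rightarrow> complex)"
          using H(5)[OF t(1)] by (intro mult_left_mono) (auto simp: g_def)
        moreover have "cmod P * (c * g) = 2 * (c * cmod P / 2 * g)" by simp
        ultimately have "c * cmod P / 2 * g \<le> F" using est small by linarith
        then have "c / (2 * \<kappa>) * (cmod P * g) \<le> F / \<kappa>"
          using \<kappa> by (simp add: field_simps)
        moreover have "M * (cmod P * g) \<le> c / (2 * \<kappa>) * (cmod P * g)"
          using M(2) g by (intro mult_right_mono) auto
        ultimately show ?thesis unfolding norm_u g_def by (simp add: mult.assoc)
      qed
    qed
  qed
qed

text \<open>A finite index type is nonempty, so \<open>CARD('n)\<close> ranges over all dimensions n
  >= 1; the three rates are the branches of \<open>growth_rate\<close>.\<close>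

theorem theorem1p2:
  shows "\<exists>C>0. \<forall>(u0 :: real ^ 'n \<Rightarrow> complex) u1 u.
    u0 \<in> sobolev 1 \<inter> L1 \<and> u1 \<in> L2 \<inter> L11 \<and> mild_solution u0 u1 u \<longrightarrow>
    (let P1 = (\<integral>x. u1 x \<partial>lborel); I0 = data_size u0 u1; n = CARD('n) in
     \<exists>t0>1. \<forall>t\<ge>t0.
       (n \<ge> 3 \<longrightarrow>
          C * cmod P1 * t powr (- (real n - 2) / 4) \<le> L2_norm (u t) \<and>
          L2_norm (u t) \<le> inverse C * I0 * t powr (- (real n - 2) / 4)) \<and>
       (n = 2 \<longrightarrow>
          C * cmod P1 * sqrt (ln t) \<le> L2_norm (u t) \<and>
          L2_norm (u t) \<le> inverse C * I0 * sqrt (ln t)) \<and>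
       (n = 1 \<longrightarrow>
          C * cmod P1 * sqrt t \<le> L2_norm (u t) \<and>
          L2_norm (u t) \<le> inverse C * I0 * sqrt t))"
proof -
  have dim: "DIM(real ^ 'n) = CARD('n)" by simp
  obtain C where C: "C > 0" and growth: "\<And>(u0 :: real ^ 'n \<Rightarrow> complex) u1 u.
    u0 \<in> sobolev 1 \<inter> L1 \<and> u1 \<in> L2 \<inter> L11 \<and> mild_solution u0 u1 u \<Longrightarrow>
    \<exists>t0>1. \<forall>t\<ge>t0. C * cmod (\<integral>x. u1 x \<partial>lborel) * growth_rate CARD('n) t \<le> L2_norm (u t) \<and>
       L2_norm (u t) \<le> inverse C * data_size u0 u1 * growth_rate CARD('n) t"
    using mild_solution_growth[where 'a="real ^ 'n"] unfolding dim by blast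
  show ?thesis
  proof (rule exI[of _ C], intro conjI allI impI C)
    fix u0 u1 :: "real ^ 'n \<Rightarrow> complex" and u
    assume "u0 \<in> sobolev 1 \<inter> L1 \<and> u1 \<in> L2 \<inter> L11 \<and> mild_solution u0 u1 u"
    from growth[OF this] obtain t0 where t0: "t0 > 1"
      "\<And>t. t \<ge> t0 \<Longrightarrow> C * cmod (\<integral>x. u1 x \<partial>lborel) * growth_rate CARD('n) t \<le> L2_norm (u t) \<and>
       L2_norm (u t) \<le> inverse C * data_size u0 u1 * growth_rate CARD('n) t"
      by blast
    have rates: "growth_rate CARD('n) t = t powr (- (real CARD('n) - 2) / 4)" if "CARD('n) \<ge> 3" for t
      using that by (simp add: growth_rate_def)
    have rates': "CARD('n) = 2 \<Longrightarrow> growth_rate CARD('n) t = sqrt (ln t)"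
      "CARD('n) = 1 \<Longrightarrow> growth_rate CARD('n) t = sqrt t" for t
      by (simp_all add: growth_rate_def)
    show "let P1 = (\<integral>x. u1 x \<partial>lborel); I0 = data_size u0 u1; n = CARD('n) in
     \<exists>t0>1. \<forall>t\<ge>t0.
       (n \<ge> 3 \<longrightarrow>
          C * cmod P1 * t powr (- (real n - 2) / 4) \<le> L2_norm (u t) \<and>
          L2_norm (u t) \<le> inverse C * I0 * t powr (- (real n - 2) / 4)) \<and>
       (n = 2 \<longrightarrow>
          C * cmod P1 * sqrt (ln t) \<le> L2_norm (u t) \<and>
          L2_norm (u t) \<le> inverse C * I0 * sqrt (ln t)) \<and>
       (n = 1 \<longrightarrow>
          C * cmod P1 * sqrt t \<le> L2_norm (u t) \<and>
          L2_norm (u t) \<le> inverse C * I0 * sqrt t)"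
      unfolding Let_def
    proof (intro exI[of _ t0] conjI allI impI t0(1))
      fix t assume t: "t0 \<le> t"
      note b = t0(2)[OF t]
      {
        assume n: "CARD('n) \<ge> 3"
        show "C * cmod (\<integral>x. u1 x \<partial>lborel) * t powr (- (real CARD('n) - 2) / 4) \<le> L2_norm (u t)"
          "L2_norm (u t) \<le> inverse C * data_size u0 u1 * t powr (- (real CARD('n) - 2) / 4)"
          using b unfolding rates[OF n] by auto
      next
        assume n: "CARD('n) = 2"
        show "C * cmod (\<integral>x. u1 x \<partial>lborel) * sqrt (ln t) \<le> L2_norm (u t)"
          "L2_norm (u t) \<le> inverse C * data_size u0 u1 * sqrt (ln t)"
          using b unfolding rates'(1)[OF n] by auto
      next
        assume n: "CARD('n) = 1"
        show "C * cmod (\<integral>x. u1 x \<partial>lborel) * sqrt t \<le> L2_norm (u t)"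
          "L2_norm (u t) \<le> inverse C * data_size u0 u1 * sqrt t"
          using b unfolding rates'(2)[OF n] by auto
      }
    qed
  qed
qed

end
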